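(* (Integral 2, generating function.) Let $n\ge1$, $q\ge0$ be integers, let $x=(x_1<\dots<x_n)$ and $y=(y_1<\dots<y_n)$ be strictly increasing tuples of nonnegative integers, and let $\lambda,\mu$ be the partitions with at most $n$ rows given by $\lambda_{n-j+1}=x_j-j+1$, $\mu_{n-j+1}=y_j-j+1$ for $j=1,\dots,n$. Let $b^{(k)}_{xy}$ be the number of ways that $n$ non-intersecting walkers in $\mathbb Z$ move during $q+k$ instants from $x_1<\dots<x_n$ to $y_1<\dots<y_n$, where at each of the instants $1,\dots,q$ walkers may move one step to the right or stay put, and at each of the instants $q+1,\dots,q+k$ exactly one walker moves, one step to the left; the total number of effective moves is then $2k+\sum_{i=1}^n(y_i-x_i)$. Then $$\sum_{k\ge0}\frac{z^k}{k!}b^{(k)}_{xy}=\int_{U(n)}\mathbf s_\lambda(M)\mathbf s_\mu(\bar M)\det(I+M)^qe^{z\operatorname{Tr}\bar M}\,dM=:a_{\lambda\mu}(z).$$ Furthermore, a generating function for the $a_{\lambda\mu}$'s is $$\sum_{\lambda,\mu:\ \lambda_1^\top,\mu_1^\top\le n}a_{\lambda\mu}(z)\,\mathbf s_\lambda(t)\,\mathbf s_\mu(-s)=\int_{U(n)}\det(I+M)^qe^{z\operatorname{Tr}\bar M}e^{\sum_{i\ge1}\operatorname{Tr}(t_iM^i-s_i\bar M^i)}\,dM.$$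
   Context: $dM$ is normalized Haar measure on the unitary group $U(n)$, $\bar M$ the complex conjugate of $M$. The elementary Schur polynomials are defined by $e^{\sum_{i\ge1}t_iz^i}=\sum_{k\ge0}\mathbf s_k(t)z^k$, $\mathbf s_k=0$ for $k<0$; $\mathbf s_\lambda(t)=\det(\mathbf s_{\lambda_i-i+j}(t))$. For a matrix $M$, $\mathbf s_\lambda(M):=\mathbf s_\lambda(\operatorname{Tr}M,\frac12\operatorname{Tr}M^2,\dots)$, i.e. the Schur function of the eigenvalues of $M$. $\lambda_1^\top$ is the number of rows of $\lambda$. The last identity is one of formal power series in $t=(t_1,t_2,\dots)$, $s=(s_1,s_2,\dots)$. Walks: at an instant where walkers "may move one step to the right or stay put", any subset of the walkers (possibly empty) moves simultaneously one unit to the right. Non-intersecting means that after each instant the positions are strictly increasing. The number of effective moves counts all individual unit moves made by all walkers (two walkers moving simultaneously count for two, a walker staying put contributes nothing). *)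

theory Defs
  imports
    "Jordan_Normal_Form.Determinant"
    "HOL-Library.Poly_Mapping"
    "HOL-Computational_Algebra.Formal_Power_Series"
    "HOL-Probability.Probability"
begin

section \<open>Formal power series in arbitrarily many variables\<close>

text \<open>
  A monomial in variables of type \<open>'v\<close> is a finitely supported exponent vector; a formal power
  series is an arbitrary assignment of complex coefficients to monomials.
\<close>

typedef 'v mfps = "UNIV :: (('v \<Rightarrow>\<^sub>0 nat) \<Rightarrow> complex) set"
  morphisms mcoeff Abs_mfps ..

lemma mcoeff_Abs [simp]: "mcoeff (Abs_mfps f) = f"
  by (simp add: Abs_mfps_inverse)

lemma mfps_eqI: "(\<And>m. mcoeff f m = mcoeff g m) \<Longrightarrow> f = g"
  by (metis ext mcoeff_inject)

definition splits :: "('v \<Rightarrow>\<^sub>0 nat) \<Rightarrow> (('v \<Rightarrow>\<^sub>0 nat) \<times> ('v \<Rightarrow>\<^sub>0 nat)) set" where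
  "splits m = {(a, b). a + b = m}"

lemma finite_splits [simp]: "finite (splits m)"
proof -
  let ?K = "Poly_Mapping.keys m"
  let ?r = "\<lambda>a::'a \<Rightarrow>\<^sub>0 nat. restrict (Poly_Mapping.lookup a) ?K"
  let ?A = "fst ` splits m"
  have le: "Poly_Mapping.lookup a v \<le> Poly_Mapping.lookup m v" if "a \<in> ?A" for a v
    using that by (auto simp: splits_def lookup_add)
  have "?r ` ?A \<subseteq> (\<Pi>\<^sub>E v\<in>?K. {..Poly_Mapping.lookup m v})"
  proof
    fix r assume "r \<in> ?r ` ?A"
    then obtain a where a: "a \<in> ?A" "r = ?r a" by blast
    show "r \<in> (\<Pi>\<^sub>E v\<in>?K. {..Poly_Mapping.lookup m v})"
      unfolding a(2) by (rule restrict_PiE_iff[THEN iffD2]) (simp add: le[OF a(1)])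
  qed
  moreover have "finite (\<Pi>\<^sub>E v\<in>?K. {..Poly_Mapping.lookup m v})"
    by (intro finite_PiE) auto
  ultimately have "finite (?r ` ?A)"
    by (rule finite_subset)
  moreover have "inj_on ?r ?A"
  proof (rule inj_onI)
    fix a b assume ab: "a \<in> ?A" "b \<in> ?A" "?r a = ?r b"
    show "a = b"
    proof (rule poly_mapping_eqI)
      fix v show "Poly_Mapping.lookup a v = Poly_Mapping.lookup b v"
      proof (cases "v \<in> ?K")
        case True
        then show ?thesis using fun_cong[OF ab(3), of v] by simp
      next
        case False
        then have "Poly_Mapping.lookup m v = 0" by (simp add: in_keys_iff)
        then show ?thesis using le[OF ab(1), of v] le[OF ab(2), of v] by simp
      qed
    qed
  qed
  ultimately have "finite ?A" by (rule finite_imageD)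
  moreover have "splits m \<subseteq> (\<lambda>a. (a, m - a)) ` ?A"
    by (force simp: splits_def image_iff)
  ultimately show ?thesis
    by (meson finite_imageI finite_subset)
qed

instantiation mfps :: (type) comm_ring_1
begin

definition "0 = Abs_mfps (\<lambda>_. 0)"
definition "1 = Abs_mfps (\<lambda>m. if m = 0 then 1 else 0)"
definition "f + g = Abs_mfps (\<lambda>m. mcoeff f m + mcoeff g m)"
definition "f - g = Abs_mfps (\<lambda>m. mcoeff f m - mcoeff g m)"
definition "- f = Abs_mfps (\<lambda>m. - mcoeff f m)"
definition "f * g = Abs_mfps (\<lambda>m. \<Sum>(a, b)\<in>splits m. mcoeff f a * mcoeff g b)"

lemma mcoeff_0 [simp]: "mcoeff 0 m = 0"
  and mcoeff_1: "mcoeff 1 m = (if m = 0 then 1 else 0)"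
  and mcoeff_add [simp]: "mcoeff (f + g) m = mcoeff f m + mcoeff g m"
  and mcoeff_diff [simp]: "mcoeff (f - g) m = mcoeff f m - mcoeff g m"
  and mcoeff_uminus [simp]: "mcoeff (- f) m = - mcoeff f m"
  and mcoeff_mult: "mcoeff (f * g) m = (\<Sum>(a, b)\<in>splits m. mcoeff f a * mcoeff g b)"
  by (simp_all add: zero_mfps_def one_mfps_def plus_mfps_def minus_mfps_def uminus_mfps_def
      times_mfps_def)

instance
proof
  fix f g h :: "'a mfps"
  show "f * g * h = f * (g * h)"
  proof (rule mfps_eqI)
    fix m
    have "mcoeff (f * g * h) m = (\<Sum>x\<in>splits m. \<Sum>y\<in>splits (fst x).
        mcoeff f (fst y) * mcoeff g (snd y) * mcoeff h (snd x))"
      by (simp add: mcoeff_mult sum_distrib_right case_prod_unfold)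
    also have "\<dots> = (\<Sum>(x, y)\<in>(SIGMA x:splits m. splits (fst x)).
        mcoeff f (fst y) * mcoeff g (snd y) * mcoeff h (snd x))"
      by (rule sum.Sigma) auto
    also have "\<dots> = (\<Sum>(x, y)\<in>(SIGMA x:splits m. splits (snd x)).
        mcoeff f (fst x) * mcoeff g (fst y) * mcoeff h (snd y))"
      by (rule sum.reindex_bij_witness
          [where i = "\<lambda>((a, p), (b, c)). ((a + b, c), (a, b))"
             and j = "\<lambda>((p, c), (a, b)). ((a, b + c), (b, c))"])
        (auto simp: splits_def add.assoc)
    also have "\<dots> = (\<Sum>x\<in>splits m. \<Sum>y\<in>splits (snd x).
        mcoeff f (fst x) * mcoeff g (fst y) * mcoeff h (snd y))"
      by (rule sum.Sigma[symmetric]) auto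
    also have "\<dots> = mcoeff (f * (g * h)) m"
      by (simp add: mcoeff_mult sum_distrib_left case_prod_unfold mult.assoc)
    finally show "mcoeff (f * g * h) m = mcoeff (f * (g * h)) m" .
  qed
  show "f * g = g * f"
  proof (rule mfps_eqI)
    fix m
    show "mcoeff (f * g) m = mcoeff (g * f) m"
      unfolding mcoeff_mult
      by (rule sum.reindex_bij_witness[where i = prod.swap and j = prod.swap])
        (auto simp: splits_def add.commute mult.commute)
  qed
  show "1 * f = f"
  proof (rule mfps_eqI)
    fix m
    have "mcoeff (1 * f) m = (\<Sum>(a, b)\<in>{(0, m)}. mcoeff 1 a * mcoeff f b)"
      unfolding mcoeff_mult
      by (rule sum.mono_neutral_right[OF finite_splits])
        (auto simp: splits_def mcoeff_1 split: if_splits)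
    then show "mcoeff (1 * f) m = mcoeff f m" by (simp add: mcoeff_1)
  qed
  show "(f + g) * h = f * h + g * h"
    by (rule mfps_eqI) (simp add: mcoeff_mult case_prod_unfold algebra_simps sum.distrib)
  show "(0::'a mfps) \<noteq> 1"
    by (metis mcoeff_0 mcoeff_1 zero_neq_one)
qed (auto intro!: mfps_eqI simp: add.assoc add.commute)

end

instantiation mfps :: (type) real_algebra_1
begin

definition "r *\<^sub>R f = Abs_mfps (\<lambda>m. r *\<^sub>R mcoeff f m)"

lemma mcoeff_scaleR [simp]: "mcoeff (r *\<^sub>R f) m = r *\<^sub>R mcoeff f m"
  by (simp add: scaleR_mfps_def)

instance
  by standard
    (auto intro!: mfps_eqI simp: scaleR_add_right scaleR_add_left mcoeff_mult
      scaleR_sum_right case_prod_unfold)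

end

definition mfps_const :: "complex \<Rightarrow> 'v mfps" where
  "mfps_const c = Abs_mfps (\<lambda>m. if m = 0 then c else 0)"

definition mfps_var :: "'v \<Rightarrow> 'v mfps" where
  "mfps_var v = Abs_mfps (\<lambda>m. if m = Poly_Mapping.single v 1 then 1 else 0)"

text \<open>
  Infinite sums of formal power series: every monomial receives a contribution from only finitely
  many summands.
\<close>

definition mfps_has_sum :: "('b \<Rightarrow> 'v mfps) \<Rightarrow> 'b set \<Rightarrow> 'v mfps \<Rightarrow> bool" where
  "mfps_has_sum f A S \<longleftrightarrow>
     (\<forall>m. finite {i\<in>A. mcoeff (f i) m \<noteq> 0} \<and>
          mcoeff S m = (\<Sum>i | i \<in> A \<and> mcoeff (f i) m \<noteq> 0. mcoeff (f i) m))"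

definition mfps_infsum :: "('b \<Rightarrow> 'v mfps) \<Rightarrow> 'b set \<Rightarrow> 'v mfps" where
  "mfps_infsum f A = Abs_mfps (\<lambda>m. \<Sum>i | i \<in> A \<and> mcoeff (f i) m \<noteq> 0. mcoeff (f i) m)"

definition mfps_exp :: "'v mfps \<Rightarrow> 'v mfps" where
  "mfps_exp f = mfps_infsum (\<lambda>j. (1 / fact j) *\<^sub>R f ^ j) UNIV"

definition mfps_integral :: "'b measure \<Rightarrow> ('b \<Rightarrow> 'v mfps) \<Rightarrow> 'v mfps" where
  "mfps_integral H F = Abs_mfps (\<lambda>m. LINT M|H. mcoeff (F M) m)"

text \<open>The exponential series is a legitimate sum when the constant term vanishes.\<close>

definition mdegree :: "('v \<Rightarrow>\<^sub>0 nat) \<Rightarrow> nat" where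
  "mdegree m = (\<Sum>v\<in>Poly_Mapping.keys m. Poly_Mapping.lookup m v)"

lemma mdegree_superset:
  assumes "finite K" "Poly_Mapping.keys m \<subseteq> K"
  shows "mdegree m = (\<Sum>v\<in>K. Poly_Mapping.lookup m v)"
  unfolding mdegree_def by (rule sum.mono_neutral_left) (use assms in \<open>auto simp: in_keys_iff\<close>)

lemma mdegree_add: "mdegree (a + b) = mdegree a + mdegree b"
proof -
  let ?K = "Poly_Mapping.keys a \<union> Poly_Mapping.keys b"
  have "mdegree (a + b) = (\<Sum>v\<in>?K. Poly_Mapping.lookup (a + b) v)"
    by (rule mdegree_superset) (auto simp: in_keys_iff lookup_add)
  also have "\<dots> = (\<Sum>v\<in>?K. Poly_Mapping.lookup a v) + (\<Sum>v\<in>?K. Poly_Mapping.lookup b v)"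
    by (simp add: lookup_add sum.distrib)
  also have "\<dots> = mdegree a + mdegree b"
    by (simp add: mdegree_superset[of ?K])
  finally show ?thesis .
qed

lemma mdegree_eq_0: "mdegree m = 0 \<Longrightarrow> m = 0"
  by (rule poly_mapping_eqI) (auto simp: mdegree_def in_keys_iff)

lemma mcoeff_power_eq_0:
  assumes "mcoeff f 0 = 0" "mdegree m < j"
  shows "mcoeff (f ^ j) m = 0"
  using assms(2)
proof (induction j arbitrary: m)
  case (Suc j)
  have "mcoeff f a * mcoeff (f ^ j) b = 0" if "a + b = m" for a b
  proof (cases "a = 0")
    case False
    then have "0 < mdegree a" using mdegree_eq_0 by blast
    then have "mdegree b < j" using Suc.prems mdegree_add[of a b] that by simp
    then show ?thesis by (simp add: Suc.IH)
  qed (simp add: assms(1))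
  then show ?case by (auto simp: mcoeff_mult splits_def intro!: sum.neutral)
qed simp

lemma mfps_has_sum_exp:
  assumes "mcoeff f 0 = 0"
  shows "mfps_has_sum (\<lambda>j. (1 / fact j) *\<^sub>R f ^ j) UNIV (mfps_exp f)"
proof -
  have "{j. mcoeff ((1 / fact j) *\<^sub>R f ^ j) m \<noteq> 0} \<subseteq> {..mdegree m}" for m
  proof
    fix j assume "j \<in> {j. mcoeff ((1 / fact j) *\<^sub>R f ^ j) m \<noteq> 0}"
    then have "mcoeff (f ^ j) m \<noteq> 0" by auto
    then show "j \<in> {..mdegree m}"
      using mcoeff_power_eq_0[OF assms] by (meson atMost_iff not_le)
  qed
  then show ?thesis
    by (auto simp: mfps_has_sum_def mfps_exp_def mfps_infsum_def intro: finite_subset)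
qed


section \<open>Partitions and Schur polynomials\<close>

text \<open>A partition \<open>\<lambda>\<^sub>1 \<ge> \<lambda>\<^sub>2 \<ge> \<dots>\<close> is stored with indices shifted by one: \<open>la i\<close> is \<open>\<lambda>\<^bsub>i+1\<^esub>\<close>.\<close>

definition is_partition :: "(nat \<Rightarrow> nat) \<Rightarrow> bool" where
  "is_partition la \<longleftrightarrow> antimono la \<and> finite {i. la i \<noteq> 0}"

definition num_rows :: "(nat \<Rightarrow> nat) \<Rightarrow> nat" where
  "num_rows la = card {i. la i \<noteq> 0}"

definition partitions_rows_le :: "nat \<Rightarrow> (nat \<Rightarrow> nat) set" where
  "partitions_rows_le n = {la. is_partition la \<and> num_rows la \<le> n}"

text \<open>
  The coefficient of \<open>z\<^sup>k\<close> in \<open>exp (\<Sum>i\<ge>1. t\<^sub>i z\<^sup>i)\<close>, zero for negative \<open>k\<close>. The value \<open>t 0\<close> is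
  ignored. The coefficient ring is left open so that \<open>t\<close> can consist of complex numbers or of
  formal power series.
\<close>

definition elem_schur :: "(nat \<Rightarrow> 'a::{comm_ring_1,real_algebra_1}) \<Rightarrow> int \<Rightarrow> 'a" where
  "elem_schur t k = (if k < 0 then 0 else
     fps_nth (fps_compose (Abs_fps (\<lambda>j. of_real (1 / fact j)))
                          (Abs_fps (\<lambda>i. if i = 0 then 0 else t i))) (nat k))"

definition schur :: "(nat \<Rightarrow> 'a::{comm_ring_1,real_algebra_1}) \<Rightarrow> (nat \<Rightarrow> nat) \<Rightarrow> 'a" where
  "schur t la = Determinant.det (Matrix.mat (num_rows la) (num_rows la)
     (\<lambda>(i, j). elem_schur t (int (la i) - int i + int j)))"


section \<open>The unitary group\<close>

definition mat_cnj :: "complex^'n^'m \<Rightarrow> complex^'n^'m" where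
  "mat_cnj M = map_matrix cnj M"

definition mat_pow :: "'a::semiring_1^'n^'n \<Rightarrow> nat \<Rightarrow> 'a^'n^'n" where
  "mat_pow M i = (((**) M) ^^ i) (Finite_Cartesian_Product.mat 1)"

definition unitary_group :: "(complex^'n^'n) set" where
  "unitary_group = {M. M ** Finite_Cartesian_Product.transpose (mat_cnj M) = Finite_Cartesian_Product.mat 1}"

definition normalized_haar :: "(complex^'n^'n) measure \<Rightarrow> bool" where
  "normalized_haar H \<longleftrightarrow>
     prob_space H \<and> sets H = sets (restrict_space borel unitary_group) \<and>
     (\<forall>g\<in>unitary_group. distr H H (\<lambda>M. g ** M) = H)"

definition schur_mat :: "(nat \<Rightarrow> nat) \<Rightarrow> complex^'n^'n \<Rightarrow> complex" where
  "schur_mat la M = schur (\<lambda>i. Determinants.trace (mat_pow M i) / of_nat i) la"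

definition a_coeff ::
    "(complex^'n^'n) measure \<Rightarrow> nat \<Rightarrow> (nat \<Rightarrow> nat) \<Rightarrow> (nat \<Rightarrow> nat) \<Rightarrow> complex \<Rightarrow> complex" where
  "a_coeff H q la mu z =
     (LINT M|H. schur_mat la M * schur_mat mu (mat_cnj M)
        * Determinants.det (Finite_Cartesian_Product.mat 1 + M) ^ q
        * exp (z * Determinants.trace (mat_cnj M)))"

text \<open>
  The generating function uses variables of type \<open>nat + nat\<close>; those with index 0 never occur.
\<close>

definition t_var :: "nat \<Rightarrow> (nat + nat) mfps" where
  "t_var i = mfps_var (Inl i)"

definition s_var :: "nat \<Rightarrow> (nat + nat) mfps" where
  "s_var i = mfps_var (Inr i)"

definition power_trace_form :: "complex^'n^'n \<Rightarrow> (nat + nat) mfps" where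
  "power_trace_form M = mfps_infsum
     (\<lambda>i. mfps_const (Determinants.trace (mat_pow M i)) * t_var i
        - mfps_const (Determinants.trace (mat_pow (mat_cnj M) i)) * s_var i) {1..}"


section \<open>Non-intersecting walkers\<close>

text \<open>A configuration is the list of the positions of the walkers, from left to right.\<close>

definition right_step :: "int list \<Rightarrow> int list \<Rightarrow> bool" where
  "right_step c d \<longleftrightarrow> length d = length c \<and> (\<forall>i<length c. d ! i = c ! i \<or> d ! i = c ! i + 1)"

definition left_step :: "int list \<Rightarrow> int list \<Rightarrow> bool" where
  "left_step c d \<longleftrightarrow> (\<exists>i<length c. d = c[i := c ! i - 1])"

text \<open>A walk of \<open>q + k\<close> instants is the list of its \<open>q + k + 1\<close> successive configurations.\<close>

definition walks :: "nat \<Rightarrow> nat \<Rightarrow> nat list \<Rightarrow> nat list \<Rightarrow> int list list set" where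
  "walks q k x y = {w. length w = q + k + 1 \<and> w ! 0 = map int x \<and> w ! (q + k) = map int y
     \<and> (\<forall>c\<in>set w. sorted_wrt (<) c)
     \<and> (\<forall>m<q. right_step (w ! m) (w ! Suc m))
     \<and> (\<forall>m\<in>{q..<q + k}. left_step (w ! m) (w ! Suc m))}"

definition num_walks :: "nat \<Rightarrow> nat \<Rightarrow> nat list \<Rightarrow> nat list \<Rightarrow> nat" where
  "num_walks q k x y = card (walks q k x y)"

definition effective_moves :: "int list list \<Rightarrow> nat" where
  "effective_moves w =
     card {(m, i). Suc m < length w \<and> i < length (w ! m) \<and> w ! Suc m ! i \<noteq> w ! m ! i}"

lemma finite_walks: "finite (walks q k x y)"
proof -
  let ?n = "length x"
  let ?N = "int (q + k)"
  have step: "length d = length c \<and> (\<forall>i<length c. \<bar>d ! i - c ! i\<bar> \<le> 1)"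
    if "right_step c d \<or> left_step c d" for c d
    using that by (auto simp: right_step_def left_step_def nth_list_update)
  have bound: "length (w ! m) = ?n \<and> (\<forall>i<?n. \<bar>w ! m ! i - int (x ! i)\<bar> \<le> int m)"
    if w: "w \<in> walks q k x y" and m: "m \<le> q + k" for w m
    using m
  proof (induction m)
    case 0
    then show ?case using w by (simp add: walks_def)
  next
    case (Suc m)
    have "right_step (w ! m) (w ! Suc m) \<or> left_step (w ! m) (w ! Suc m)"
      using w Suc.prems by (cases "m < q") (auto simp: walks_def)
    then have st: "length (w ! Suc m) = length (w ! m)"
        "i < length (w ! m) \<Longrightarrow> \<bar>w ! Suc m ! i - w ! m ! i\<bar> \<le> 1" for i
      using step by blast+
    have IH: "length (w ! m) = ?n" "i < ?n \<Longrightarrow> \<bar>w ! m ! i - int (x ! i)\<bar> \<le> int m" for i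
      using Suc.IH Suc.prems by auto
    have "\<bar>w ! Suc m ! i - int (x ! i)\<bar> \<le> int (Suc m)" if "i < ?n" for i
      using st(2)[of i] IH(2)[of i] IH(1) that by simp
    then show ?case using st(1) IH(1) by simp
  qed
  let ?B = "\<Union>i<?n. {int (x ! i) - ?N..int (x ! i) + ?N}"
  let ?C = "{c. set c \<subseteq> ?B \<and> length c = ?n}"
  have "walks q k x y \<subseteq> {w. set w \<subseteq> ?C \<and> length w = q + k + 1}"
  proof
    fix w assume w: "w \<in> walks q k x y"
    have len: "length w = q + k + 1" using w by (simp add: walks_def)
    have "c \<in> ?C" if c: "c \<in> set w" for c
    proof -
      obtain m where m: "m \<le> q + k" "c = w ! m"
        using c len by (auto simp: in_set_conv_nth less_Suc_eq_le)
      have "v \<in> ?B" if v: "v \<in> set c" for v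
      proof -
        obtain i where i: "i < ?n" "v = c ! i"
          using v bound[OF w m(1)] m(2) by (auto simp: in_set_conv_nth)
        then have "\<bar>v - int (x ! i)\<bar> \<le> int m" using bound[OF w m(1)] m(2) by simp
        then have "v \<in> {int (x ! i) - ?N..int (x ! i) + ?N}" using m(1) by auto
        then show ?thesis using i(1) by blast
      qed
      then show ?thesis using bound[OF w m(1)] m(2) by auto
    qed
    then show "w \<in> {w. set w \<subseteq> ?C \<and> length w = q + k + 1}" using len by blast
  qed
  moreover have "finite {w. set w \<subseteq> ?C \<and> length w = q + k + 1}"
    by (intro finite_lists_length_eq) simp
  ultimately show ?thesis by (rule finite_subset)
qed

end

theory Submission
  imports Defs "Jordan_Normal_Form.Schur_Decomposition"
begin

text \<open>
  A polynomial class function on the unitary group is a symmetric Laurent polynomial \<open>f\<close> of the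
  eigenvalues. Replacing \<open>M\<close> by \<open>R M\<close>, where \<open>R\<close> runs through the unitary matrices
  \<open>1 + (e\<^sup>i\<^sup>t - 1) Y\<close> with a projection \<open>Y\<close>, and comparing the terms linear in \<open>t\<close> gives loop
  equations between integrals of products of power sums. Together they say that the Haar integral
  kills the image of the Laplacian. Conjugated by the Vandermonde product \<open>V\<close>, the Laplacian
  multiplies the monomial with exponent vector \<open>m\<close> by \<open>q(m) - q(\<delta>)\<close> for a quadratic form \<open>q\<close>, and
  for \<open>m\<close> with distinct entries this is 0 only if \<open>m\<close> is a permutation of \<open>\<delta>\<close>. Subtracting images
  of the Laplacian therefore reduces \<open>V f\<close> to a multiple of \<open>V\<close>, which is Weyl's formula: \<open>n!\<close> times
  the integral of \<open>f\<close> is the constant term of \<open>f V V*\<close>, where \<open>V*\<close> is \<open>V\<close> in the inverse variables.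

  By the bialternant formula the integrand becomes a product of two alternants, of \<open>\<Prod> (1 + x\<^sub>i)\<^sup>q\<close>
  and of a power of \<open>\<Sum> x\<^sub>i\<^sup>-\<^sup>1\<close>. Multiplying an alternant by \<open>\<Prod> (1 + x\<^sub>i)\<close> moves any set of its
  exponents one step to the right, multiplying it by \<open>\<Sum> x\<^sub>i\<^sup>-\<^sup>1\<close> moves one exponent to the left, and
  colliding exponents contribute 0; orthogonality of alternants leaves the number of walks. The
  generating function is the Cauchy identity for both sets of variables under the integral sign,
  where only finitely many partitions contribute to the coefficient of a given monomial.
\<close>

text \<open>The measure is known only through left invariance, so there is no density and no change
  of variables to start from; invariance can only be differentiated. This shapes the first half.
  Rotations by projections have an elementary exponential, and although projections are Hermitian,
  their complex span contains all matrix units, which is enough because the equations are linear in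
  the direction. Differentiation under the integral is replaced by expansions whose remainder is
  uniform on the group.

  Weyl's formula then is a uniqueness statement: the integral and the constant term functional
  vanish on the same space, which together with the constants spans all class functions. In the
  Cauchy identity the obstacle is coinciding eigenvalues, for which the Vandermonde determinant
  vanishes and cannot be cancelled; there a perturbation of the numbers helps.\<close>

no_notation vec_index (infixl "$" 100)

abbreviation (input) idm :: "'a::semiring_1^'n^'n" where
  "idm \<equiv> Finite_Cartesian_Product.mat 1"

type_synonym laurent = "(nat \<Rightarrow>\<^sub>0 int) \<Rightarrow>\<^sub>0 complex"

abbreviation single where "single \<equiv> Poly_Mapping.single"
abbreviation lookup where "lookup \<equiv> Poly_Mapping.lookup"
abbreviation keys where "keys \<equiv> Poly_Mapping.keys"

section \<open>Reduction of additive identities to monomials\<close>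

lemma poly_mapping_expand: "f = (\<Sum>m\<in>keys f. single m (lookup f m))"
  by (rule poly_mapping_eqI)
    (simp add: lookup_sum lookup_single when_def sum.delta' in_keys_iff)

text \<open>Additivity into a group already forces the value 0 at 0, so product and evaluation rules
  can be checked on single monomials.\<close>

lemma additive_poly_mapping_eq:
  fixes A B :: "('a \<Rightarrow>\<^sub>0 'b::comm_monoid_add) \<Rightarrow> 'c::ab_group_add"
  assumes A: "\<And>f g. A (f + g) = A f + A g" and B: "\<And>f g. B (f + g) = B f + B g"
    and eq: "\<And>m c. A (single m c) = B (single m c)"
  shows "A f = B f"
proof -
  have 0: "A 0 = 0" "B 0 = 0" using A[of 0 0] B[of 0 0] by auto
  have "A (\<Sum>m\<in>K. single m (lookup f m)) = B (\<Sum>m\<in>K. single m (lookup f m))" if "finite K" for K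
    using that by induction (auto simp: 0 A B eq)
  from this[of "keys f"] show ?thesis by (simp flip: poly_mapping_expand)
qed

lemma biadditive_poly_mapping_eq:
  fixes A B :: "('a \<Rightarrow>\<^sub>0 'b::comm_monoid_add) \<Rightarrow> ('d \<Rightarrow>\<^sub>0 'e::comm_monoid_add) \<Rightarrow> 'c::ab_group_add"
  assumes "\<And>f f' g. A (f + f') g = A f g + A f' g" "\<And>f f' g. B (f + f') g = B f g + B f' g"
    and "\<And>f g g'. A f (g + g') = A f g + A f g'" "\<And>f g g'. B f (g + g') = B f g + B f g'"
    and "\<And>m c m' c'. A (single m c) (single m' c') = B (single m c) (single m' c')"
  shows "A f g = B f g"
proof (rule additive_poly_mapping_eq[of "\<lambda>f. A f g" "\<lambda>f. B f g"])
  fix m c show "A (single m c) g = B (single m c) g"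
    by (rule additive_poly_mapping_eq[of "A (single m c)" "B (single m c)"]) (auto simp: assms)
qed (auto simp: assms)

definition X :: "nat \<Rightarrow> int \<Rightarrow> laurent" where
  "X i a = single (single i a) 1"

definition cst :: "complex \<Rightarrow> laurent" where
  "cst c = single 0 c"

lemma X_mult: "X i a * X i b = X i (a + b)"
  by (simp add: X_def mult_single single_add)

lemma X_0 [simp]: "X i 0 = 1"
  by (simp add: X_def)

lemma X_power: "X i a ^ k = X i (a * int k)"
  by (induction k) (auto simp: X_mult algebra_simps)

lemma prod_X: "(\<Prod>i\<in>A. X (p i) (h i)) = single (\<Sum>i\<in>A. single (p i) (h i)) 1"
  by (induction A rule: infinite_finite_induct) (auto simp: X_def mult_single)

lemma cst_0 [simp]: "cst 0 = 0" and cst_1 [simp]: "cst 1 = 1"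
  and cst_add: "cst (a + b) = cst a + cst b"
  and cst_diff: "cst (a - b) = cst a - cst b"
  and cst_minus: "cst (- a) = - cst a"
  and cst_mult: "cst (a * b) = cst a * cst b"
  by (simp_all add: cst_def single_add single_diff single_uminus mult_single)

lemma of_int_cst: "of_int k = cst (of_int k)" and of_nat_cst: "of_nat m = cst (of_nat m)"
  by (simp_all add: cst_def)

lemma lookup_cst_mult [simp]: "lookup (cst c * f) m = c * lookup f m"
  by (rule additive_poly_mapping_eq[of "\<lambda>f. lookup (cst c * f) m"])
    (auto simp: lookup_add algebra_simps cst_def mult_single lookup_single when_def)

subsection \<open>Diagonal operators\<close>

text \<open>Operators that are diagonal in the monomial basis. The derivations \<open>E\<close>, the
  conjugated Laplacian \<open>qop\<close> and the eigenspace projection in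
  \<open>alt_span_minimal\<close> are all of this form.\<close>

definition dop :: "((nat \<Rightarrow>\<^sub>0 int) \<Rightarrow> complex) \<Rightarrow> laurent \<Rightarrow> laurent" where
  "dop u f = Poly_Mapping.mapp (\<lambda>m c. u m * c) f"

lemma lookup_dop: "lookup (dop u f) m = u m * lookup f m"
  by (auto simp: dop_def lookup_mapp when_def in_keys_iff)

lemma dop_add: "dop u (f + g) = dop u f + dop u g"
  and dop_diff: "dop u (f - g) = dop u f - dop u g"
  and dop_0 [simp]: "dop u 0 = 0"
  by (rule poly_mapping_eqI, simp add: lookup_dop lookup_add lookup_minus algebra_simps)+

lemma dop_cst: "dop u (cst c * f) = cst c * dop u f"
  by (rule poly_mapping_eqI) (simp add: lookup_dop)

lemma dop_sum: "dop u (\<Sum>i\<in>A. f i) = (\<Sum>i\<in>A. dop u (f i))"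
  by (induction A rule: infinite_finite_induct) (auto simp: dop_add)

lemma dop_single: "dop u (single m c) = single m (u m * c)"
  by (rule poly_mapping_eqI) (simp add: lookup_dop lookup_single when_def)

text \<open>The Euler derivation x_i d/dx_i.\<close>

definition E :: "nat \<Rightarrow> laurent \<Rightarrow> laurent" where
  "E i = dop (\<lambda>m. of_int (lookup m i))"

lemma E_mult: "E i (f * g) = E i f * g + f * E i g"
  by (rule biadditive_poly_mapping_eq[of "\<lambda>f g. E i (f * g)"])
    (auto simp: E_def dop_add algebra_simps dop_single mult_single lookup_add simp flip: single_add)

lemma E_add: "E i (f + g) = E i f + E i g" and E_diff: "E i (f - g) = E i f - E i g"
  by (simp_all add: E_def dop_add dop_diff)

lemma E_sum: "E i (\<Sum>j\<in>A. f j) = (\<Sum>j\<in>A. E i (f j))"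
  by (simp add: E_def dop_sum)

lemma E_cst [simp]: "E i (cst c) = 0"
  by (simp add: E_def cst_def dop_single)

lemma E_X: "E i (X j a) = (if i = j then cst (of_int a) * X j a else 0)"
  by (simp add: E_def X_def dop_single cst_def mult_single lookup_single del: single_of_int)

subsection \<open>Evaluation\<close>

text \<open>Variables with index at least \<open>n\<close> are dropped, that is, evaluated at
  1.\<close>

definition leval :: "nat \<Rightarrow> (nat \<Rightarrow> complex) \<Rightarrow> laurent \<Rightarrow> complex" where
  "leval n x f = (\<Sum>m\<in>keys f. lookup f m * (\<Prod>i<n. x i powi lookup m i))"

lemma eval_superset:
  assumes "finite K" "keys f \<subseteq> K"
  shows "leval n x f = (\<Sum>m\<in>K. lookup f m * (\<Prod>i<n. x i powi lookup m i))"
  unfolding leval_def by (rule sum.mono_neutral_left) (use assms in \<open>auto simp: in_keys_iff\<close>)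

lemma eval_add: "leval n x (f + g) = leval n x f + leval n x g"
proof -
  let ?K = "keys f \<union> keys g"
  have "leval n x (f + g) = (\<Sum>m\<in>?K. lookup (f + g) m * (\<Prod>i<n. x i powi lookup m i))"
    by (rule eval_superset) (auto simp: Poly_Mapping.keys_add)
  also have "\<dots> = (\<Sum>m\<in>?K. lookup f m * (\<Prod>i<n. x i powi lookup m i))
      + (\<Sum>m\<in>?K. lookup g m * (\<Prod>i<n. x i powi lookup m i))"
    by (simp add: lookup_add algebra_simps sum.distrib)
  also have "\<dots> = leval n x f + leval n x g"
    by (simp add: eval_superset[of ?K])
  finally show ?thesis .
qed

lemma eval_single: "leval n x (single m c) = c * (\<Prod>i<n. x i powi lookup m i)"
  by (simp add: eval_superset[of "{m}"])

lemma eval_0 [simp]: "leval n x 0 = 0" by (simp add: leval_def)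

lemma eval_cst [simp]: "leval n x (cst c) = c" by (simp add: cst_def eval_single)

lemma eval_1 [simp]: "leval n x 1 = 1" using eval_cst[of n x 1] by simp

text \<open>The values must not vanish: a negative power of 0 is 0 here, so the law of exponents
  fails at 0.\<close>

lemma eval_mult:
  assumes "\<And>i. i < n \<Longrightarrow> x i \<noteq> 0"
  shows "leval n x (f * g) = leval n x f * leval n x g"
  by (rule biadditive_poly_mapping_eq[of "\<lambda>f g. leval n x (f * g)"])
    (auto simp: eval_add algebra_simps eval_single mult_single lookup_add power_int_add assms prod.distrib)

lemma eval_sum: "leval n x (\<Sum>i\<in>A. f i) = (\<Sum>i\<in>A. leval n x (f i))"
  by (induction A rule: infinite_finite_induct) (auto simp: eval_add)

lemma eval_diff: "leval n x (f - g) = leval n x f - leval n x g"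
  using eval_add[of n x "f - g" g] by simp

lemma eval_prod:
  assumes "\<And>i. i < n \<Longrightarrow> x i \<noteq> 0"
  shows "leval n x (\<Prod>i\<in>A. f i) = (\<Prod>i\<in>A. leval n x (f i))"
  by (induction A rule: infinite_finite_induct) (auto simp: eval_mult[OF assms])

lemma eval_X: "i < n \<Longrightarrow> leval n x (X i a) = x i powi a"
  by (simp add: X_def eval_single lookup_single when_def if_distrib[of "\<lambda>k. _ powi k"] prod.delta'
      cong: if_cong)

definition psum :: "nat \<Rightarrow> int \<Rightarrow> laurent" where
  "psum n a = (\<Sum>i<n. X i a)"

lemma eval_psum: "leval n x (psum n a) = (\<Sum>i<n. x i powi a)"
  by (simp add: psum_def eval_sum eval_X)

subsection \<open>Alternants\<close>

definition alt :: "nat \<Rightarrow> (nat \<Rightarrow> int) \<Rightarrow> laurent" where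
  "alt n h = Determinant.det (Matrix.mat n n (\<lambda>(i, j). X j (h i)))"

lemma alt_leibniz: "alt n h = (\<Sum>p | p permutes {0..<n}. of_int (sign p) * (\<Prod>i<n. X (p i) (h i)))"
  unfolding alt_def by (subst Determinant.det_def'[of _ n])
    (auto intro!: sum.cong prod.cong simp: permutes_in_image atLeast0LessThan)

lemma alt_cong: "(\<And>i. i < n \<Longrightarrow> h i = k i) \<Longrightarrow> alt n h = alt n k"
  unfolding alt_leibniz by (intro sum.cong arg_cong2[of _ _ _ _ "(*)"] prod.cong) auto

text \<open>As a symmetric function, the power sum may be rewritten in each Leibniz term in the
  permuted variables, where its summands change one exponent each.\<close>

lemma psum_mult_alt: "psum n a * alt n h = (\<Sum>j<n. alt n (h(j := h j + a)))"
proof -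
  have "psum n a * alt n h = (\<Sum>p | p permutes {0..<n}. psum n a * (of_int (sign p) * (\<Prod>i<n. X (p i) (h i))))"
    by (simp add: alt_leibniz sum_distrib_left)
  also have "\<dots> = (\<Sum>p | p permutes {0..<n}. \<Sum>j<n. of_int (sign p) * (\<Prod>i<n. X (p i) ((h(j := h j + a)) i)))"
  proof (rule sum.cong)
    fix p assume "p \<in> {p. p permutes {0..<n}}"
    then have p: "p permutes {..<n}" by (simp add: atLeast0LessThan)
    have "psum n a = (\<Sum>j<n. X (p j) a)"
      unfolding psum_def by (rule sum.permute[OF p, unfolded o_def])
    moreover have "X (p j) a * (\<Prod>i<n. X (p i) (h i)) = (\<Prod>i<n. X (p i) ((h(j := h j + a)) i))" if "j < n" for j
      using that by (simp add: prod.remove[of "{..<n}" j] X_mult mult.assoc[symmetric] add.commute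
          del: mult.assoc)
    ultimately show "psum n a * (of_int (sign p) * (\<Prod>i<n. X (p i) (h i)))
        = (\<Sum>j<n. of_int (sign p) * (\<Prod>i<n. X (p i) ((h(j := h j + a)) i)))"
      by (simp add: sum_distrib_right sum_distrib_left mult.left_commute)
  qed simp
  also have "\<dots> = (\<Sum>j<n. alt n (h(j := h j + a)))"
    unfolding alt_leibniz by (rule sum.swap)
  finally show ?thesis .
qed

text \<open>The same device as for power sums; expanding the product selects the set
  \<open>B\<close> of exponents that are raised.\<close>

lemma prod_1_add_X_mult_alt:
  "(\<Prod>i<n. 1 + X i 1) * alt n h = (\<Sum>B\<in>Pow {..<n}. alt n (\<lambda>i. h i + of_bool (i \<in> B)))"
proof -
  have "(\<Prod>i<n. 1 + X i 1) * alt n h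
     = (\<Sum>p | p permutes {0..<n}. (\<Prod>i<n. 1 + X i 1) * (of_int (sign p) * (\<Prod>i<n. X (p i) (h i))))"
    by (simp add: alt_leibniz sum_distrib_left)
  also have "\<dots> = (\<Sum>p | p permutes {0..<n}. \<Sum>B\<in>Pow {..<n}. of_int (sign p) *
      (\<Prod>i<n. X (p i) (h i + of_bool (i \<in> B))))"
  proof (rule sum.cong)
    fix p assume "p \<in> {p. p permutes {0..<n}}"
    then have p: "p permutes {..<n}" by (simp add: atLeast0LessThan)
    have "(\<Prod>i<n. 1 + X i 1) * (\<Prod>i<n. X (p i) (h i)) = (\<Prod>i<n. 1 + X (p i) 1) * (\<Prod>i<n. X (p i) (h i))"
      using prod.permute[OF p, of "\<lambda>i. 1 + X i 1"] by (simp add: o_def)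
    also have "\<dots> = (\<Prod>i<n. X (p i) (h i + 1) + X (p i) (h i))"
      by (simp add: prod.distrib[symmetric] distrib_right X_mult add.commute)
    also have "\<dots> = (\<Sum>B\<in>Pow {..<n}. (\<Prod>i\<in>B. X (p i) (h i + 1)) * (\<Prod>i\<in>{..<n} - B. X (p i) (h i)))"
      by (rule prod_add) simp
    also have "\<dots> = (\<Sum>B\<in>Pow {..<n}. \<Prod>i<n. X (p i) (h i + of_bool (i \<in> B)))"
    proof (rule sum.cong)
      fix B assume "B \<in> Pow {..<n}"
      then have B: "B \<subseteq> {..<n}" by simp
      show "(\<Prod>i\<in>B. X (p i) (h i + 1)) * (\<Prod>i\<in>{..<n} - B. X (p i) (h i)) = (\<Prod>i<n. X (p i) (h i + of_bool (i \<in> B)))"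
        using prod.subset_diff[OF B, of "\<lambda>i. X (p i) (h i + of_bool (i \<in> B))"]
        by (simp add: mult.commute)
    qed simp
    finally show "(\<Prod>i<n. 1 + X i 1) * (of_int (sign p) * (\<Prod>i<n. X (p i) (h i)))
       = (\<Sum>B\<in>Pow {..<n}. of_int (sign p) * (\<Prod>i<n. X (p i) (h i + of_bool (i \<in> B))))"
      by (simp add: sum_distrib_left mult.left_commute)
  qed simp
  also have "\<dots> = (\<Sum>B\<in>Pow {..<n}. alt n (\<lambda>i. h i + of_bool (i \<in> B)))"
    unfolding alt_leibniz by (rule sum.swap)
  finally show ?thesis .
qed

lemma alt_eq_0:
  assumes "i < n" "j < n" "i \<noteq> j" "h i = h j"
  shows "alt n h = 0"
  unfolding alt_def
  by (rule Determinant.det_identical_rows[of _ n i j]) (use assms in \<open>auto simp: Matrix.row_def\<close>)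

lemma alt_permute:
  assumes p: "p permutes {0..<n}"
  shows "alt n (\<lambda>i. h (p i)) = of_int (sign p) * alt n h"
proof -
  let ?A = "Matrix.mat n n (\<lambda>(i, j). X j (h i))"
  have "Matrix.mat n n (\<lambda>(i, j). X j (h (p i))) = Matrix.mat n n (\<lambda>(i, j). ?A $$ (p i, j))"
    using permutes_in_image[OF p] by (intro eq_matI) auto
  then show ?thesis
    using Determinant.det_permute_rows[of ?A n p] p by (simp add: alt_def)
qed

lemma lookup_sum_single:
  fixes n :: nat
  assumes p: "p permutes {..<n}" and i: "i < n"
  shows "lookup (\<Sum>j<n. single (p j) (h j)) (p i) = (h i :: int)"
proof -
  have "lookup (\<Sum>j<n. single (p j) (h j)) (p i) = (\<Sum>j<n. if j = i then h j else 0)"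
    unfolding lookup_sum
    by (rule sum.cong) (auto simp: lookup_single when_def permutes_inj[OF p] inj_eq)
  then show ?thesis using i by (simp add: sum.delta)
qed

subsection \<open>The radial Laplacian\<close>

text \<open>Up to an additive constant, the squared distance of the exponents from their common
  centre (n - 1) / 2.\<close>

definition qform :: "nat \<Rightarrow> (nat \<Rightarrow> int) \<Rightarrow> int" where
  "qform n h = (\<Sum>i<n. h i * (h i - (int n - 1)))"

lemma qform_lookup:
  assumes p: "p permutes {..<n}"
  shows "qform n (lookup (\<Sum>j<n. single (p j) (h j))) = qform n h"
proof -
  let ?m = "lookup (\<Sum>j<n. single (p j) (h j))"
  have "qform n ?m = (\<Sum>i<n. ?m (p i) * (?m (p i) - (int n - 1)))"
    unfolding qform_def by (rule sum.permute[OF p, unfolded o_def])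
  also have "\<dots> = qform n h"
    unfolding qform_def by (rule sum.cong) (auto simp: lookup_sum_single[OF p])
  finally show ?thesis .
qed

text \<open>The monomials of an alternant differ by permutations of the variables, and
  \<open>qform\<close> is symmetric. The function \<open>u\<close> is arbitrary so that one lemma
  serves both the Laplacian and the projection onto one of its eigenspaces.\<close>

lemma dop_qform_alt:
  "dop (\<lambda>m. u (qform n (lookup m))) (alt n h) = cst (u (qform n h)) * alt n h"
  unfolding alt_leibniz sum_distrib_left dop_sum
proof (rule sum.cong)
  fix p assume "p \<in> {p. p permutes {0..<n}}"
  then have p: "p permutes {..<n}" by (simp add: atLeast0LessThan)
  have "dop (\<lambda>m. u (qform n (lookup m))) (\<Prod>i<n. X (p i) (h i)) = cst (u (qform n h)) * (\<Prod>i<n. X (p i) (h i))"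
    by (simp add: prod_X dop_single qform_lookup[OF p] cst_def mult_single)
  then show "dop (\<lambda>m. u (qform n (lookup m))) (of_int (sign p) * (\<Prod>i<n. X (p i) (h i)))
      = cst (u (qform n h)) * (of_int (sign p) * (\<Prod>i<n. X (p i) (h i)))"
    unfolding of_int_cst dop_cst by (simp add: mult.left_commute)
qed simp

definition dlt :: "nat \<Rightarrow> nat \<Rightarrow> int" where
  "dlt n i = int n - 1 - int i"

lemma dlt_image: "dlt n ` {..<n} = {0..<int n}"
proof -
  have "a \<in> dlt n ` {..<n}" if "0 \<le> a" "a < int n" for a
    by (rule image_eqI[of _ _ "nat (int n - 1 - a)"]) (use that in \<open>auto simp: dlt_def\<close>)
  then show ?thesis by (auto simp: dlt_def)
qed

lemma inj_on_dlt: "inj_on (dlt n) {..<n}"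
  by (auto simp: dlt_def inj_on_def)

text \<open>The summand a (a - (n - 1)) is at most 0 on {0..<n} and positive at every other integer.
  Of all sets of n integers, only the interval itself therefore attains the minimum.\<close>

lemma qform_minimal:
  assumes inj: "inj_on h {..<n}" and q: "qform n h = qform n (dlt n)"
  shows "h ` {..<n} = {0..<int n}"
proof (rule ccontr)
  let ?psi = "\<lambda>a::int. a * (a - (int n - 1))"
  let ?A = "h ` {..<n}" and ?I = "{0..<int n}"
  assume neq: "?A \<noteq> ?I"
  have card: "card ?A = card ?I" using card_image[OF inj] by simp
  have "sum ?psi ?A = sum ?psi ?I"
    using q unfolding qform_def sum.reindex[OF inj] dlt_image[symmetric] sum.reindex[OF inj_on_dlt]
    by (simp add: o_def)
  moreover have "sum ?psi ?A = sum ?psi (?A - ?I) + sum ?psi (?A \<inter> ?I)"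
    by (subst sum.union_disjoint[symmetric]) (auto intro!: arg_cong[of _ _ "sum ?psi"])
  moreover have "sum ?psi ?I = sum ?psi (?I - ?A) + sum ?psi (?A \<inter> ?I)"
    by (subst sum.union_disjoint[symmetric]) (auto intro!: arg_cong[of _ _ "sum ?psi"])
  moreover have "sum ?psi (?I - ?A) \<le> 0"
    by (rule sum_nonpos) (auto simp: mult_le_0_iff)
  moreover have "\<not> ?A \<subseteq> ?I"
    using neq card card_subset_eq[of ?I ?A] by auto
  then have "sum ?psi (?A - ?I) > 0"
    by (intro sum_pos) (auto simp: zero_less_mult_iff)
  ultimately show False by linarith
qed

text \<open>A repeated exponent makes the alternant 0; distinct exponents are a rearrangement of the
  staircase, which costs a sign.\<close>

lemma alt_minimal:
  assumes q: "qform n h = qform n (dlt n)"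
  shows "\<exists>c. alt n h = cst c * alt n (dlt n)"
proof (cases "inj_on h {..<n}")
  case False
  then obtain i j where "i < n" "j < n" "i \<noteq> j" "h i = h j" by (auto simp: inj_on_def)
  then show ?thesis using alt_eq_0[of i n j h] by (intro exI[of _ 0]) simp
next
  case True
  have im: "h ` {..<n} = dlt n ` {..<n}" using qform_minimal[OF True q] dlt_image by simp
  define p where "p i = (if i < n then inv_into {..<n} (dlt n) (h i) else i)" for i
  have p1: "p i < n \<and> dlt n (p i) = h i" if "i < n" for i
  proof -
    have "h i \<in> dlt n ` {..<n}" using im that by auto
    then show ?thesis using that inv_into_into[of "h i" "dlt n" "{..<n}"] f_inv_into_f[of "h i" "dlt n" "{..<n}"]
      by (simp add: p_def)
  qed
  have "p permutes {..<n}"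
  proof (rule bij_imp_permutes)
    have "inj_on p {..<n}"
      by (rule inj_onI) (metis True inj_onD lessThan_iff p1)
    moreover have "p ` {..<n} \<subseteq> {..<n}" using p1 by auto
    ultimately show "bij_betw p {..<n} {..<n}"
      by (simp add: bij_betw_def endo_inj_surj)
  qed (auto simp: p_def)
  then have p: "p permutes {0..<n}" by (simp add: atLeast0LessThan)
  have "alt n h = alt n (\<lambda>i. dlt n (p i))" by (rule alt_cong) (simp add: p1)
  then show ?thesis using alt_permute[OF p, of "dlt n"] of_int_cst by auto
qed

subsection \<open>Constant terms\<close>

text \<open>Monotonicity gives i \<le> p i, and a permutation preserves the sum of all indices, so
  no inequality can be strict. The lemma identifies decreasing vectors that are rearrangements of
  each other.\<close>

lemma strict_mono_permutation_id:
  fixes n :: nat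
  assumes p: "p permutes {..<n}" and mono: "\<And>i j. i < j \<Longrightarrow> j < n \<Longrightarrow> p i < p j"
  shows "p = id"
proof
  fix i
  have ge: "i \<le> p i" if "i < n" for i
    using that
  proof (induction i)
    case (Suc i)
    then show ?case using mono[of i "Suc i"] by simp
  qed simp
  have "p i = i" if "i < n"
  proof (rule ccontr)
    assume "p i \<noteq> i"
    then have "(\<Sum>i<n. i) < (\<Sum>i<n. p i)"
      using that ge \<open>p i \<noteq> i\<close> by (intro sum_strict_mono_ex1) (auto simp: le_neq_implies_less intro!: bexI[of _ i])
    moreover have "(\<Sum>i<n. p i) = (\<Sum>i<n. i)"
      using sum.permute[OF p, of id] by (simp add: o_def)
    ultimately show False by simp
  qed
  then show "p i = id i"
    using permutes_not_in[OF p, of i] by (cases "i < n") auto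
qed

text \<open>Orthogonality of alternants for the constant term. A product of two Leibniz terms is
  constant only if the permutations carry one exponent vector to the other; for decreasing vectors
  this forces equal vectors and equal permutations, and the signs cancel.\<close>

lemma lookup_0_alt_mult_alt:
  assumes h: "\<And>i j. i < j \<Longrightarrow> j < n \<Longrightarrow> h i > h j" and k: "\<And>i j. i < j \<Longrightarrow> j < n \<Longrightarrow> k i > k j"
  shows "lookup (alt n h * alt n (\<lambda>i. - k i)) 0 = (if \<forall>i<n. h i = k i then fact n else 0)"
proof -
  let ?P = "{p. p permutes {0..<n}}"
  let ?m = "\<lambda>p h. \<Sum>i<n. single (p i) (h i :: int)"
  have fin: "finite ?P" by (simp add: finite_permutations)
  have P: "p \<in> ?P \<Longrightarrow> p permutes {..<n}" for p by (simp add: atLeast0LessThan)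
  have eq: "?m p h + ?m r (\<lambda>i. - k i) = 0 \<longleftrightarrow> p = r \<and> (\<forall>i<n. h i = k i)" if pr: "p \<in> ?P" "r \<in> ?P" for p r
  proof
    have neg: "?m r (\<lambda>i. - k i) = - ?m r k" by (simp add: single_uminus sum_negf)
    {
      assume "?m p h + ?m r (\<lambda>i. - k i) = 0"
      then have "?m p h = ?m r k" unfolding neg by simp
      \<comment> \<open>The permutation that carries \<open>h\<close> to \<open>k\<close>; it is
        increasing because both vectors decrease.\<close>
      define s where "s = inv_into UNIV r \<circ> p"
      have s: "s permutes {..<n}"
        unfolding s_def by (intro permutes_compose permutes_inv P pr)
      have rs: "r (s i) = p i" for i
        unfolding s_def using permutes_inverses(1)[OF P[OF pr(2)]] by simp
      have hk: "h i = k (s i)" if i: "i < n" for i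
      proof -
        have si: "s i < n" using permutes_in_image[OF s, of i] i by simp
        have "h i = lookup (?m p h) (p i)" by (rule lookup_sum_single[OF P[OF pr(1)] i, symmetric])
        also have "\<dots> = lookup (?m r k) (r (s i))" by (simp add: \<open>?m p h = ?m r k\<close> rs)
        also have "\<dots> = k (s i)" by (rule lookup_sum_single[OF P[OF pr(2)] si])
        finally show ?thesis .
      qed
      have "s = id"
      proof (rule strict_mono_permutation_id[OF s])
        fix i j assume ij: "i < j" "j < n"
        have n: "s i < n" "s j < n" using permutes_in_image[OF s] ij by auto
        have "k (s i) > k (s j)" using h[OF ij] hk ij by simp
        then show "s i < s j" using k[of "s j" "s i"] n by (cases "s i" "s j" rule: linorder_cases) auto
      qed
      then show "p = r \<and> (\<forall>i<n. h i = k i)"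
        using hk rs by (auto simp: fun_eq_iff)
    }
    {
      assume "p = r \<and> (\<forall>i<n. h i = k i)"
      then have "?m p h = ?m r k" by (auto intro!: sum.cong)
      then show "?m p h + ?m r (\<lambda>i. - k i) = 0" unfolding neg by simp
    }
  qed
  have "lookup (alt n h * alt n (\<lambda>i. - k i)) 0 = (\<Sum>p\<in>?P. \<Sum>r\<in>?P.
      lookup (cst (of_int (sign p * sign r)) * single (?m p h + ?m r (\<lambda>i. - k i)) 1) 0)"
    unfolding alt_leibniz sum_product lookup_sum prod_X
    by (intro sum.cong arg_cong2[of _ _ _ _ lookup] refl)
      (auto simp: of_int_cst cst_mult mult_ac, simp add: mult_single)
  also have "\<dots> = (\<Sum>p\<in>?P. \<Sum>r\<in>?P. if p = r \<and> (\<forall>i<n. h i = k i) then 1 else 0)"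
    by (intro sum.cong refl) (subst lookup_cst_mult, auto simp: lookup_single when_def eq sign_def)
  also have "\<dots> = (if \<forall>i<n. h i = k i then of_nat (card ?P) else 0)"
  proof -
    have "(\<Sum>p\<in>?P. \<Sum>r\<in>?P. if p = r \<and> B then 1 else 0) = (if B then of_nat (card ?P) else (0::complex))" for B
      using fin by (cases B) (simp_all add: sum.delta)
    then show ?thesis .
  qed
  also have "card ?P = fact n" by (simp add: card_permutations)
  finally show ?thesis by simp
qed

subsection \<open>The Vandermonde determinant\<close>

text \<open>Coefficients of y^i in the Newton basis \<Prod> (y - x_r), r < l. They are the complete
  homogeneous polynomials of degree i - l in x_0, ..., x_l.\<close>

fun newton_coeff :: "(nat \<Rightarrow> 'a::comm_ring_1) \<Rightarrow> nat \<Rightarrow> nat \<Rightarrow> 'a" where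
  "newton_coeff x 0 l = (if l = 0 then 1 else 0)"
| "newton_coeff x (Suc i) l = (if l = 0 then 0 else newton_coeff x i (l - 1)) + x l * newton_coeff x i l"

lemma newton_coeff_eq_0: "i < l \<Longrightarrow> newton_coeff x i l = 0"
  by (induction i arbitrary: l) auto

lemma newton_coeff_diag: "newton_coeff x i i = 1"
  by (induction i) (auto simp: newton_coeff_eq_0)

lemma power_newton: "y ^ i = (\<Sum>l\<le>i. newton_coeff x i l * (\<Prod>r<l. y - x r))"
proof (induction i)
  case (Suc i)
  let ?P = "\<lambda>l. \<Prod>r<l. y - x r"
  have step: "y * ?P l = ?P (Suc l) + x l * ?P l" for l
    by (simp add: algebra_simps)
  have "y ^ Suc i = (\<Sum>l\<le>i. newton_coeff x i l * (y * ?P l))"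
    by (simp add: Suc sum_distrib_left mult.left_commute)
  also have "\<dots> = (\<Sum>l\<le>i. newton_coeff x i l * (?P (Suc l) + x l * ?P l))"
    unfolding step ..
  also have "\<dots> = (\<Sum>l\<le>i. newton_coeff x i l * ?P (Suc l)) + (\<Sum>l\<le>Suc i. x l * newton_coeff x i l * ?P l)"
    by (simp add: sum.distrib distrib_left mult_ac newton_coeff_eq_0 del: prod.lessThan_Suc)
  also have "(\<Sum>l\<le>i. newton_coeff x i l * ?P (Suc l))
      = (\<Sum>l\<le>Suc i. (if l = 0 then 0 else newton_coeff x i (l - 1)) * ?P l)"
    by (subst sum.atMost_Suc_shift) (simp del: prod.lessThan_Suc)
  finally show ?case by (simp add: sum.distrib algebra_simps del: sum.atMost_Suc)
qed simp

text \<open>Passing to the Newton basis factors the matrix into a unitriangular one and one whose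
  entries below the diagonal vanish, since \<Prod> (x_j - x_r) over r < l contains the factor r = j
  when j < l. This works over any commutative ring.\<close>

lemma det_vandermonde:
  fixes x :: "nat \<Rightarrow> 'a::comm_ring_1"
  shows "Determinant.det (Matrix.mat n n (\<lambda>(i, j). x j ^ i)) = (\<Prod>j<n. \<Prod>r<j. x j - x r)"
proof -
  let ?T = "Matrix.mat n n (\<lambda>(i, l). newton_coeff x i l)"
  let ?U = "Matrix.mat n n (\<lambda>(l, j). \<Prod>r<l. x j - x r)"
  have "Matrix.mat n n (\<lambda>(i, j). x j ^ i) = ?T * ?U"
  proof (rule eq_matI)
    fix i j assume "i < dim_row (?T * ?U)" "j < dim_col (?T * ?U)"
    then have ij: "i < n" "j < n" by auto
    have "x j ^ i = (\<Sum>l\<le>i. newton_coeff x i l * (\<Prod>r<l. x j - x r))" by (rule power_newton)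
    also have "\<dots> = (\<Sum>l\<in>{0..<n}. newton_coeff x i l * (\<Prod>r<l. x j - x r))"
      by (rule sum.mono_neutral_left) (use ij in \<open>auto simp: newton_coeff_eq_0\<close>)
    finally show "Matrix.mat n n (\<lambda>(i, j). x j ^ i) $$ (i, j) = (?T * ?U) $$ (i, j)"
      using ij by (simp add: scalar_prod_def)
  qed auto
  moreover have "Determinant.det ?T = 1"
  proof -
    have "diag_mat ?T = replicate n 1"
      by (rule nth_equalityI) (auto simp: diag_mat_def newton_coeff_diag)
    moreover have "Determinant.det ?T = prod_list (diag_mat ?T)"
      by (rule Determinant.det_lower_triangular[of n]) (auto simp: newton_coeff_eq_0)
    ultimately show ?thesis by (simp add: prod_list_replicate)
  qed
  moreover have "Determinant.det ?U = (\<Prod>j<n. \<Prod>r<j. x j - x r)"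
  proof -
    have "upper_triangular ?U"
      unfolding upper_triangular_def by (auto intro!: prod_zero)
    then have "Determinant.det ?U = prod_list (diag_mat ?U)"
      by (rule Determinant.det_upper_triangular[of _ n]) simp
    also have "diag_mat ?U = map (\<lambda>j. \<Prod>r<j. x j - x r) [0..<n]"
      by (auto simp: diag_mat_def)
    finally show ?thesis
      using prod.distinct_set_conv_list[of "[0..<n]" "\<lambda>j. \<Prod>r<j. x j - x r"]
      by (simp add: atLeast0LessThan)
  qed
  ultimately show ?thesis by (simp add: Determinant.det_mult[of _ n])
qed

definition vdm :: "nat \<Rightarrow> laurent" where
  "vdm n = (\<Prod>j<n. \<Prod>r<j. X j 1 - X r 1)"

text \<open>The constant is the sign of the order reversal; being a constant, it passes through all
  derivations.\<close>

lemma alt_dlt: "\<exists>c. alt n (dlt n) = of_int c * vdm n"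
proof -
  define p where "p i = (if i < n then n - 1 - i else i)" for i
  have "bij_betw p {0..<n} {0..<n}"
    by (rule bij_betw_byWitness[of _ p]) (auto simp: p_def)
  then have p: "p permutes {0..<n}"
    by (rule bij_imp_permutes) (auto simp: p_def)
  have "alt n (dlt n) = alt n (\<lambda>i. int (p i))"
    by (rule alt_cong) (auto simp: dlt_def p_def)
  also have "\<dots> = of_int (sign p) * alt n int"
    by (rule alt_permute[OF p])
  also have "alt n int = vdm n"
    using det_vandermonde[of n "\<lambda>j. X j 1"] by (simp add: alt_def vdm_def X_power)
  finally show ?thesis by blast
qed

lemma alt_dlt_nonzero: "alt n (dlt n) \<noteq> 0"
  using lookup_0_alt_mult_alt[of n "dlt n" "dlt n"] by (auto simp: dlt_def)

section \<open>Logarithmic derivatives of the Vandermonde product\<close>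

definition Theta :: "nat \<Rightarrow> int \<Rightarrow> laurent \<Rightarrow> laurent" where
  "Theta n a f = (\<Sum>i<n. X i a * E i f)"

text \<open>
  Twice the logarithmic derivative of the Vandermonde product along \<open>\<Sum> x\<^sub>i\<^sup>a\<^sup>+\<^sup>1 \<partial>\<^sub>i\<close>, up to
  the multiple of \<open>p\<^sub>a\<close> coming from the diagonal terms.
\<close>
definition loop_term :: "nat \<Rightarrow> int \<Rightarrow> laurent" where
  "loop_term n a = (if a \<ge> 0 then \<Sum>c<nat a. psum n (int c) * psum n (a - int c)
     else - (\<Sum>c<nat (- a). psum n (- 1 - int c) * psum n (a + 1 + int c)))"

lemma Theta_mult: "Theta n a (f * g) = Theta n a f * g + f * Theta n a g"
  and Theta_add: "Theta n a (f + g) = Theta n a f + Theta n a g"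
  and Theta_cst: "Theta n a (cst c) = 0"
  by (simp_all add: Theta_def E_mult E_add algebra_simps sum.distrib sum_distrib_left)

lemma E_psum: "i < n \<Longrightarrow> E i (psum n b) = cst (of_int b) * X i b"
  by (simp add: psum_def E_sum E_X sum.delta)

lemma Theta_psum: "Theta n a (psum n b) = cst (of_int b) * psum n (a + b)"
  unfolding Theta_def
  by (simp add: E_psum, simp add: psum_def sum_distrib_left X_mult[symmetric] mult_ac)

lemma Theta_prod:
  assumes "finite A" "\<And>i. i \<in> A \<Longrightarrow> Theta n a (f i) = f i * g i"
  shows "Theta n a (\<Prod>i\<in>A. f i) = (\<Prod>i\<in>A. f i) * (\<Sum>i\<in>A. g i)"
  using assms
proof (induction A)
  case empty
  then show ?case using Theta_cst[of n a 1] by simp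
qed (simp add: Theta_mult algebra_simps)

text \<open>Quotient \<open>(x\<^sup>a\<^sup>+\<^sup>1 - y\<^sup>a\<^sup>+\<^sup>1) / (x - y)\<close>, also for negative \<open>a\<close>.\<close>
definition diff_quot :: "int \<Rightarrow> nat \<Rightarrow> nat \<Rightarrow> laurent" where
  "diff_quot a i j = (if a \<ge> 0 then \<Sum>c<Suc (nat a). X i (int c) * X j (a - int c)
     else - (\<Sum>c<nat (- a) - 1. X i (- 1 - int c) * X j (a + 1 + int c)))"

lemma telescope_mult:
  "(X i 1 - X j 1) * (\<Sum>c<m. X i (b + int c) * X j (d - int c))
     = X i (b + int m) * X j (d + 1 - int m) - X i b * X j (d + 1)"
proof (induction m)
  case (Suc m)
  have "(X i 1 - X j 1) * (\<Sum>c<Suc m. X i (b + int c) * X j (d - int c))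
    = (X i (b + int m) * X j (d + 1 - int m) - X i b * X j (d + 1))
      + ((X i 1 * X i (b + int m)) * X j (d - int m) - X i (b + int m) * (X j 1 * X j (d - int m)))"
    using Suc by (simp add: algebra_simps)
  also have "\<dots> = X i (b + int (Suc m)) * X j (d + 1 - int (Suc m)) - X i b * X j (d + 1)"
    unfolding X_mult by (simp add: algebra_simps)
  finally show ?case .
qed simp

lemma diff_quot: "X i (a + 1) - X j (a + 1) = (X i 1 - X j 1) * diff_quot a i j"
proof (cases "a \<ge> 0")
  case True
  then show ?thesis using telescope_mult[of i j 0 a "Suc (nat a)"]
    by (simp add: diff_quot_def add.commute[of 1 a] del: sum.lessThan_Suc)
next
  case False
  \<comment> \<open>\<open>diff_quot\<close> lists the exponents of x_i downwards from -1, whereas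
    \<open>telescope_mult\<close> lists them upwards from a + 1.\<close>
  have "(\<Sum>c<nat (- a) - 1. X i (- 1 - int c) * X j (a + 1 + int c))
      = (\<Sum>c<nat (- a) - 1. X i (a + 1 + int c) * X j (- 1 - int c))"
    by (rule sum.reindex_bij_witness[of _ "\<lambda>c. nat (- a) - 2 - c" "\<lambda>c. nat (- a) - 2 - c"])
      (use False in \<open>auto simp: of_nat_diff ac_simps\<close>)
  then show ?thesis using False telescope_mult[of i j "a + 1" "-1" "nat (- a) - 1"]
    by (simp add: diff_quot_def algebra_simps of_nat_diff)
qed

lemma diff_quot_sym: "diff_quot a i j = diff_quot a j i"
proof (cases "a \<ge> 0")
  case True
  then show ?thesis unfolding diff_quot_def if_P[OF True]
    by (intro sum.reindex_bij_witness[of _ "\<lambda>c. nat a - c" "\<lambda>c. nat a - c"])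
      (auto simp: of_nat_diff mult.commute)
next
  case False
  then show ?thesis unfolding diff_quot_def
    by (auto intro!: sum.reindex_bij_witness[of _ "\<lambda>c. nat (- a) - 2 - c" "\<lambda>c. nat (- a) - 2 - c"]
        simp: of_nat_diff ac_simps)
qed

lemma diff_quot_diag: "diff_quot a i i = cst (of_int (a + 1)) * X i a"
proof (cases "a \<ge> 0")
  case True
  have "diff_quot a i i = of_nat (Suc (nat a)) * X i a"
    unfolding diff_quot_def X_mult using True by simp
  also have "of_nat (Suc (nat a)) = cst (of_int (a + 1))"
    unfolding of_nat_cst using True by (simp add: add.commute)
  finally show ?thesis .
next
  case False
  have "diff_quot a i i = - (of_nat (nat (- a) - 1) * X i a)"
    unfolding diff_quot_def X_mult using False by simp
  also have "of_nat (nat (- a) - 1) = cst (of_int (- a - 1))"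
    unfolding of_nat_cst using False by (simp add: of_nat_diff)
  finally show ?thesis by (simp add: cst_diff cst_add cst_minus algebra_simps)
qed

text \<open>Summation over both indices turns products of monomials into products of power sums.
  Compared with \<open>loop_term\<close>, the quotient has one term more for a \<ge> 0 and one
  negative term fewer for a < 0; in both cases the difference is p_0 p_a.\<close>

lemma sum_diff_quot:
  "(\<Sum>i<n. \<Sum>j<n. diff_quot a i j) = loop_term n a + psum n 0 * psum n a"
proof (cases "a \<ge> 0")
  case True
  then have "(\<Sum>i<n. \<Sum>j<n. diff_quot a i j)
     = (\<Sum>i<n. \<Sum>j<n. \<Sum>c<Suc (nat a). X i (int c) * X j (a - int c))"
    by (simp only: diff_quot_def if_True)
  also have "\<dots> = (\<Sum>c<Suc (nat a). \<Sum>i<n. \<Sum>j<n. X i (int c) * X j (a - int c))"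
    by (subst (2) sum.swap, subst sum.swap) (rule refl)
  also have "\<dots> = (\<Sum>c<Suc (nat a). psum n (int c) * psum n (a - int c))"
    by (simp add: psum_def sum_product)
  finally show ?thesis using True by (simp add: loop_term_def mult.commute)
next
  case False
  then have "(\<Sum>i<n. \<Sum>j<n. diff_quot a i j)
     = - (\<Sum>i<n. \<Sum>j<n. \<Sum>c<nat (- a) - 1. X i (- 1 - int c) * X j (a + 1 + int c))"
    by (simp only: diff_quot_def if_False sum_negf)
  also have "(\<Sum>i<n. \<Sum>j<n. \<Sum>c<nat (- a) - 1. X i (- 1 - int c) * X j (a + 1 + int c))
      = (\<Sum>c<nat (- a) - 1. \<Sum>i<n. \<Sum>j<n. X i (- 1 - int c) * X j (a + 1 + int c))"
    by (subst (2) sum.swap, subst sum.swap) (rule refl)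
  also have "\<dots> = (\<Sum>c<nat (- a) - 1. psum n (- 1 - int c) * psum n (a + 1 + int c))"
    by (simp add: psum_def sum_product)
  finally have 1: "(\<Sum>i<n. \<Sum>j<n. diff_quot a i j)
      = - (\<Sum>c<nat (- a) - 1. psum n (- 1 - int c) * psum n (a + 1 + int c))" .
  obtain m where m: "nat (- a) = Suc m" using False by (cases "nat (- a)") auto
  then have "psum n (- 1 - int m) * psum n (a + 1 + int m) = psum n a * psum n 0"
    using False by (intro arg_cong2[of _ _ _ _ "(*)"] arg_cong[of _ _ "psum n"]) simp_all
  then show ?thesis unfolding 1 loop_term_def if_not_P[OF False] m
    by (simp add: mult.commute)
qed

text \<open>On each factor x_j - x_r the derivation acts as multiplication by the difference
  quotient. Doubling the sum over r < j gives the sum over all pairs minus the diagonal: the pairs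
  contribute p_0 = n beside \<open>loop_term\<close>, the diagonal contributes a + 1.\<close>

lemma Theta_vdm:
  "2 * Theta n a (vdm n)
     = vdm n * (loop_term n a + cst (of_nat n - 1 - of_int a) * psum n a)"
proof -
  let ?D = "\<Sum>j<n. \<Sum>r<j. diff_quot a j r"
  have "Theta n a (vdm n) = vdm n * ?D"
    unfolding vdm_def
  proof (intro Theta_prod)
    fix j r assume "j \<in> {..<n}" "r \<in> {..<j}"
    then have jr: "j < n" "r < n" by auto
    have X1: "Theta n a (X j 1) = X j (a + 1)" if "j < n" for j
    proof -
      have "Theta n a (X j 1) = (\<Sum>i<n. if i = j then X j a * X j 1 else 0)"
        unfolding Theta_def by (rule sum.cong) (auto simp: E_X)
      then show ?thesis using that by (simp add: sum.delta X_mult)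
    qed
    have "Theta n a (X j 1 - X r 1) = Theta n a (X j 1) - Theta n a (X r 1)"
      by (simp add: Theta_def E_diff right_diff_distrib sum_subtractf)
    then show "Theta n a (X j 1 - X r 1) = (X j 1 - X r 1) * diff_quot a j r"
      by (simp add: diff_quot X1 jr)
  qed auto
  moreover have "(\<Sum>i<n. \<Sum>j<n. diff_quot a i j) = 2 * ?D + (\<Sum>i<n. diff_quot a i i)"
  proof (induction n)
    case (Suc n)
    have "(\<Sum>i<n. diff_quot a i n) = (\<Sum>i<n. diff_quot a n i)"
      by (rule sum.cong) (simp_all add: diff_quot_sym)
    then show ?case using Suc by (simp add: sum.distrib algebra_simps)
  qed simp
  moreover have "(\<Sum>i<n. diff_quot a i i) = cst (of_int (a + 1)) * psum n a"
    by (simp add: diff_quot_diag psum_def sum_distrib_left)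
  moreover have "psum n 0 = cst (of_nat n)"
    by (simp add: psum_def flip: of_nat_cst)
  ultimately have "2 * ?D = loop_term n a + cst (of_nat n) * psum n a - cst (of_int (a + 1)) * psum n a"
    using sum_diff_quot[of a n] by (simp add: eq_diff_eq)
  also have "\<dots> = loop_term n a + cst (of_nat n - 1 - of_int a) * psum n a"
    by (simp add: cst_diff cst_add algebra_simps)
  finally have "2 * ?D = loop_term n a + cst (of_nat n - 1 - of_int a) * psum n a" .
  moreover have "2 * Theta n a (vdm n) = vdm n * (2 * ?D)"
    unfolding \<open>Theta n a (vdm n) = vdm n * ?D\<close> by (rule mult.left_commute)
  ultimately show ?thesis by simp
qed

lemma Theta_alt_dlt:
  "2 * Theta n a (alt n (dlt n))
     = alt n (dlt n) * (loop_term n a + cst (of_nat n - 1 - of_int a) * psum n a)"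
proof -
  obtain c where c: "alt n (dlt n) = of_int c * vdm n" using alt_dlt by blast
  have "Theta n a (of_int c * vdm n) = of_int c * Theta n a (vdm n)"
    by (simp only: Theta_mult of_int_cst Theta_cst) simp
  then have "2 * Theta n a (alt n (dlt n)) = of_int c * (2 * Theta n a (vdm n))"
    by (simp add: c mult.left_commute)
  then show ?thesis unfolding Theta_vdm by (simp add: c mult.assoc)
qed

subsection \<open>Eigenvalues of a unitary matrix\<close>

definition adj :: "complex^'n^'n \<Rightarrow> complex^'n^'n" where
  "adj M = Finite_Cartesian_Product.transpose (mat_cnj M)"

lemma adj_nth: "adj M $ i $ j = cnj (M $ j $ i)"
  by (simp add: adj_def mat_cnj_def Finite_Cartesian_Product.transpose_def map_matrix_def)

lemma mat_cnj_nth: "mat_cnj M $ i $ j = cnj (M $ i $ j)"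
  by (simp add: mat_cnj_def map_matrix_def)

lemma unitary_iff: "M \<in> unitary_group \<longleftrightarrow> M ** adj M = idm"
  by (simp add: unitary_group_def adj_def)

lemma unitary_left: "M \<in> unitary_group \<Longrightarrow> adj M ** M = idm"
  unfolding unitary_iff using matrix_left_right_inverse by blast

lemma mat_pow_0: "mat_pow M 0 = idm"
  and mat_pow_Suc: "mat_pow M (Suc k) = M ** mat_pow M k"
  by (simp_all add: mat_pow_def)

lemma mat_pow_conj:
  fixes P Q T :: "complex^'n^'n"
  assumes "Q ** P = idm" "P ** Q = idm"
  shows "mat_pow (P ** T ** Q) k = P ** mat_pow T k ** Q"
proof (induction k)
  case (Suc k)
  have "P ** T ** Q ** (P ** mat_pow T k ** Q) = P ** T ** (Q ** P) ** mat_pow T k ** Q"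
    by (simp add: matrix_mul_assoc)
  then show ?case by (simp add: mat_pow_Suc Suc assms matrix_mul_assoc)
qed (simp add: mat_pow_0 assms)

lemma matrix_add_rdistrib: "(A + B) ** C = A ** C + B ** (C :: 'a::semiring_1^'n^'m)"
  by (simp add: vec_eq_iff matrix_matrix_mult_def sum.distrib distrib_right)

text \<open>The group consists of matrices indexed by a finite type, triangular forms are handled
  for matrices indexed by numbers. An enumeration \<open>e\<close> carries the permutations in one
  Leibniz formula to those in the other and preserves signs.\<close>

lemma det_reindex:
  fixes A :: "'a::comm_ring_1^'n^'n"
  assumes e: "bij_betw e {0..<CARD('n)} (UNIV :: 'n set)"
  shows "Determinants.det A = Determinant.det (Matrix.mat CARD('n) CARD('n) (\<lambda>(i, j). A $ e i $ e j))"
proof -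
  let ?I = "{0..<CARD('n)}"
  have inj: "inj_on e ?I" using e by (rule bij_betw_imp_inj_on)
  have bij: "bij_betw (map_permutation ?I e) {p. p permutes ?I} {p. p permutes (UNIV :: 'n set)}"
  proof -
    have "map_permutation ?I e p = (\<lambda>x. if x \<in> UNIV then e (p (inv_into ?I e x)) else x)" for p
      using e by (auto simp: map_permutation_def restrict_id_def bij_betw_def fun_eq_iff)
    then have "map_permutation ?I e = (\<lambda>p x. if x \<in> UNIV then e (p (inv_into ?I e x)) else x)"
      by (rule ext)
    then show ?thesis using bij_betw_permutations[OF e] by simp
  qed
  have "Determinants.det A = (\<Sum>p | p permutes ?I.
      of_int (sign (map_permutation ?I e p)) * (\<Prod>i\<in>UNIV. A $ i $ map_permutation ?I e p i))"
    unfolding Determinants.det_def by (rule sum.reindex_bij_betw[OF bij, symmetric])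
  also have "\<dots> = (\<Sum>p | p permutes ?I. of_int (sign p) * (\<Prod>i\<in>?I. A $ e i $ e (p i)))"
  proof (rule sum.cong)
    fix p assume "p \<in> {p. p permutes ?I}"
    then have p: "p permutes ?I" by simp
    have "(\<Prod>i\<in>UNIV. A $ i $ map_permutation ?I e p i) = (\<Prod>i\<in>?I. A $ e i $ map_permutation ?I e p (e i))"
      by (rule prod.reindex_bij_betw[OF e, symmetric])
    also have "\<dots> = (\<Prod>i\<in>?I. A $ e i $ e (p i))"
      by (rule prod.cong) (auto simp: map_permutation_apply[OF inj])
    finally show "of_int (sign (map_permutation ?I e p)) * (\<Prod>i\<in>UNIV. A $ i $ map_permutation ?I e p i)
        = of_int (sign p) * (\<Prod>i\<in>?I. A $ e i $ e (p i))"
      using sign_map_permutation[OF inj p] by simp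
  qed simp
  also have "\<dots> = Determinant.det (Matrix.mat CARD('n) CARD('n) (\<lambda>(i, j). A $ e i $ e j))"
    by (subst Determinant.det_def'[of _ "CARD('n)"])
      (auto intro!: sum.cong prod.cong simp: permutes_in_image)
  finally show ?thesis .
qed

text \<open>The Schur decomposition, transported along an enumeration. Similarity to a triangular
  matrix is enough to read off the traces of powers and det(c + M).\<close>

lemma triangularization:
  fixes M :: "complex^'n^'n"
  shows "\<exists>P Q T (e :: nat \<Rightarrow> 'n). bij_betw e {0..<CARD('n)} UNIV \<and> P ** Q = idm
    \<and> Q ** P = idm \<and> M = P ** T ** Q
    \<and> (\<forall>i<CARD('n). \<forall>j<i. T $ e i $ e j = 0)"
proof -
  let ?n = "CARD('n)"
  obtain e :: "nat \<Rightarrow> 'n" where e: "bij_betw e {0..<?n} UNIV"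
    using ex_bij_betw_nat_finite[of "UNIV :: 'n set"] by auto
  define d where "d = inv_into {0..<?n} e"
  have d: "bij_betw d UNIV {0..<?n}" unfolding d_def by (rule bij_betw_inv_into[OF e])
  have dlt: "d a < ?n" for a using bij_betwE[OF d] by simp
  have de: "d (e i) = i" if "i < ?n" for i
    unfolding d_def using that by (intro inv_into_f_f bij_betw_imp_inj_on[OF e]) simp
  have ed: "e (d a) = a" for a
    unfolding d_def using e by (intro f_inv_into_f) (simp add: bij_betw_def)
  define J :: "complex^'n^'n \<Rightarrow> complex mat" where "J A = Matrix.mat ?n ?n (\<lambda>(i, j). A $ e i $ e j)" for A
  define K :: "complex mat \<Rightarrow> complex^'n^'n" where "K B = (\<chi> a b. B $$ (d a, d b))" for B
  have JK: "K (J A) = A" for A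
    by (simp add: K_def J_def vec_eq_iff dlt ed)
  have K_mult: "K (A * B) = K A ** K B" if "A \<in> carrier_mat ?n ?n" "B \<in> carrier_mat ?n ?n" for A B
  proof -
    have "(A * B) $$ (d a, d b) = (\<Sum>c\<in>UNIV. A $$ (d a, d c) * B $$ (d c, d b))" for a b
    proof -
      have "(A * B) $$ (d a, d b) = (\<Sum>l\<in>{0..<?n}. A $$ (d a, l) * B $$ (l, d b))"
        using that dlt[of a] dlt[of b] by (simp add: scalar_prod_def)
      also have "\<dots> = (\<Sum>c\<in>UNIV. A $$ (d a, d c) * B $$ (d c, d b))"
        by (rule sum.reindex_bij_betw[OF d, symmetric])
      finally show ?thesis .
    qed
    then show ?thesis by (simp add: K_def vec_eq_iff matrix_matrix_mult_def)
  qed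
  have K_1: "K (1\<^sub>m ?n) = idm"
    using dlt ed by (auto simp: K_def vec_eq_iff mat_def) metis
  have JM: "J M \<in> carrier_mat ?n ?n" by (simp add: J_def)
  obtain es where "char_poly (J M) = (\<Prod>a\<leftarrow>es. [:- a, 1:])"
    using char_poly_factorized[OF JM] by blast
  from schur_decomposition_exists[OF JM this] obtain B where
    B: "B \<in> carrier_mat ?n ?n" "upper_triangular B" "similar_mat (J M) B" by blast
  from B(3) obtain P Q where PQ: "similar_mat_wit (J M) B P Q" by (auto simp: similar_mat_def)
  note w = similar_mat_witD2[OF JM PQ]
  have c: "P \<in> carrier_mat ?n ?n" "Q \<in> carrier_mat ?n ?n" using w by auto
  have "K P ** K Q = idm" "K Q ** K P = idm"
    using w K_1 K_mult[OF c] K_mult[OF c(2,1)] by simp_all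
  moreover have "M = K P ** K B ** K Q"
    using w(3) JK[of M] K_mult[OF c(1) B(1)] K_mult[OF mult_carrier_mat[OF c(1) B(1)] c(2)] by simp
  moreover have "\<forall>i<?n. \<forall>j<i. K B $ e i $ e j = 0"
    using B(1,2) by (auto simp: K_def de upper_triangular_def)
  ultimately show ?thesis using e by blast
qed

lemma trace_similar:
  fixes P Q T :: "complex^'n^'n"
  assumes "Q ** P = idm"
  shows "trace (P ** T ** Q) = trace T"
proof -
  have "trace (P ** (T ** Q)) = trace (T ** Q ** P)"
    by (rule trace_mul_sym)
  then show ?thesis using assms by (metis matrix_mul_assoc matrix_mul_rid)
qed

lemma unitary_norm_eigenvalue:
  fixes M :: "complex^'n^'n"
  assumes M: "M \<in> unitary_group" and v: "v \<noteq> 0" "M *v v = x *s v"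
  shows "cmod x = 1"
proof -
  have U: "(\<Sum>i\<in>UNIV. cnj (M $ i $ k) * M $ i $ j) = (if k = j then 1 else 0)" for k j
    using unitary_left[OF M] by (simp add: vec_eq_iff matrix_matrix_mult_def adj_nth mat_def)
  have "(\<Sum>i\<in>UNIV. (M *v v) $ i * cnj ((M *v v) $ i))
     = (\<Sum>i\<in>UNIV. \<Sum>j\<in>UNIV. \<Sum>k\<in>UNIV. v $ j * cnj (v $ k) * (cnj (M $ i $ k) * M $ i $ j))"
    by (simp add: matrix_vector_mult_def sum_product mult_ac)
  also have "\<dots> = (\<Sum>j\<in>UNIV. \<Sum>k\<in>UNIV. v $ j * cnj (v $ k) * (\<Sum>i\<in>UNIV. cnj (M $ i $ k) * M $ i $ j))"
    unfolding sum_distrib_left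
    by (subst sum.swap, rule sum.cong[OF refl], rule sum.swap)
  also have "\<dots> = (\<Sum>j\<in>UNIV. v $ j * cnj (v $ j))"
    by (simp add: U if_distrib[of "\<lambda>u. _ * u"] sum.delta cong: if_cong)
  finally have "(\<Sum>i\<in>UNIV. (x * cnj x) * (v $ i * cnj (v $ i))) = (\<Sum>j\<in>UNIV. v $ j * cnj (v $ j))"
    by (simp add: v(2) mult_ac)
  then have *: "(x * cnj x) * (\<Sum>i\<in>UNIV. v $ i * cnj (v $ i)) = (\<Sum>i\<in>UNIV. v $ i * cnj (v $ i))"
    by (simp add: sum_distrib_left)
  obtain i where "v $ i \<noteq> 0" using v(1) by (auto simp: vec_eq_iff)
  then have "(\<Sum>i\<in>UNIV. (cmod (v $ i))\<^sup>2) > 0"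
    by (intro sum_pos2[of _ i]) auto
  moreover have "(\<Sum>i\<in>UNIV. v $ i * cnj (v $ i)) = of_real (\<Sum>i\<in>UNIV. (cmod (v $ i))\<^sup>2)"
    by (simp only: complex_norm_square[symmetric] of_real_sum)
  ultimately have "(\<Sum>i\<in>UNIV. v $ i * cnj (v $ i)) \<noteq> 0"
    by (metis less_irrefl of_real_eq_0_iff)
  then have "x * cnj x = 1" using * by simp
  then have "(cmod x)\<^sup>2 = 1" by (metis complex_norm_square of_real_eq_1_iff)
  then show ?thesis using norm_ge_zero[of x] by (simp add: power2_eq_1_iff)
qed

lemma unitary_eigenvalues:
  fixes M :: "complex^'n^'n"
  assumes M: "M \<in> unitary_group"
  shows "\<exists>x. (\<forall>i<CARD('n). cmod (x i) = 1) \<and> (\<forall>k. trace (mat_pow M k) = (\<Sum>i<CARD('n). x i ^ k))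
     \<and> Determinants.det (idm + M) = (\<Prod>i<CARD('n). 1 + x i)"
proof -
  let ?n = "CARD('n)"
  obtain P Q T and e :: "nat \<Rightarrow> 'n" where e: "bij_betw e {0..<?n} UNIV"
    and PQ: "P ** Q = idm" "Q ** P = idm"
    and MT: "M = P ** T ** Q" and tri: "\<forall>i<?n. \<forall>j<i. T $ e i $ e j = 0"
    using triangularization[of M] by blast
  define x where "x i = T $ e i $ e i" for i
  have sum_e: "(\<Sum>a\<in>UNIV. f a) = (\<Sum>i<?n. f (e i))" for f :: "'n \<Rightarrow> complex"
    using sum.reindex_bij_betw[OF e, of f] by (simp add: atLeast0LessThan)
  have inj: "e i = e j \<longleftrightarrow> i = j" if "i < ?n" "j < ?n" for i j
    using bij_betw_imp_inj_on[OF e] that by (auto simp: inj_on_def)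
  have pow: "(\<forall>i<?n. \<forall>j<i. mat_pow T k $ e i $ e j = 0) \<and> (\<forall>i<?n. mat_pow T k $ e i $ e i = x i ^ k)" for k
  proof (induction k)
    case 0
    then show ?case by (auto simp: mat_pow_0 mat_def inj)
  next
    case (Suc k)
    have nth: "mat_pow T (Suc k) $ e i $ e j = (\<Sum>l<?n. T $ e i $ e l * mat_pow T k $ e l $ e j)" for i j
      by (simp add: mat_pow_Suc matrix_matrix_mult_def sum_e)
    have 0: "T $ e i $ e l * mat_pow T k $ e l $ e j = 0" if "i < ?n" "j \<le> i" "l < ?n" "l \<noteq> i \<or> j < i" for i j l
    proof (cases "l < i")
      case False
      then have "j < l" using that by auto
      then show ?thesis using Suc that by simp
    qed (use tri that in simp)
    have "mat_pow T (Suc k) $ e i $ e i = x i * x i ^ k" if "i < ?n" for i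
    proof -
      have "mat_pow T (Suc k) $ e i $ e i = (\<Sum>l\<in>{i}. T $ e i $ e l * mat_pow T k $ e l $ e i)"
        unfolding nth by (rule sum.mono_neutral_right) (use that 0 in auto)
      then show ?thesis using Suc that by (simp add: x_def)
    qed
    moreover have "mat_pow T (Suc k) $ e i $ e j = 0" if "i < ?n" "j < i" for i j
      unfolding nth by (rule sum.neutral) (use that 0 in auto)
    ultimately show ?case by simp
  qed
  have tr: "trace (mat_pow M k) = (\<Sum>i<?n. x i ^ k)" for k
    unfolding MT mat_pow_conj[OF PQ(2,1)] trace_similar[OF PQ(2)]
    by (simp add: trace_def sum_e pow)
  \<comment> \<open>The shift c serves twice: c = 1 is the determinant in the claim, and c = - x_i
    shows that M - x_i is singular, so that x_i has an eigenvector and modulus 1.\<close>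
  have det: "Determinants.det (mat c + M) = (\<Prod>i<?n. c + x i)" for c
  proof -
    have Pc: "P ** mat c ** Q = mat c"
    proof -
      have "P ** mat c = mat c ** P"
        by (simp add: vec_eq_iff matrix_matrix_mult_def mat_def
            if_distrib[of "\<lambda>u. _ * u"] if_distrib[of "\<lambda>u. u * _"] sum.delta sum.delta' mult.commute cong: if_cong)
      then show ?thesis using PQ by (metis matrix_mul_assoc matrix_mul_rid)
    qed
    have "mat c + M = P ** (mat c + T) ** Q"
      by (simp add: MT matrix_add_ldistrib matrix_add_rdistrib Pc)
    then have "Determinants.det (mat c + M)
        = (Determinants.det P * Determinants.det Q) * Determinants.det (mat c + T)"
      by (simp add: Determinants.det_mul)
    also have "Determinants.det P * Determinants.det Q = 1"
      by (metis Determinants.det_mul Determinants.det_I PQ(1))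
    also have "Determinants.det (mat c + T)
       = Determinant.det (Matrix.mat ?n ?n (\<lambda>(i, j). (mat c + T) $ e i $ e j))"
      (is "_ = Determinant.det ?A") by (rule det_reindex[OF e])
    also have "\<dots> = prod_list (diag_mat ?A)"
      by (rule Determinant.det_upper_triangular[of _ ?n])
        (use tri in \<open>auto simp: upper_triangular_def mat_def inj\<close>)
    also have "diag_mat ?A = map (\<lambda>i. c + x i) [0..<?n]"
      by (auto simp: diag_mat_def mat_def x_def)
    finally show ?thesis
      using prod.distinct_set_conv_list[of "[0..<?n]" "\<lambda>i. c + x i"] by (simp add: atLeast0LessThan)
  qed
  have "cmod (x i) = 1" if i: "i < ?n" for i
  proof -
    let ?A = "mat (- x i) + M"
    have "Determinants.det ?A = 0" unfolding det by (rule prod_zero) (use i in auto)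
    then have "\<not> (\<exists>B. B ** ?A = idm)"
      by (metis Determinants.det_mul Determinants.det_I mult_zero_right zero_neq_one)
    then obtain v where v: "?A *v v = 0" "v \<noteq> 0"
      unfolding matrix_left_invertible_ker by blast
    have "mat (- x i) *v v = - (x i *s v)"
      by (simp add: vec_eq_iff matrix_vector_mult_def mat_def
          if_distrib[of "\<lambda>u. u * _"] sum.delta sum.delta' cong: if_cong)
    then have "M *v v = x i *s v"
      using v(1) by (simp add: matrix_vector_mult_add_rdistrib)
    then show ?thesis using unitary_norm_eigenvalue[OF M v(2)] by simp
  qed
  then show ?thesis using tr det[of 1] by blast
qed

subsection \<open>First-order expansions\<close>

text \<open>The remainder is uniform on \<open>A\<close>, which lets the expansion be integrated.
  Boundedness of both coefficients is included to make the notion stable under products.\<close>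

definition expands :: "'a set \<Rightarrow> (real \<Rightarrow> 'a \<Rightarrow> complex) \<Rightarrow> ('a \<Rightarrow> complex) \<Rightarrow> ('a \<Rightarrow> complex) \<Rightarrow> bool" where
  "expands A g g0 g1 \<longleftrightarrow>
     (\<exists>C. \<forall>M\<in>A. \<forall>t\<in>{0..1}. cmod (g t M - g0 M - of_real t * g1 M) \<le> C * t\<^sup>2) \<and>
     (\<exists>B. \<forall>M\<in>A. cmod (g0 M) \<le> B \<and> cmod (g1 M) \<le> B)"

lemma expandsE:
  assumes "expands A g g0 g1"
  obtains C where "C \<ge> 0" "\<And>M t. M \<in> A \<Longrightarrow> 0 \<le> t \<Longrightarrow> t \<le> 1 \<Longrightarrow> cmod (g t M - g0 M - of_real t * g1 M) \<le> C * t\<^sup>2"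
    "\<And>M. M \<in> A \<Longrightarrow> cmod (g0 M) \<le> C" "\<And>M. M \<in> A \<Longrightarrow> cmod (g1 M) \<le> C"
proof -
  from assms obtain C B where C: "\<forall>M\<in>A. \<forall>t\<in>{0..1}. cmod (g t M - g0 M - of_real t * g1 M) \<le> C * t\<^sup>2"
    and B: "\<forall>M\<in>A. cmod (g0 M) \<le> B \<and> cmod (g1 M) \<le> B"
    by (auto simp: expands_def)
  show ?thesis
  proof (rule that[of "max 0 (max C B)"])
    fix M t assume "M \<in> A" "0 \<le> t" "t \<le> (1::real)"
    then have "cmod (g t M - g0 M - of_real t * g1 M) \<le> C * t\<^sup>2" using C by auto
    also have "\<dots> \<le> max 0 (max C B) * t\<^sup>2" by (rule mult_right_mono) auto
    finally show "cmod (g t M - g0 M - of_real t * g1 M) \<le> max 0 (max C B) * t\<^sup>2" .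
  qed (use B in force)+
qed

lemma expandsI:
  assumes "\<And>M t. M \<in> A \<Longrightarrow> 0 \<le> t \<Longrightarrow> t \<le> 1 \<Longrightarrow> cmod (g t M - g0 M - of_real t * g1 M) \<le> C * t\<^sup>2"
    "\<And>M. M \<in> A \<Longrightarrow> cmod (g0 M) \<le> B" "\<And>M. M \<in> A \<Longrightarrow> cmod (g1 M) \<le> B'"
  shows "expands A g g0 g1"
  unfolding expands_def using assms
  by (intro conjI exI[of _ C] exI[of _ "max B B'"]) (auto simp: le_max_iff_disj)

lemma expands_const: "(\<And>M. M \<in> A \<Longrightarrow> cmod (f M) \<le> B) \<Longrightarrow> expands A (\<lambda>t. f) f (\<lambda>_. 0)"
  by (rule expandsI[of _ _ _ _ 0 B 0]) auto

lemma expands_add: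
  assumes "expands A g g0 g1" "expands A h h0 h1"
  shows "expands A (\<lambda>t M. g t M + h t M) (\<lambda>M. g0 M + h0 M) (\<lambda>M. g1 M + h1 M)"
proof -
  from assms(1) obtain C where C: "C \<ge> 0" "\<And>M t. M \<in> A \<Longrightarrow> 0 \<le> t \<Longrightarrow> t \<le> 1 \<Longrightarrow> cmod (g t M - g0 M - of_real t * g1 M) \<le> C * t\<^sup>2"
    "\<And>M. M \<in> A \<Longrightarrow> cmod (g0 M) \<le> C" "\<And>M. M \<in> A \<Longrightarrow> cmod (g1 M) \<le> C" by (rule expandsE) blast
  from assms(2) obtain D where D: "D \<ge> 0" "\<And>M t. M \<in> A \<Longrightarrow> 0 \<le> t \<Longrightarrow> t \<le> 1 \<Longrightarrow> cmod (h t M - h0 M - of_real t * h1 M) \<le> D * t\<^sup>2"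
    "\<And>M. M \<in> A \<Longrightarrow> cmod (h0 M) \<le> D" "\<And>M. M \<in> A \<Longrightarrow> cmod (h1 M) \<le> D" by (rule expandsE) blast
  show ?thesis
  proof (rule expandsI[of _ _ _ _ "C + D" "C + D" "C + D"])
    fix M t assume Mt: "M \<in> A" "0 \<le> t" "t \<le> (1::real)"
    have "g t M + h t M - (g0 M + h0 M) - of_real t * (g1 M + h1 M)
        = (g t M - g0 M - of_real t * g1 M) + (h t M - h0 M - of_real t * h1 M)"
      by (simp add: algebra_simps)
    also have "cmod \<dots> \<le> C * t\<^sup>2 + D * t\<^sup>2"
      by (intro norm_triangle_le add_mono C D Mt)
    finally show "cmod (g t M + h t M - (g0 M + h0 M) - of_real t * (g1 M + h1 M)) \<le> (C + D) * t\<^sup>2"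
      by (simp add: algebra_simps)
  qed (auto intro!: norm_triangle_le add_mono C D)
qed

lemma expands_mult:
  assumes "expands A g g0 g1" "expands A h h0 h1"
  shows "expands A (\<lambda>t M. g t M * h t M) (\<lambda>M. g0 M * h0 M) (\<lambda>M. g0 M * h1 M + g1 M * h0 M)"
proof -
  from assms(1) obtain C where C: "C \<ge> 0" "\<And>M t. M \<in> A \<Longrightarrow> 0 \<le> t \<Longrightarrow> t \<le> 1 \<Longrightarrow> cmod (g t M - g0 M - of_real t * g1 M) \<le> C * t\<^sup>2"
    "\<And>M. M \<in> A \<Longrightarrow> cmod (g0 M) \<le> C" "\<And>M. M \<in> A \<Longrightarrow> cmod (g1 M) \<le> C" by (rule expandsE) blast
  from assms(2) obtain D where D: "D \<ge> 0" "\<And>M t. M \<in> A \<Longrightarrow> 0 \<le> t \<Longrightarrow> t \<le> 1 \<Longrightarrow> cmod (h t M - h0 M - of_real t * h1 M) \<le> D * t\<^sup>2"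
    "\<And>M. M \<in> A \<Longrightarrow> cmod (h0 M) \<le> D" "\<And>M. M \<in> A \<Longrightarrow> cmod (h1 M) \<le> D" by (rule expandsE) blast
  show ?thesis
  proof (rule expandsI[of _ _ _ _ "C * D + C * (D + D + D) + (C + C) * D" "C * D" "C * D + C * D"])
    fix M t assume Mt: "M \<in> A" "0 \<le> t" "t \<le> (1::real)"
    have t2: "t\<^sup>2 \<le> 1" "0 \<le> t\<^sup>2" using Mt by (auto simp: power_le_one)
    let ?r = "g t M - g0 M - of_real t * g1 M" and ?s = "h t M - h0 M - of_real t * h1 M"
    have tn: "cmod (of_real t * u) \<le> B" if "cmod u \<le> B" for u B
      using that Mt mult_mono[of "\<bar>t\<bar>" 1 "cmod u" B] by (simp add: norm_mult)
    have h: "cmod (h t M) \<le> D + D + D"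
    proof -
      have "cmod ?s \<le> D"
        using D(2)[OF Mt] t2 D(1) mult_left_mono[of "t\<^sup>2" 1 D] by linarith
      then have "cmod (?s + h0 M + of_real t * h1 M) \<le> D + D + D"
        by (intro norm_triangle_le add_mono tn D Mt)
      then show ?thesis by simp
    qed
    have g01: "cmod (g0 M + of_real t * g1 M) \<le> C + C"
      by (intro norm_triangle_le add_mono tn C Mt)
    \<comment> \<open>With g = g0 + t g1 + r and h = h0 + t h1 + s, write g h = r h + (g0 + t g1)
      (h0 + t h1 + s). The terms of order 0 and 1 cancel and each remaining term carries t^2 or a
      remainder.\<close>
    have "g t M * h t M - g0 M * h0 M - of_real t * (g0 M * h1 M + g1 M * h0 M)
        = of_real (t\<^sup>2) * (g1 M * h1 M) + ?r * h t M + (g0 M + of_real t * g1 M) * ?s"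
      by (simp add: algebra_simps power2_eq_square)
    also have "cmod \<dots> \<le> t\<^sup>2 * (C * D) + (C * t\<^sup>2) * (D + D + D) + (C + C) * (D * t\<^sup>2)"
    proof (intro norm_triangle_le add_mono)
      show "cmod (of_real (t\<^sup>2) * (g1 M * h1 M)) \<le> t\<^sup>2 * (C * D)"
      proof -
        have "cmod (g1 M * h1 M) \<le> C * D"
          unfolding norm_mult by (intro mult_mono C D Mt) (use C D in auto)
        then show ?thesis
          unfolding norm_mult[of "of_real (t\<^sup>2)"] norm_of_real by (simp add: mult_left_mono)
      qed
      show "cmod (?r * h t M) \<le> (C * t\<^sup>2) * (D + D + D)"
        unfolding norm_mult by (intro mult_mono C h Mt) (use C D in auto)
      show "cmod ((g0 M + of_real t * g1 M) * ?s) \<le> (C + C) * (D * t\<^sup>2)"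
        unfolding norm_mult by (intro mult_mono D g01 Mt) (use C D in auto)
    qed
    finally show "cmod (g t M * h t M - g0 M * h0 M - of_real t * (g0 M * h1 M + g1 M * h0 M))
      \<le> (C * D + C * (D + D + D) + (C + C) * D) * t\<^sup>2"
      by (simp add: algebra_simps)
  next
    fix M assume M: "M \<in> A"
    show "cmod (g0 M * h0 M) \<le> C * D"
      unfolding norm_mult by (intro mult_mono C D M) (use C D in auto)
    show "cmod (g0 M * h1 M + g1 M * h0 M) \<le> C * D + C * D"
      by (intro norm_triangle_le add_mono) (auto simp: norm_mult intro!: mult_mono C D M)
  qed
qed

lemma expands_sum:
  assumes "\<And>i. i \<in> I \<Longrightarrow> expands A (g i) (g0 i) (g1 i)"
  shows "expands A (\<lambda>t M. \<Sum>i\<in>I. g i t M) (\<lambda>M. \<Sum>i\<in>I. g0 i M) (\<lambda>M. \<Sum>i\<in>I. g1 i M)"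
  using assms
  by (induction I rule: infinite_finite_induct) (auto intro!: expands_add expands_const[of _ _ 0])

lemma expands_cong:
  assumes "expands A g g0 g1" "\<And>M t. M \<in> A \<Longrightarrow> g t M = h t M" "\<And>M. M \<in> A \<Longrightarrow> g0 M = h0 M" "\<And>M. M \<in> A \<Longrightarrow> g1 M = h1 M"
  shows "expands A h h0 h1"
  using assms unfolding expands_def by simp

definition expandsM ::
  "'a set \<Rightarrow> (real \<Rightarrow> 'a \<Rightarrow> complex^'n^'n) \<Rightarrow> ('a \<Rightarrow> complex^'n^'n) \<Rightarrow> ('a \<Rightarrow> complex^'n^'n) \<Rightarrow> bool" where
  "expandsM A g g0 g1 \<longleftrightarrow> (\<forall>i j. expands A (\<lambda>t M. g t M $ i $ j) (\<lambda>M. g0 M $ i $ j) (\<lambda>M. g1 M $ i $ j))"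

lemma expandsM_mult:
  assumes "expandsM A g g0 g1" "expandsM A h h0 h1"
  shows "expandsM A (\<lambda>t M. g t M ** h t M) (\<lambda>M. g0 M ** h0 M) (\<lambda>M. g0 M ** h1 M + g1 M ** h0 M)"
  unfolding expandsM_def
proof (intro allI)
  fix i j
  have "expands A (\<lambda>t M. \<Sum>k\<in>UNIV. g t M $ i $ k * h t M $ k $ j) (\<lambda>M. \<Sum>k\<in>UNIV. g0 M $ i $ k * h0 M $ k $ j)
     (\<lambda>M. \<Sum>k\<in>UNIV. g0 M $ i $ k * h1 M $ k $ j + g1 M $ i $ k * h0 M $ k $ j)"
    by (intro expands_sum expands_mult) (use assms in \<open>auto simp: expandsM_def\<close>)
  then show "expands A (\<lambda>t M. (g t M ** h t M) $ i $ j) (\<lambda>M. (g0 M ** h0 M) $ i $ j)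
      (\<lambda>M. (g0 M ** h1 M + g1 M ** h0 M) $ i $ j)"
    by (simp add: matrix_matrix_mult_def sum.distrib)
qed

lemma mat_pow_commute: "mat_pow M k ** M = M ** mat_pow (M :: 'a::semiring_1^'n^'n) k"
  by (induction k) (simp_all add: mat_pow_0 mat_pow_Suc flip: matrix_mul_assoc)

lemma matrix_sum_ldistrib: "A ** (\<Sum>i\<in>I. f i) = (\<Sum>i\<in>I. A ** (f i :: 'a::semiring_1^'n^'n))"
  by (induction I rule: infinite_finite_induct) (simp_all add: matrix_add_ldistrib)

lemma expandsM_mat_pow:
  assumes "expandsM A g g0 g1"
  shows "expandsM A (\<lambda>t M. mat_pow (g t M) k) (\<lambda>M. mat_pow (g0 M) k)
     (\<lambda>M. \<Sum>c<k. mat_pow (g0 M) c ** g1 M ** mat_pow (g0 M) (k - 1 - c))"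
proof (induction k)
  case 0
  show ?case unfolding expandsM_def mat_pow_0
    by (auto intro!: expands_const[of _ _ 1] simp: mat_def)
next
  case (Suc k)
  have "g0 M ** (\<Sum>c<k. mat_pow (g0 M) c ** g1 M ** mat_pow (g0 M) (k - 1 - c)) + g1 M ** mat_pow (g0 M) k
      = (\<Sum>c<Suc k. mat_pow (g0 M) c ** g1 M ** mat_pow (g0 M) (Suc k - 1 - c))" for M
    by (simp add: sum.lessThan_Suc_shift matrix_sum_ldistrib mat_pow_Suc mat_pow_0 matrix_mul_assoc add.commute
        del: sum.lessThan_Suc)
  then show ?case using expandsM_mult[OF assms Suc] by (simp add: mat_pow_Suc)
qed

subsection \<open>Integer powers of unitary matrices\<close>

text \<open>The adjoint replaces the inverse, with which it agrees on the unitary group; this keeps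
  all integer powers continuous on the whole matrix space.\<close>

definition mpow :: "complex^'n^'n \<Rightarrow> int \<Rightarrow> complex^'n^'n" where
  "mpow M a = (if a \<ge> 0 then mat_pow M (nat a) else mat_pow (adj M) (nat (- a)))"

lemma adj_adj [simp]: "adj (adj M) = M"
  by (simp add: vec_eq_iff adj_nth)

lemma adj_mult: "adj (A ** B) = adj B ** adj A"
  by (simp add: vec_eq_iff adj_nth matrix_matrix_mult_def mult.commute)

lemma adj_1 [simp]: "adj (idm) = idm"
  by (auto simp: vec_eq_iff adj_nth mat_def)

lemma adj_mat_pow: "adj (mat_pow M k) = mat_pow (adj M) k"
  by (induction k) (simp_all add: mat_pow_0 mat_pow_Suc adj_mult mat_pow_commute)

lemma mpow_0 [simp]: "mpow M 0 = idm"
  by (simp add: mpow_def mat_pow_0)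

lemma mpow_succ:
  assumes "M \<in> unitary_group"
  shows "M ** mpow M a = mpow M (a + 1)"
proof (cases "a \<ge> 0")
  case True
  then have "nat (a + 1) = Suc (nat a)" by simp
  then show ?thesis using True by (simp add: mpow_def mat_pow_Suc)
next
  case False
  then have "nat (- a) = Suc (nat (- (a + 1)))" by simp
  then have "mpow M a = adj M ** mat_pow (adj M) (nat (- (a + 1)))"
    using False by (simp add: mpow_def mat_pow_Suc)
  then have "M ** mpow M a = mat_pow (adj M) (nat (- (a + 1)))"
    using assms by (simp add: matrix_mul_assoc unitary_iff)
  also have "\<dots> = mpow M (a + 1)"
    using False by (cases "a = -1") (auto simp: mpow_def mat_pow_0)
  finally show ?thesis .
qed

lemma mpow_pred:
  assumes "M \<in> unitary_group"
  shows "adj M ** mpow M a = mpow M (a - 1)"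
proof -
  have "adj M ** (M ** mpow M (a - 1)) = mpow M (a - 1)"
    using unitary_left[OF assms] by (simp add: matrix_mul_assoc)
  then show ?thesis using mpow_succ[OF assms, of "a - 1"] by simp
qed

lemma mpow_mult:
  assumes "M \<in> unitary_group"
  shows "mpow M a ** mpow M b = mpow M (a + b)"
proof (induction a rule: int_induct[where k = 0])
  case (step1 a)
  have "mpow M (a + 1) ** mpow M b = M ** (mpow M a ** mpow M b)"
    by (simp only: mpow_succ[OF assms, symmetric] matrix_mul_assoc)
  also have "\<dots> = mpow M (a + b + 1)"
    unfolding step1 by (rule mpow_succ[OF assms])
  finally show ?case by (simp add: ac_simps)
next
  case (step2 a)
  have "mpow M (a - 1) ** mpow M b = adj M ** (mpow M a ** mpow M b)"
    by (simp only: mpow_pred[OF assms, symmetric] matrix_mul_assoc)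
  also have "\<dots> = mpow M (a + b - 1)"
    unfolding step2 by (rule mpow_pred[OF assms])
  finally show ?case by (simp add: algebra_simps)
qed simp

text \<open>The derivative of M^a along e^(tY) M: by the product rule Y is inserted before each
  factor M. For a < 0 the derivative of M^-1 is - M^-1 Y, so Y is inserted after each factor and the
  powers on its left start at -1.\<close>

definition dpow :: "complex^'n^'n \<Rightarrow> int \<Rightarrow> complex^'n^'n \<Rightarrow> complex^'n^'n" where
  "dpow Y a M = (if a \<ge> 0 then \<Sum>c<nat a. mpow M (int c) ** Y ** mpow M (a - int c)
     else - (\<Sum>c<nat (- a). mpow M (- 1 - int c) ** Y ** mpow M (a + 1 + int c)))"

definition scal :: "complex \<Rightarrow> complex^'n^'n \<Rightarrow> complex^'n^'n" where
  "scal c A = (\<chi> i j. c * A $ i $ j)"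

lemma scal_nth [simp]: "scal c A $ i $ j = c * A $ i $ j"
  by (simp add: scal_def)

lemma scal_mult_left: "scal c A ** B = scal c (A ** B)"
  and scal_mult_right: "A ** scal c B = scal c (A ** B)"
  and scal_add: "scal c (A + B) = scal c A + scal c B"
  and scal_add_left: "scal (c + d) A = scal c A + scal d A"
  and scal_scal: "scal c (scal d A) = scal (c * d) A"
  and scal_minus: "scal c (- A) = - scal c A"
  and scal_minus_left: "scal (- c) A = - scal c A"
  and scal_1 [simp]: "scal 1 A = A"
  and scal_0 [simp]: "scal 0 A = 0"
  by (simp_all add: vec_eq_iff matrix_matrix_mult_def sum_distrib_left mult_ac algebra_simps)

lemma scal_sum: "scal c (\<Sum>i\<in>I. f i) = (\<Sum>i\<in>I. scal c (f i))"
  by (simp add: vec_eq_iff sum_distrib_left)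

lemma trace_scal: "trace (scal c A) = c * trace A"
  by (simp add: trace_def sum_distrib_left)

lemma trace_sum: "trace (\<Sum>i\<in>I. f i) = (\<Sum>i\<in>I. trace (f i :: 'a::comm_ring_1^'n^'n))"
  by (simp add: trace_def) (rule sum.swap)

lemma trace_dpow:
  assumes M: "M \<in> unitary_group"
  shows "trace (dpow Y a M) = of_int a * trace (Y ** mpow M a)"
proof -
  have 1: "trace (mpow M b ** Y ** mpow M d) = trace (Y ** mpow M (b + d))" for b d
  proof -
    have "trace (mpow M b ** (Y ** mpow M d)) = trace (Y ** mpow M d ** mpow M b)"
      by (rule trace_mul_sym)
    then show ?thesis using mpow_mult[OF M] by (simp add: matrix_mul_assoc[symmetric] add.commute)
  qed
  have 2: "trace (- A) = - trace A" for A :: "complex^'a^'a"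
    by (simp add: trace_def sum_negf)
  show ?thesis by (auto simp: dpow_def trace_sum 1 2)
qed

subsection \<open>Unitary perturbations of the identity\<close>

definition hproj :: "complex^'n^'n \<Rightarrow> bool" where
  "hproj Y \<longleftrightarrow> adj Y = Y \<and> Y ** Y = Y"

text \<open>This is e^(itY): all positive powers of a projection Y equal Y, so the exponential
  series collapses.\<close>

definition rot :: "complex^'n^'n \<Rightarrow> real \<Rightarrow> complex^'n^'n" where
  "rot Y t = idm + scal (iexp t - 1) Y"

lemma adj_rot: "hproj Y \<Longrightarrow> adj (rot Y t) = idm + scal (iexp (- t) - 1) Y"
  by (auto simp: vec_eq_iff adj_nth rot_def mat_def hproj_def exp_cnj)

lemma rot_unitary:
  assumes Y: "hproj Y"
  shows "rot Y t \<in> unitary_group"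
proof -
  let ?z = "iexp t - 1" and ?w = "iexp (- t) - 1"
  have "iexp t * iexp (- t) = 1" by (simp flip: exp_add)
  then have 0: "?z + ?w + ?z * ?w = 0" by (simp add: algebra_simps)
  have "(idm + scal z Y) ** (idm + scal w Y)
      = idm + scal (z + w + z * w) Y" for z w
    using Y unfolding hproj_def
    by (simp add: matrix_add_ldistrib matrix_add_rdistrib scal_mult_left scal_mult_right scal_scal scal_add scal_add_left
        mult.commute add_ac)
  then have "rot Y t ** adj (rot Y t) = idm + scal (?z + ?w + ?z * ?w) Y"
    unfolding adj_rot[OF Y] unfolding rot_def .
  then show ?thesis unfolding unitary_iff 0 by simp
qed

lemma unitary_mult: "A \<in> unitary_group \<Longrightarrow> B \<in> unitary_group \<Longrightarrow> A ** B \<in> unitary_group"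
  unfolding unitary_iff adj_mult by (metis matrix_mul_assoc matrix_mul_rid)

lemma unitary_entry_bound:
  assumes "M \<in> unitary_group"
  shows "cmod (M $ i $ j) \<le> 1"
proof -
  have "(\<Sum>k\<in>UNIV. M $ i $ k * cnj (M $ i $ k)) = 1"
    using assms by (simp add: unitary_iff vec_eq_iff matrix_matrix_mult_def adj_nth mat_def)
  moreover have "(\<Sum>k\<in>UNIV. M $ i $ k * cnj (M $ i $ k)) = of_real (\<Sum>k\<in>UNIV. (cmod (M $ i $ k))\<^sup>2)"
    by (simp only: complex_norm_square[symmetric] of_real_sum)
  ultimately have "(\<Sum>k\<in>UNIV. (cmod (M $ i $ k))\<^sup>2) = 1"
    by (metis of_real_eq_1_iff)
  moreover have "(cmod (M $ i $ j))\<^sup>2 \<le> (\<Sum>k\<in>UNIV. (cmod (M $ i $ k))\<^sup>2)"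
    by (rule member_le_sum) auto
  ultimately show ?thesis by (simp add: power2_le_iff_abs_le[of 1, simplified])
qed

lemma iexp_expansion: "cmod (iexp t - 1 - \<i> * of_real t) \<le> t\<^sup>2"
proof -
  have "cmod (iexp t - (\<Sum>k\<le>1. (\<i> * of_real t) ^ k / fact k)) \<le> \<bar>t\<bar> ^ Suc 1 / fact (Suc 1)"
    by (rule iexp_approx1)
  then have "cmod (iexp t - 1 - \<i> * of_real t) \<le> t\<^sup>2 / 2"
    by (simp add: diff_diff_eq power2_eq_square)
  then show ?thesis using zero_le_power2[of t] by linarith
qed

lemma expands_affine:
  assumes z: "\<And>t. 0 \<le> t \<Longrightarrow> t \<le> 1 \<Longrightarrow> cmod (z t - of_real t * w) \<le> t\<^sup>2"
    and b: "\<And>M. M \<in> A \<Longrightarrow> cmod (f M) \<le> B" "\<And>M. M \<in> A \<Longrightarrow> cmod (g M) \<le> C" and C: "C \<ge> 0"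
  shows "expands A (\<lambda>t M. f M + z t * g M) f (\<lambda>M. w * g M)"
proof (rule expandsI[of _ _ _ _ C B "cmod w * C"])
  fix M t assume Mt: "M \<in> A" "0 \<le> t" "t \<le> (1::real)"
  have "f M + z t * g M - f M - of_real t * (w * g M) = (z t - of_real t * w) * g M"
    by (simp add: algebra_simps)
  also have "cmod \<dots> \<le> t\<^sup>2 * C"
    unfolding norm_mult by (intro mult_mono z b Mt) (use C in auto)
  finally show "cmod (f M + z t * g M - f M - of_real t * (w * g M)) \<le> C * t\<^sup>2"
    by (simp add: mult.commute)
qed (auto simp: norm_mult b intro!: mult_left_mono)

lemma norm_mult_entry_bound:
  fixes A B :: "complex^'n^'n"
  assumes "\<And>i j. cmod (A $ i $ j) \<le> a" "\<And>i j. cmod (B $ i $ j) \<le> b" "a \<ge> 0"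
  shows "cmod ((A ** B) $ i $ j) \<le> of_nat CARD('n) * (a * b)"
proof -
  have "cmod ((A ** B) $ i $ j) \<le> (\<Sum>k\<in>UNIV. cmod (A $ i $ k * B $ k $ j))"
    by (simp add: matrix_matrix_mult_def norm_sum)
  also have "\<dots> \<le> (\<Sum>k\<in>(UNIV :: 'n set). a * b)"
    by (intro sum_mono) (auto simp: norm_mult intro!: mult_mono assms)
  finally show ?thesis by simp
qed

lemma matrix_entries_bounded:
  fixes Y :: "complex^'n^'n"
  obtains b where "b \<ge> 0" "\<And>i j. cmod (Y $ i $ j) \<le> b"
proof (rule that[of "norm Y"])
  fix i j
  show "cmod (Y $ i $ j) \<le> norm Y"
    using Finite_Cartesian_Product.norm_nth_le[of Y i] Finite_Cartesian_Product.norm_nth_le[of "Y $ i" j] by linarith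
qed simp

lemma expandsM_rot:
  fixes Y :: "complex^'n^'n"
  assumes Y: "hproj Y"
  shows "expandsM unitary_group (\<lambda>t M. rot Y t ** M) (\<lambda>M. M) (\<lambda>M. scal \<i> (Y ** M))"
    and "expandsM unitary_group (\<lambda>t M. adj (rot Y t ** M)) adj (\<lambda>M. scal (- \<i>) (adj M ** Y))"
proof -
  obtain b where b: "b \<ge> 0" "\<And>i j. cmod (Y $ i $ j) \<le> b" using matrix_entries_bounded by blast
  have z: "cmod ((iexp t - 1) - of_real t * \<i>) \<le> t\<^sup>2" "cmod ((iexp (- t) - 1) - of_real t * (- \<i>)) \<le> t\<^sup>2" for t
    using iexp_expansion[of t] iexp_expansion[of "- t"] by (simp_all add: mult.commute)
  show "expandsM unitary_group (\<lambda>t M. rot Y t ** M) (\<lambda>M. M) (\<lambda>M. scal \<i> (Y ** M))"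
    unfolding expandsM_def rot_def matrix_add_rdistrib scal_mult_left scal_nth matrix_mul_lid vector_add_component
    by (intro allI expands_affine[where B = 1 and C = "of_nat CARD('n) * (b * 1)"] z unitary_entry_bound
        norm_mult_entry_bound[OF b(2) unitary_entry_bound b(1)]) (use b(1) in auto)
  have "adj (rot Y t ** M) = adj M + scal (iexp (- t) - 1) (adj M ** Y)" for t and M :: "complex^'n^'n"
    unfolding adj_mult adj_rot[OF Y] by (simp add: matrix_add_ldistrib scal_mult_right)
  moreover have "cmod (adj M $ i $ j) \<le> 1" if "M \<in> unitary_group" for i j and M :: "complex^'n^'n"
    using unitary_entry_bound[OF that] by (simp add: adj_nth)
  ultimately show "expandsM unitary_group (\<lambda>t M. adj (rot Y t ** M)) adj (\<lambda>M. scal (- \<i>) (adj M ** Y))"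
    unfolding expandsM_def scal_nth
    by (simp only: vector_add_component scal_nth)
      (intro allI expands_affine[where B = 1 and C = "of_nat CARD('n) * (1 * b)"] z
        norm_mult_entry_bound[OF _ b(2)], use b(1) in auto)
qed

lemma expandsM_cong:
  assumes "expandsM A g g0 g1" "\<And>M t. M \<in> A \<Longrightarrow> g t M = h t M" "\<And>M. M \<in> A \<Longrightarrow> g0 M = h0 M" "\<And>M. M \<in> A \<Longrightarrow> g1 M = h1 M"
  shows "expandsM A h h0 h1"
  using assms unfolding expandsM_def expands_def by simp

lemma expandsM_mpow:
  fixes Y :: "complex^'n^'n"
  assumes Y: "hproj Y"
  shows "expandsM unitary_group (\<lambda>t M. mpow (rot Y t ** M) a) (\<lambda>M. mpow M a) (\<lambda>M. scal \<i> (dpow Y a M))"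
proof (cases "a \<ge> 0")
  case True
  show ?thesis
  proof (rule expandsM_cong[OF expandsM_mat_pow[OF expandsM_rot(1)[OF Y], of "nat a"]])
    fix M :: "complex^'n^'n" assume M: "M \<in> unitary_group"
    have "mat_pow M c ** scal \<i> (Y ** M) ** mat_pow M (nat a - 1 - c)
        = scal \<i> (mpow M (int c) ** Y ** mpow M (a - int c))" if "c < nat a" for c
    proof -
      have "M ** mat_pow M (nat a - 1 - c) = mpow M (a - int c)"
      proof -
        have "nat (a - int c - 1) = nat a - 1 - c" "a - int c - 1 \<ge> 0" using that by auto
        then have "mat_pow M (nat a - 1 - c) = mpow M (a - int c - 1)" by (simp add: mpow_def)
        then show ?thesis using mpow_succ[OF M, of "a - int c - 1"] by simp
      qed
      moreover have "mat_pow M c = mpow M (int c)" by (simp add: mpow_def)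
      ultimately show ?thesis
        by (simp add: scal_mult_right scal_mult_left flip: matrix_mul_assoc)
    qed
    then show "(\<Sum>c<nat a. mat_pow M c ** scal \<i> (Y ** M) ** mat_pow M (nat a - 1 - c)) = scal \<i> (dpow Y a M)"
      using True by (simp add: dpow_def scal_sum)
  qed (use True in \<open>simp_all add: mpow_def\<close>)
next
  case False
  show ?thesis
  proof (rule expandsM_cong[OF expandsM_mat_pow[OF expandsM_rot(2)[OF Y], of "nat (- a)"]])
    fix M :: "complex^'n^'n" assume M: "M \<in> unitary_group"
    have "mat_pow (adj M) c ** scal (- \<i>) (adj M ** Y) ** mat_pow (adj M) (nat (- a) - 1 - c)
        = - scal \<i> (mpow M (- 1 - int c) ** Y ** mpow M (a + 1 + int c))" if "c < nat (- a)" for c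
    proof -
      have "mat_pow (adj M) k = mpow M (- int k)" for k
        by (cases "k = 0") (auto simp: mpow_def mat_pow_0)
      moreover from this have "mat_pow (adj M) c ** adj M = mpow M (- 1 - int c)"
      proof -
        have "mat_pow (adj M) c ** adj M = adj M ** mpow M (- int c)"
          unfolding \<open>\<And>k. mat_pow (adj M) k = mpow M (- int k)\<close>[symmetric] by (rule mat_pow_commute)
        moreover have "- int c - 1 = - 1 - int c" by simp
        ultimately show ?thesis using mpow_pred[OF M, of "- int c"] by (simp only:)
      qed
      moreover have "- int (nat (- a) - 1 - c) = a + 1 + int c" using that by (simp add: of_nat_diff)
      moreover have "mat_pow (adj M) c ** scal (- \<i>) (adj M ** Y) ** R
          = - scal \<i> (mat_pow (adj M) c ** adj M ** Y ** R)" for R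
        by (simp only: scal_mult_right scal_mult_left matrix_mul_assoc scal_minus_left[symmetric])
      ultimately show ?thesis by (simp add: add_ac)
    qed
    then show "(\<Sum>c<nat (- a). mat_pow (adj M) c ** scal (- \<i>) (adj M ** Y) ** mat_pow (adj M) (nat (- a) - 1 - c))
      = scal \<i> (dpow Y a M)"
      using False by (simp add: dpow_def scal_sum scal_minus sum_negf)
  qed (use False in \<open>simp_all add: mpow_def\<close>)
qed

subsection \<open>Symmetric Laurent polynomials\<close>

text \<open>Generation by power sums, instead of invariance under permutations, makes every member
  visibly a polynomial in traces of powers of M. The inductions over class functions follow these
  four rules.\<close>

inductive_set csym :: "nat \<Rightarrow> laurent set" for n where
  csym_cst: "cst c \<in> csym n"
| csym_psum: "psum n a \<in> csym n"
| csym_add: "f \<in> csym n \<Longrightarrow> g \<in> csym n \<Longrightarrow> f + g \<in> csym n"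
| csym_mult: "f \<in> csym n \<Longrightarrow> g \<in> csym n \<Longrightarrow> f * g \<in> csym n"

lemma csym_1: "1 \<in> csym n" using csym_cst[of 1] by simp
lemma csym_0: "0 \<in> csym n" using csym_cst[of 0] by simp

lemma csym_minus: "f \<in> csym n \<Longrightarrow> - f \<in> csym n"
  using csym_mult[OF csym_cst[of "-1"], of f] by (simp add: cst_minus)

lemma csym_sum: "(\<And>i. i \<in> A \<Longrightarrow> f i \<in> csym n) \<Longrightarrow> (\<Sum>i\<in>A. f i) \<in> csym n"
  by (induction A rule: infinite_finite_induct) (auto intro: csym_0 csym_add)

lemma csym_prod: "(\<And>i. i \<in> A \<Longrightarrow> f i \<in> csym n) \<Longrightarrow> (\<Prod>i\<in>A. f i) \<in> csym n"
  by (induction A rule: infinite_finite_induct) (auto intro: csym_1 csym_mult)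

lemma csym_power: "f \<in> csym n \<Longrightarrow> f ^ k \<in> csym n"
  by (induction k) (auto intro: csym_1 csym_mult)

lemma csym_sum_list: "(\<And>i. i \<in> set A \<Longrightarrow> f i \<in> csym n) \<Longrightarrow> (\<Sum>i\<leftarrow>A. f i) \<in> csym n"
  by (induction A) (auto intro: csym_0 csym_add)

lemma csym_loop_term: "loop_term n a \<in> csym n"
  by (auto simp: loop_term_def intro!: csym_minus csym_sum csym_mult csym_psum)

lemma csym_Theta: "f \<in> csym n \<Longrightarrow> Theta n a f \<in> csym n"
  by (induction rule: csym.induct)
    (auto simp: Theta_cst Theta_psum Theta_add Theta_mult intro: csym.intros csym_0)

text \<open>The chain rule: the derivative of a power sum is a multiple of x_i^a, and what
  multiplies it is symmetric and the same for all i. The pairs (a, u) are those to which the loop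
  equations are applied.\<close>

lemma csym_gradient:
  assumes "f \<in> csym n"
  shows "\<exists>K. (\<forall>(a, u)\<in>set K. u \<in> csym n) \<and> (\<forall>i<n. E i f = (\<Sum>(a, u)\<leftarrow>K. X i a * u))"
  using assms
proof induction
  case (csym_cst c)
  show ?case by (rule exI[of _ "[]"]) simp
next
  case (csym_psum a)
  show ?case
    by (rule exI[of _ "[(a, cst (of_int a))]"]) (auto simp: E_psum mult.commute csym.csym_cst)
next
  case (csym_add f g)
  then obtain K L where "\<forall>(a, u)\<in>set K. u \<in> csym n" "\<forall>i<n. E i f = (\<Sum>(a, u)\<leftarrow>K. X i a * u)"
    "\<forall>(a, u)\<in>set L. u \<in> csym n" "\<forall>i<n. E i g = (\<Sum>(a, u)\<leftarrow>L. X i a * u)" by blast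
  then show ?case by (intro exI[of _ "K @ L"]) (auto simp: E_add)
next
  case (csym_mult f g)
  then obtain K L where KL: "\<forall>(a, u)\<in>set K. u \<in> csym n" "\<forall>i<n. E i f = (\<Sum>(a, u)\<leftarrow>K. X i a * u)"
    "\<forall>(a, u)\<in>set L. u \<in> csym n" "\<forall>i<n. E i g = (\<Sum>(a, u)\<leftarrow>L. X i a * u)" by blast
  let ?K = "map (\<lambda>(a, u). (a, u * g)) K @ map (\<lambda>(a, u). (a, f * u)) L"
  have "(\<Sum>(a, u)\<leftarrow>map (\<lambda>(a, u). (a, u * g)) K. X i a * u) = (\<Sum>(a, u)\<leftarrow>K. X i a * u) * g" for i
    by (induction K) (auto simp: algebra_simps)
  moreover have "(\<Sum>(a, u)\<leftarrow>map (\<lambda>(a, u). (a, f * u)) L. X i a * u) = f * (\<Sum>(a, u)\<leftarrow>L. X i a * u)" for i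
    by (induction L) (auto simp: algebra_simps)
  ultimately have "\<forall>i<n. E i (f * g) = (\<Sum>(a, u)\<leftarrow>?K. X i a * u)"
    using KL by (simp add: E_mult)
  moreover have "\<forall>(a, u)\<in>set ?K. u \<in> csym n"
    using KL csym_mult.hyps by (auto intro: csym.csym_mult)
  ultimately show ?case by blast
qed

section \<open>The conjugated Laplacian and its action on alternants\<close>

definition qop :: "nat \<Rightarrow> laurent \<Rightarrow> laurent" where
  "qop n f = dop (\<lambda>m. of_int (qform n (lookup m) - qform n (dlt n))) f"

lemma lookup_mult_cst [simp]: "lookup (f * cst c) m = c * lookup f m"
  by (simp add: mult.commute[of f])

lemma qop_eq_E:
  "qop n f = (\<Sum>i<n. E i (E i f) - cst (of_nat n - 1) * E i f) - cst (of_int (qform n (dlt n))) * f"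
proof -
  define d where "d = qform n (dlt n)"
  show ?thesis
    unfolding qop_def d_def[symmetric]
    by (rule poly_mapping_eqI)
      (simp add: E_def lookup_dop lookup_minus lookup_sum qform_def algebra_simps sum_distrib_left)
qed

text \<open>In the product rule, the terms in which only the Vandermonde factor is differentiated
  combine with the shift by q(\<delta>) to 0, since \<open>qop\<close> annihilates that
  factor.\<close>

lemma qop_alt_dlt_mult:
  "qop n (alt n (dlt n) * f) = (\<Sum>i<n. 2 * (E i (alt n (dlt n)) * E i f)
      + alt n (dlt n) * (E i (E i f) - cst (of_nat n - 1) * E i f))"
proof -
  let ?V = "alt n (dlt n)"
  have "qop n ?V = 0"
    unfolding qop_def using dop_qform_alt[of "\<lambda>q. of_int (q - qform n (dlt n))" n "dlt n"] by simp
  then have V: "(\<Sum>i<n. E i (E i ?V) - cst (of_nat n - 1) * E i ?V) = cst (of_int (qform n (dlt n))) * ?V"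
    by (simp add: qop_eq_E)
  have "(\<Sum>i<n. E i (E i (?V * f)) - cst (of_nat n - 1) * E i (?V * f))
      = (\<Sum>i<n. (2 * (E i ?V * E i f) + ?V * (E i (E i f) - cst (of_nat n - 1) * E i f))
         + (E i (E i ?V) - cst (of_nat n - 1) * E i ?V) * f)"
    by (rule sum.cong) (simp_all add: E_mult E_add algebra_simps)
  also have "\<dots> = (\<Sum>i<n. 2 * (E i ?V * E i f) + ?V * (E i (E i f) - cst (of_nat n - 1) * E i f))
      + cst (of_int (qform n (dlt n))) * ?V * f"
    by (simp add: sum.distrib V flip: sum_distrib_right)
  finally show ?thesis by (simp add: qop_eq_E mult.assoc)
qed

text \<open>The right-hand side of \<open>qop_alt_dlt_mult\<close> is linear in the gradient of f.
  Decomposing the gradient into terms x_i^a u with symmetric u turns it into a sum of left-hand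
  sides of loop equations.\<close>

lemma radial_laplacian:
  assumes "f \<in> csym n"
  shows "\<exists>K. (\<forall>(a, u)\<in>set K. u \<in> csym n) \<and>
     alt n (dlt n) * (\<Sum>(a, u)\<leftarrow>K. loop_term n a * u + Theta n a u) = qop n (alt n (dlt n) * f)"
proof -
  let ?V = "alt n (dlt n)"
  obtain K where K: "\<forall>(a, u)\<in>set K. u \<in> csym n" "\<forall>i<n. E i f = (\<Sum>(a, u)\<leftarrow>K. X i a * u)"
    using csym_gradient[OF assms] by blast
  define D where "D g = (\<Sum>i<n. 2 * (E i ?V * g i) + ?V * (E i (g i) - cst (of_nat n - 1) * g i))" for g
  have D_add: "D (\<lambda>i. g i + h i) = D g + D h" for g h
    by (simp add: D_def E_add algebra_simps sum.distrib sum_subtractf)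
  have D_0: "D (\<lambda>i. 0) = 0" using E_cst[of _ 0] by (simp add: D_def)
  have D_X: "D (\<lambda>i. X i a * u) = ?V * (loop_term n a * u + Theta n a u)" for a u
  proof -
    have "D (\<lambda>i. X i a * u) = (\<Sum>i<n. 2 * (X i a * E i ?V) * u + ?V * (X i a * E i u)
        + cst (of_int a - of_nat n + 1) * ?V * (X i a * u))"
      unfolding D_def
      by (rule sum.cong) (simp_all add: E_mult E_X cst_add cst_diff algebra_simps)
    also have "\<dots> = (2 * Theta n a ?V) * u + ?V * Theta n a u + cst (of_int a - of_nat n + 1) * ?V * (psum n a * u)"
      by (simp add: Theta_def psum_def sum.distrib sum_distrib_left sum_distrib_right mult.assoc)
    also have "\<dots> = ?V * (loop_term n a * u + Theta n a u)
        + (cst (of_nat n - 1 - of_int a) + cst (of_int a - of_nat n + 1)) * (?V * psum n a * u)"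
      unfolding Theta_alt_dlt by (simp add: algebra_simps)
    \<comment> \<open>The power sum left over in \<open>Theta_alt_dlt\<close> has the coefficient n
      - 1 - a. It cancels against a from differentiating x_i^a and n - 1 from the linear term of
      \<open>qform\<close>, which is where that linear term comes from.\<close>
    also have "cst (of_nat n - 1 - of_int a) + cst (of_int a - of_nat n + 1) = 0"
      by (simp flip: cst_add)
    finally show ?thesis by simp
  qed
  have "qop n (?V * f) = D (\<lambda>i. \<Sum>(a, u)\<leftarrow>K. X i a * u)"
    unfolding qop_alt_dlt_mult D_def by (rule sum.cong) (simp_all add: K(2))
  also have "\<dots> = ?V * (\<Sum>(a, u)\<leftarrow>K. loop_term n a * u + Theta n a u)"
    by (induction K) (auto simp: D_0 D_add D_X distrib_left)
  finally show ?thesis using K(1) by (intro exI[of _ K]) simp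
qed

inductive_set alt_span :: "nat \<Rightarrow> laurent set" for n where
  alt_span_0: "0 \<in> alt_span n"
| alt_span_add: "F \<in> alt_span n \<Longrightarrow> cst c * alt n h + F \<in> alt_span n"

lemma alt_span_plus: "F \<in> alt_span n \<Longrightarrow> G \<in> alt_span n \<Longrightarrow> F + G \<in> alt_span n"
  by (induction rule: alt_span.induct) (auto simp: add.assoc intro: alt_span.intros)

lemma alt_in_alt_span: "cst c * alt n h \<in> alt_span n"
  using alt_span_add[OF alt_span_0] by simp

lemma alt_span_cst: "F \<in> alt_span n \<Longrightarrow> cst c * F \<in> alt_span n"
  by (induction rule: alt_span.induct)
    (auto simp: distrib_left mult.assoc[symmetric] intro: alt_span.intros simp flip: cst_mult)

lemma alt_span_sum: "(\<And>i. i \<in> A \<Longrightarrow> f i \<in> alt_span n) \<Longrightarrow> (\<Sum>i\<in>A. f i) \<in> alt_span n"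
  by (induction A rule: infinite_finite_induct) (auto intro: alt_span_0 alt_span_plus)

lemma csym_mult_alt_span:
  assumes "f \<in> csym n" "F \<in> alt_span n"
  shows "f * F \<in> alt_span n"
  using assms
proof (induction arbitrary: F)
  case (csym_psum a)
  from csym_psum show ?case
  proof induction
    case (alt_span_add F c h)
    have "psum n a * (cst c * alt n h + F) = cst c * (\<Sum>j<n. alt n (h(j := h j + a))) + psum n a * F"
      by (simp add: distrib_left mult.left_commute psum_mult_alt)
    then show ?case
      using alt_span_add.IH alt_in_alt_span[of 1]
      by (auto intro!: alt_span_plus alt_span_cst alt_span_sum)
  qed (auto intro: alt_span.intros)
qed (auto simp: distrib_right mult.assoc alt_span_cst alt_span_plus)

text \<open>The projection onto the monomials with eigenvalue q(\<delta>) fixes F, and it keeps or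
  kills each alternant as a whole. Those it keeps are handled by \<open>alt_minimal\<close>.\<close>

lemma alt_span_minimal:
  assumes F: "F \<in> alt_span n" and q: "\<And>m. m \<in> keys F \<Longrightarrow> qform n (lookup m) = qform n (dlt n)"
  shows "\<exists>c. F = cst c * alt n (dlt n)"
proof -
  let ?P = "dop (\<lambda>m. if qform n (lookup m) = qform n (dlt n) then 1 else 0)"
  have "\<exists>c. ?P F = cst c * alt n (dlt n)"
    using F
  proof induction
    case alt_span_0
    show ?case by (rule exI[of _ 0]) simp
  next
    case (alt_span_add F c h)
    then obtain d where d: "?P F = cst d * alt n (dlt n)" by blast
    have h: "?P (alt n h) = cst (if qform n h = qform n (dlt n) then 1 else 0) * alt n h"
      by (rule dop_qform_alt[of "\<lambda>q. if q = qform n (dlt n) then 1 else 0"])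
    have "\<exists>e. ?P (alt n h) = cst e * alt n (dlt n)"
      unfolding h using alt_minimal[of n h] by (cases "qform n h = qform n (dlt n)") (auto intro: exI[of _ 0])
    then obtain e where "?P (alt n h) = cst e * alt n (dlt n)" by blast
    then have "?P (cst c * alt n h + F) = cst (c * e + d) * alt n (dlt n)"
      by (simp add: dop_add dop_cst d cst_add cst_mult algebra_simps)
    then show ?case by blast
  qed
  moreover have "?P F = F"
    by (rule poly_mapping_eqI) (use q in \<open>auto simp: lookup_dop in_keys_iff\<close>)
  ultimately show ?thesis by simp
qed

lemma lookup_mult_single_0: "lookup (F * single m c) 0 = lookup F (- m) * (c :: complex)"
  for F :: laurent
  by (rule additive_poly_mapping_eq[of "\<lambda>F. lookup (F * single m c) 0"])
    (auto simp: lookup_add algebra_simps mult_single lookup_single when_def eq_neg_iff_add_eq_0)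

text \<open>The second factor meets only the coefficients at permutations of the staircase, where
  \<open>qop\<close> multiplies by 0. So the constant term functional, too, vanishes on the image of
  the Laplacian.\<close>

lemma lookup_qop_mult_alt: "lookup (qop n F * alt n (\<lambda>i. - dlt n i)) 0 = 0"
  unfolding alt_leibniz sum_distrib_left lookup_sum
proof (rule sum.neutral, rule ballI)
  fix p assume "p \<in> {p. p permutes {0..<n}}"
  then have p: "p permutes {..<n}" by (simp add: atLeast0LessThan)
  have "lookup (qop n F * (of_int (sign p) * (\<Prod>i<n. X (p i) (- dlt n i)))) 0
      = of_int (sign p) * lookup (qop n F * single (\<Sum>i<n. single (p i) (- dlt n i)) 1) 0"
    unfolding of_int_cst prod_X by (subst mult.left_commute) (rule lookup_cst_mult)
  also have "\<dots> = 0"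
    unfolding lookup_mult_single_0 qop_def lookup_dop
    using qform_lookup[OF p, of "dlt n"] by (simp add: single_uminus sum_negf)
  finally show "lookup (qop n F * (of_int (sign p) * (\<Prod>i<n. X (p i) (- dlt n i)))) 0 = 0" .
qed

text \<open>
  The operator \<open>qop\<close> is the Laplacian conjugated by the Vandermonde product; on alternants it has
  eigenvalue 0 only for multiples of \<open>alt n (dlt n)\<close>. A functional that vanishes on the image of
  the Laplacian is therefore the Weyl functional.
\<close>
theorem weyl_functional:
  fixes I :: "laurent \<Rightarrow> complex"
  assumes add: "\<And>f g. f \<in> csym n \<Longrightarrow> g \<in> csym n \<Longrightarrow> I (f + g) = I f + I g"
    and scale: "\<And>c f. f \<in> csym n \<Longrightarrow> I (cst c * f) = c * I f"
    and one: "I 1 = 1"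
    and loop: "\<And>a u. u \<in> csym n \<Longrightarrow> I (loop_term n a * u + Theta n a u) = 0"
    and f: "f \<in> csym n"
  shows "fact n * I f = lookup (alt n (dlt n) * f * alt n (\<lambda>i. - dlt n i)) 0"
proof -
  let ?V = "alt n (dlt n)" and ?W = "alt n (\<lambda>i. - dlt n i)"
  let ?q = "\<lambda>m. qform n (lookup m)"
  have I0: "I 0 = 0" using scale[OF csym_1, of 0] by simp
  \<comment> \<open>Induction on the number of values other than q(\<delta>) that
    \<open>qform\<close> takes on the monomials of V f.\<close>
  have "card (?q ` keys (?V * f) - {qform n (dlt n)}) = k \<Longrightarrow> ?thesis" for k
    using f
  proof (induction k arbitrary: f rule: less_induct)
    case (less k)
    show ?case
    proof (cases "?q ` keys (?V * f) \<subseteq> {qform n (dlt n)}")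
      case True
      have "?V * f \<in> alt_span n"
        using csym_mult_alt_span[OF less.prems(2) alt_in_alt_span[of 1 n "dlt n"]] by (simp add: mult.commute)
      then obtain c where c: "?V * f = cst c * ?V"
        using alt_span_minimal[of "?V * f" n] True by blast
      then have "?V * (f - cst c) = 0" by (simp add: algebra_simps)
      then have fc: "f = cst c" using alt_dlt_nonzero by auto
      have "lookup (?V * f * ?W) 0 = c * lookup (?V * ?W) 0"
        unfolding c by (simp add: mult.assoc)
      also have "lookup (?V * ?W) 0 = fact n"
        using lookup_0_alt_mult_alt[of n "dlt n" "dlt n"] by (simp add: dlt_def)
      finally show ?thesis using scale[OF csym_1, of c] one by (simp add: fc)
    next
      case False
      then obtain m where m: "m \<in> keys (?V * f)" "?q m \<noteq> qform n (dlt n)" by blast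
      obtain K where K: "\<forall>(a, u)\<in>set K. u \<in> csym n"
        "?V * (\<Sum>(a, u)\<leftarrow>K. loop_term n a * u + Theta n a u) = qop n (?V * f)"
        using radial_laplacian[OF less.prems(2)] by blast
      define g where "g = (\<Sum>(a, u)\<leftarrow>K. loop_term n a * u + Theta n a u)"
      have Vg: "?V * g = qop n (?V * f)" unfolding g_def by (rule K(2))
      have g: "g \<in> csym n" unfolding g_def
        using K(1) by (auto intro!: csym_sum_list csym_add csym_mult csym_loop_term csym_Theta)
      have Ig: "I g = 0"
        unfolding g_def using K(1)
      proof (induction K)
        case (Cons k K)
        obtain a u where k: "k = (a, u)" by (cases k)
        have u: "u \<in> csym n" and IH: "I (\<Sum>(a, u)\<leftarrow>K. loop_term n a * u + Theta n a u) = 0"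
          using Cons by (auto simp: k)
        have "(\<Sum>(a, u)\<leftarrow>K. loop_term n a * u + Theta n a u) \<in> csym n"
          using Cons.prems by (auto intro!: csym_sum_list csym_add csym_mult csym_loop_term csym_Theta)
        moreover have "loop_term n a * u + Theta n a u \<in> csym n"
          by (intro csym_add csym_mult csym_loop_term csym_Theta u)
        ultimately have "I ((loop_term n a * u + Theta n a u) + (\<Sum>(a, u)\<leftarrow>K. loop_term n a * u + Theta n a u)) = 0"
          using add loop[OF u] IH by simp
        then show ?case by (simp add: k)
      qed (simp add: I0)
      define r :: complex where "r = of_int (?q m - qform n (dlt n))"
      have r: "r \<noteq> 0" using m(2) by (simp add: r_def)
      \<comment> \<open>Subtracting 1/r times the image of the Laplacian multiplies the coefficient
        at m' by 1 - (q(m') - q(\<delta>)) / r. This removes all monomials with the value q(m) and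
        creates none with a new value, while neither functional changes.\<close>
      define f' where "f' = f + cst (- (1 / r)) * g"
      have f': "f' \<in> csym n" unfolding f'_def by (intro csym_add csym_mult csym_cst g less.prems)
      have "I f' = I f" unfolding f'_def
        using add[OF less.prems(2) csym_mult[OF csym_cst g]] scale[OF g] Ig by simp
      have Vf': "?V * f' = ?V * f - cst (1 / r) * qop n (?V * f)"
        unfolding f'_def Vg[symmetric] by (simp add: cst_minus algebra_simps)
      have lk: "lookup (?V * f') m' = (1 - of_int (?q m' - qform n (dlt n)) / r) * lookup (?V * f) m'" for m'
        unfolding Vf' by (simp add: lookup_minus qop_def lookup_dop left_diff_distrib)
      have "lookup (?V * f' * ?W) 0 = lookup (?V * f * ?W) 0"
        unfolding Vf' left_diff_distrib mult.assoc[of "cst _"] lookup_minus lookup_cst_mult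
        using lookup_qop_mult_alt[of n "?V * f"] by simp
      have "?q ` keys (?V * f') - {qform n (dlt n)} \<subset> ?q ` keys (?V * f) - {qform n (dlt n)}"
      proof
        show "?q ` keys (?V * f') - {qform n (dlt n)} \<subseteq> ?q ` keys (?V * f) - {qform n (dlt n)}"
          by (auto simp: in_keys_iff lk)
        have "?q m \<notin> ?q ` keys (?V * f')"
        proof
          assume "?q m \<in> ?q ` keys (?V * f')"
          then obtain m' where "m' \<in> keys (?V * f')" "?q m' = ?q m" by (metis imageE)
          then show False using r by (simp add: in_keys_iff lk r_def)
        qed
        then show "?q ` keys (?V * f') - {qform n (dlt n)} \<noteq> ?q ` keys (?V * f) - {qform n (dlt n)}"
          using m by blast
      qed
      then have "card (?q ` keys (?V * f') - {qform n (dlt n)}) < k"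
        using less.prems(1) psubset_card_mono by (metis finite_Diff finite_imageI finite_keys)
      from less.IH[OF this refl f'] show ?thesis
        by (simp add: \<open>I f' = I f\<close> \<open>lookup (?V * f' * ?W) 0 = lookup (?V * f * ?W) 0\<close>)
    qed
  qed
  then show ?thesis by blast
qed

subsection \<open>Class functions on the unitary group\<close>

text \<open>The choice fixes some order of the eigenvalues and need not be measurable in M.
  Continuity and integrability are always obtained by rewriting a symmetric expression in
  traces.\<close>

definition eig :: "complex^'n^'n \<Rightarrow> nat \<Rightarrow> complex" where
  "eig M = (SOME x. (\<forall>i<CARD('n). cmod (x i) = 1) \<and>
     (\<forall>k. trace (mat_pow M k) = (\<Sum>i<CARD('n). x i ^ k)) \<and>
     Determinants.det (idm + M) = (\<Prod>i<CARD('n). 1 + x i))"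

lemma
  fixes M :: "complex^'n^'n"
  assumes M: "M \<in> unitary_group"
  shows norm_eig: "\<And>i. i < CARD('n) \<Longrightarrow> cmod (eig M i) = 1"
    and trace_mat_pow_eig: "trace (mat_pow M k) = (\<Sum>i<CARD('n). eig M i ^ k)"
    and det_eig: "Determinants.det (idm + M) = (\<Prod>i<CARD('n). 1 + eig M i)"
  using someI_ex[OF unitary_eigenvalues[OF M]] unfolding eig_def[symmetric] by blast+

lemma eig_nonzero:
  fixes M :: "complex^'n^'n"
  shows "M \<in> unitary_group \<Longrightarrow> i < CARD('n) \<Longrightarrow> eig M i \<noteq> 0"
  using norm_eig[of M i] by auto

lemma cnj_eig:
  fixes M :: "complex^'n^'n"
  assumes "M \<in> unitary_group" "i < CARD('n)"
  shows "cnj (eig M i) = inverse (eig M i)"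
  using norm_eig[OF assms] by (simp add: inverse_complex_def complex_eq_iff cmod_def)

lemma trace_adj: "trace (adj A) = cnj (trace A)"
  by (simp add: trace_def adj_nth)

lemma trace_mpow_eig:
  fixes M :: "complex^'n^'n"
  assumes M: "M \<in> unitary_group"
  shows "trace (mpow M a) = leval CARD('n) (eig M) (psum CARD('n) a)"
proof (cases "a \<ge> 0")
  case True
  then show ?thesis by (simp add: mpow_def eval_psum trace_mat_pow_eig[OF M] power_int_def)
next
  case False
  then have "trace (mpow M a) = cnj (trace (mat_pow M (nat (- a))))"
    by (simp add: mpow_def adj_mat_pow flip: trace_adj)
  also have "\<dots> = (\<Sum>i<CARD('n). eig M i powi a)"
    using False by (simp add: trace_mat_pow_eig[OF M] power_int_def cnj_eig[OF M])
  finally show ?thesis by (simp add: eval_psum)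
qed

lemma evalU_mult:
  fixes M :: "complex^'n^'n"
  shows "M \<in> unitary_group \<Longrightarrow> leval CARD('n) (eig M) (f * g) = leval CARD('n) (eig M) f * leval CARD('n) (eig M) g"
  by (rule eval_mult) (rule eig_nonzero)

text \<open>
  \<open>cls f F G\<close>: \<open>F\<close> is the class function of \<open>f\<close>, written as a polynomial in traces of powers, and
  \<open>G\<close> is its gradient, i.e.\ the derivative of \<open>F\<close> along \<open>M \<mapsto> e\<^sup>t\<^sup>Y M\<close> is \<open>tr (Y G)\<close>.
\<close>
inductive cls :: "laurent \<Rightarrow> (complex^'n^'n \<Rightarrow> complex) \<Rightarrow> (complex^'n^'n \<Rightarrow> complex^'n^'n) \<Rightarrow> bool" where
  "cls (cst c) (\<lambda>_. c) (\<lambda>_. 0)"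
| "cls (psum CARD('n) a) (\<lambda>M :: complex^'n^'n. trace (mpow M a)) (\<lambda>M. scal (of_int a) (mpow M a))"
| "cls f F G \<Longrightarrow> cls g F' G' \<Longrightarrow> cls (f + g) (\<lambda>M. F M + F' M) (\<lambda>M. G M + G' M)"
| "cls f F G \<Longrightarrow> cls g F' G' \<Longrightarrow> cls (f * g) (\<lambda>M. F M * F' M) (\<lambda>M. scal (F M) (G' M) + scal (F' M) (G M))"

lemma csym_cls: "f \<in> csym CARD('n) \<Longrightarrow> \<exists>F (G :: complex^'n^'n \<Rightarrow> complex^'n^'n). cls f F G"
  by (induction rule: csym.induct) (blast intro: cls.intros)+

lemma cls_eval:
  fixes G :: "complex^'n^'n \<Rightarrow> complex^'n^'n"
  shows "cls f F G \<Longrightarrow> M \<in> unitary_group \<Longrightarrow> F M = leval CARD('n) (eig M) f"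
  by (induction rule: cls.induct) (simp_all add: trace_mpow_eig eval_add evalU_mult)

lemma trace_mult_add: "trace (A ** (B + C)) = trace (A ** B) + trace (A ** (C :: complex^'n^'n))"
  by (simp add: matrix_add_ldistrib trace_def sum.distrib)

text \<open>Moving M in the direction M^(a+1) moves each eigenvalue x in the direction x^(a+1). The
  gradient paired with M^a is thus the vector field \<Sum> x_i^(a+1) d/dx_i applied to f.\<close>

lemma cls_Theta:
  fixes G :: "complex^'n^'n \<Rightarrow> complex^'n^'n"
  shows "cls f F G \<Longrightarrow> M \<in> unitary_group \<Longrightarrow>
    trace (mpow M a ** G M) = leval CARD('n) (eig M) (Theta CARD('n) a f)"
proof (induction rule: cls.induct)
  case (1 c)
  have "trace (mpow M a ** (0 :: complex^'n^'n)) = 0"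
    by (simp add: trace_def matrix_matrix_mult_def)
  then show ?case by (simp add: Theta_cst)
next
  case (2 b)
  then show ?case
    by (simp add: scal_mult_right trace_scal mpow_mult trace_mpow_eig Theta_psum evalU_mult)
next
  case (3 f F G g F' G')
  then show ?case by (simp add: trace_mult_add Theta_add eval_add)
next
  case (4 f F G g F' G')
  then show ?case
    by (simp add: trace_mult_add scal_mult_right trace_scal Theta_mult eval_add evalU_mult cls_eval)
qed

lemma continuous_on_matrixI:
  fixes f :: "'a::topological_space \<Rightarrow> complex^'n^'m"
  assumes "\<And>i j. continuous_on A (\<lambda>M. f M $ i $ j)"
  shows "continuous_on A f"
proof -
  have "continuous_on A (\<lambda>M. \<chi> i j. f M $ i $ j)"
    by (intro continuous_on_vec_lambda assms)
  then show ?thesis by simp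
qed

lemma continuous_matrix_mult:
  fixes f g :: "'a::topological_space \<Rightarrow> complex^'n^'n"
  assumes "continuous_on A f" "continuous_on A g"
  shows "continuous_on A (\<lambda>M. f M ** g M)"
  by (rule continuous_on_matrixI) (auto simp: matrix_matrix_mult_def intro!: continuous_intros assms)

lemma continuous_adj:
  assumes "continuous_on A f"
  shows "continuous_on A (\<lambda>M. adj (f M))"
  by (rule continuous_on_matrixI) (auto simp: adj_nth intro!: continuous_intros assms)

lemma continuous_mat_pow:
  fixes f :: "'a::topological_space \<Rightarrow> complex^'n^'n"
  assumes "continuous_on A f"
  shows "continuous_on A (\<lambda>M. mat_pow (f M) k)"
  by (induction k) (auto simp: mat_pow_0 mat_pow_Suc intro!: continuous_matrix_mult assms)

lemma continuous_mpow: "continuous_on A (\<lambda>M. mpow M a)"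
  unfolding mpow_def by (cases "a \<ge> 0") (auto intro!: continuous_mat_pow continuous_adj)

lemma continuous_scal:
  assumes "continuous_on A F" "continuous_on A f"
  shows "continuous_on A (\<lambda>M. scal (F M) (f M))"
  by (rule continuous_on_matrixI) (auto intro!: continuous_intros assms)

lemma continuous_dpow: "continuous_on A (dpow Y a)"
  unfolding dpow_def
  by (cases "a \<ge> 0") (auto intro!: continuous_intros continuous_matrix_mult continuous_mpow)

lemma continuous_trace: "continuous_on A f \<Longrightarrow> continuous_on A (\<lambda>M. trace (f M :: complex^'n^'n))"
  by (auto simp: trace_def intro!: continuous_intros)

lemma cls_continuous:
  fixes G :: "complex^'n^'n \<Rightarrow> complex^'n^'n"
  shows "cls f F G \<Longrightarrow> continuous_on UNIV F \<and> continuous_on UNIV G"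
  by (induction rule: cls.induct)
    (auto intro!: continuous_intros continuous_trace continuous_mpow continuous_scal)

lemma expands_trace: "expandsM A g g0 g1 \<Longrightarrow>
    expands A (\<lambda>t M. trace (g t M)) (\<lambda>M. trace (g0 M)) (\<lambda>M. trace (g1 M))"
  unfolding trace_def expandsM_def by (intro expands_sum) blast

lemma cls_expands:
  fixes G :: "complex^'n^'n \<Rightarrow> complex^'n^'n"
  assumes Y: "hproj Y"
  shows "cls f F G \<Longrightarrow>
    expands unitary_group (\<lambda>t M. F (rot Y t ** M)) F (\<lambda>M. \<i> * trace (Y ** G M))"
proof (induction rule: cls.induct)
  case (1 c)
  have "trace (Y ** (0 :: complex^'n^'n)) = 0"
    by (simp add: trace_def matrix_matrix_mult_def)
  then show ?case by (auto intro!: expands_const)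
next
  case (2 a)
  show ?case
    by (rule expands_cong[OF expands_trace[OF expandsM_mpow[OF Y, of a]]])
      (simp_all add: trace_scal trace_dpow scal_mult_right)
next
  case (3 f F G g F' G')
  from expands_add[OF 3(3,4)] show ?case
    by (rule expands_cong) (simp_all add: trace_mult_add distrib_left)
next
  case (4 f F G g F' G')
  from expands_mult[OF 4(3,4)] show ?case
    by (rule expands_cong) (simp_all add: trace_mult_add scal_mult_right trace_scal algebra_simps)
qed

subsection \<open>Matrix units\<close>

definition munit :: "'n \<Rightarrow> 'n \<Rightarrow> complex^'n^'n" where
  "munit k l = (\<chi> i j. if i = k \<and> j = l then 1 else 0)"

lemma mult_munit: "(A ** munit k l) $ i $ m = (if m = l then A $ i $ k else 0)"
  by (cases "m = l")
    (simp_all add: matrix_matrix_mult_def munit_def if_distrib[of "\<lambda>u. _ * u"] sum.delta' cong: if_cong)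

lemma munit_mult: "(munit k l ** A) $ i $ m = (if i = k then A $ l $ m else 0)"
  by (cases "i = k")
    (simp_all add: matrix_matrix_mult_def munit_def if_distrib[of "\<lambda>u. u * _"] sum.delta' cong: if_cong)

lemma mult_munit_mult: "(A ** munit k l ** B) $ i $ j = A $ i $ k * B $ l $ j"
proof -
  have "(A ** munit k l ** B) $ i $ j = (\<Sum>m\<in>UNIV. (A ** munit k l) $ i $ m * B $ m $ j)"
    by (simp only: matrix_matrix_mult_def[of "A ** munit k l" B] vec_lambda_beta)
  also have "\<dots> = (\<Sum>m\<in>UNIV. if m = l then A $ i $ k * B $ m $ j else 0)"
    by (rule sum.cong) (simp_all add: mult_munit)
  finally show ?thesis by (simp add: sum.delta')
qed

lemma trace_munit_mult: "trace (munit k l ** A) = A $ l $ k"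
  by (simp add: trace_def munit_mult sum.delta')

lemma adj_munit: "adj (munit k l) = munit l k"
  by (auto simp: vec_eq_iff adj_nth munit_def)

lemma munit_mult_munit: "munit k l ** munit p q = (if l = p then munit k q else 0)"
  by (auto simp: vec_eq_iff munit_mult) (auto simp: munit_def)

lemma adj_add: "adj (A + B) = adj A + adj B"
  and adj_scal: "adj (scal c A) = scal (cnj c) (adj A)"
  by (simp_all add: vec_eq_iff adj_nth)

lemma matrix_mult_zero: "A ** 0 = (0 :: complex^'n^'n)" "0 ** A = (0 :: complex^'n^'n)"
  by (simp_all add: vec_eq_iff matrix_matrix_mult_def)

lemma hproj_munit: "hproj (munit k k)"
  by (simp add: hproj_def adj_munit munit_mult_munit)

text \<open>The projection onto the line through e_k + cnj(w) e_l. Varying the phase w separates the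
  two off-diagonal matrix units.\<close>

lemma hproj_munit_pair:
  assumes "k \<noteq> l" "cmod w = 1"
  shows "hproj (scal (1 / 2) (munit k k + munit l l + scal w (munit k l) + scal (cnj w) (munit l k)))"
proof -
  have w: "w * cnj w = 1" "cnj w * w = 1"
    using complex_norm_square[of w] assms(2) by (simp_all add: mult.commute)
  let ?A = "munit k k + munit l l + scal w (munit k l) + scal (cnj w) (munit l k)"
  have "adj ?A = ?A" by (simp add: adj_add adj_scal adj_munit add_ac)
  moreover have "?A ** ?A = scal 2 ?A"
    using assms(1) w
    by (simp add: matrix_add_ldistrib matrix_add_rdistrib scal_mult_left scal_mult_right munit_mult_munit scal_scal
        matrix_mult_zero)
      (auto simp: vec_eq_iff munit_def algebra_simps)
  ultimately show ?thesis by (simp add: hproj_def adj_scal scal_mult_left scal_mult_right scal_scal)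
qed

subsection \<open>Haar measure\<close>

lemma closed_unitary_group: "closed (unitary_group :: (complex^'n^'n) set)"
proof -
  have U: "unitary_group = {M :: complex^'n^'n. \<forall>i j. (M ** adj M) $ i $ j = idm $ i $ j}"
    by (auto simp: unitary_iff vec_eq_iff)
  have "continuous_on UNIV (\<lambda>M :: complex^'n^'n. M ** adj M)"
    by (intro continuous_matrix_mult continuous_on_id continuous_adj)
  then show ?thesis unfolding U
    by (intro closed_Collect_all closed_Collect_eq continuous_intros)
qed

lemma compact_unitary_group: "compact (unitary_group :: (complex^'n^'n) set)"
proof -
  have "norm M \<le> of_nat CARD('n) * of_nat CARD('n)" if "M \<in> unitary_group" for M :: "complex^'n^'n"
  proof -
    have "norm M \<le> (\<Sum>i\<in>UNIV. norm (M $ i))"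
      unfolding norm_vec_def by (intro L2_set_le_sum) auto
    also have "\<dots> \<le> (\<Sum>i\<in>(UNIV :: 'n set). of_nat CARD('n))"
    proof (rule sum_mono)
      fix i
      have "norm (M $ i) \<le> (\<Sum>j\<in>UNIV. cmod (M $ i $ j))"
        unfolding norm_vec_def by (intro L2_set_le_sum) auto
      also have "\<dots> \<le> (\<Sum>j\<in>(UNIV :: 'n set). 1)"
        by (intro sum_mono unitary_entry_bound that)
      finally show "norm (M $ i) \<le> of_nat CARD('n)" by simp
    qed
    finally show ?thesis by simp
  qed
  then have "bounded (unitary_group :: (complex^'n^'n) set)" by (auto simp: bounded_iff)
  then show ?thesis using closed_unitary_group compact_eq_bounded_closed by blast
qed

context
  fixes H :: "(complex^'n^'n) measure"
  assumes haar: "normalized_haar H"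
begin

interpretation prob_space H using haar by (simp add: normalized_haar_def)

lemma sets_haar: "sets H = sets (restrict_space borel unitary_group)"
  using haar by (simp add: normalized_haar_def)

lemma space_haar: "space H = unitary_group"
  using sets_eq_imp_space_eq[OF sets_haar] by (simp add: space_restrict_space)

lemma haar_measurable:
  fixes f :: "complex^'n^'n \<Rightarrow> complex"
  assumes "continuous_on UNIV f"
  shows "f \<in> borel_measurable H"
  using measurable_restrict_space1[OF borel_measurable_continuous_onI[OF assms], of unitary_group]
  by (simp add: measurable_cong_sets[OF sets_haar refl])

lemma continuous_bounded_unitary:
  fixes f :: "complex^'n^'n \<Rightarrow> complex"
  assumes "continuous_on UNIV f"
  obtains B where "\<And>M. M \<in> unitary_group \<Longrightarrow> cmod (f M) \<le> B"
proof -
  have "compact (f ` unitary_group)"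
    by (rule compact_continuous_image[OF _ compact_unitary_group]) (rule continuous_on_subset[OF assms], simp)
  then have "bounded (f ` unitary_group)" by (rule compact_imp_bounded)
  then obtain B where "\<forall>x\<in>f ` unitary_group. cmod x \<le> B"
    unfolding bounded_iff ..
  then have "cmod (f M) \<le> B" if "M \<in> unitary_group" for M using that by blast
  then show ?thesis by (rule that)
qed

lemma haar_integrable:
  fixes f :: "complex^'n^'n \<Rightarrow> complex"
  assumes "continuous_on UNIV f"
  shows "integrable H f"
proof -
  obtain B where "\<And>M. M \<in> unitary_group \<Longrightarrow> cmod (f M) \<le> B"
    using assms by (rule continuous_bounded_unitary) blast
  then show ?thesis
    by (intro integrable_const_bound[of _ B] haar_measurable assms) (auto simp: space_haar)
qed

lemma haar_left_invariant:
  fixes f :: "complex^'n^'n \<Rightarrow> complex"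
  assumes f: "continuous_on UNIV f" and g: "g \<in> unitary_group"
  shows "(LINT M|H. f (g ** M)) = (LINT M|H. f M)"
proof -
    have "continuous_on UNIV (\<lambda>M :: complex^'n^'n. g ** M)"
      by (intro continuous_matrix_mult continuous_intros)
  then have "(\<lambda>M :: complex^'n^'n. g ** M) \<in> borel \<rightarrow>\<^sub>M borel" by (rule borel_measurable_continuous_onI)
  then have "(\<lambda>M :: complex^'n^'n. g ** M) \<in> restrict_space borel unitary_group \<rightarrow>\<^sub>M restrict_space borel unitary_group"
    by (rule measurable_restrict_space3) (auto intro: unitary_mult g)
  then have "(\<lambda>M :: complex^'n^'n. g ** M) \<in> H \<rightarrow>\<^sub>M H"
    by (simp add: measurable_cong_sets[OF sets_haar sets_haar])
  moreover have "distr H H (\<lambda>M. g ** M) = H" using haar g by (simp add: normalized_haar_def)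
  ultimately show ?thesis using integral_distr[of "\<lambda>M. g ** M" H H f] haar_measurable[OF f] by simp
qed

text \<open>By invariance F(RM) and F(M) have the same integral, so t times the integral of F1
  equals, up to sign, the integral of the remainder and is at most C t^2. Divide by t and let t tend
  to 0.\<close>

lemma haar_derivative:
  fixes F F1 :: "complex^'n^'n \<Rightarrow> complex"
  assumes ex: "expands unitary_group (\<lambda>t M. F (rot Y t ** M)) F F1" and Y: "hproj Y"
    and F: "continuous_on UNIV F" and F1: "continuous_on UNIV F1"
  shows "(LINT M|H. F1 M) = 0"
proof -
  obtain C where C: "C \<ge> 0" "\<And>M t. M \<in> unitary_group \<Longrightarrow> 0 \<le> t \<Longrightarrow> t \<le> 1 \<Longrightarrow>
      cmod (F (rot Y t ** M) - F M - of_real t * F1 M) \<le> C * t\<^sup>2"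
    using ex by (rule expandsE) blast
  have "cmod (LINT M|H. F1 M) \<le> C * t" if t: "0 < t" "t \<le> 1" for t
  proof -
    have "continuous_on UNIV (\<lambda>M :: complex^'n^'n. rot Y t ** M)"
      by (intro continuous_matrix_mult continuous_intros)
    then have Ft: "continuous_on UNIV (\<lambda>M. F (rot Y t ** M))"
      by (rule continuous_on_compose2[OF F]) simp
    note int = haar_integrable[OF F] haar_integrable[OF Ft] haar_integrable[OF F1]
    have intD: "integrable H (\<lambda>M. F (rot Y t ** M) - F M - of_real t * F1 M)"
      by (intro Bochner_Integration.integrable_diff integrable_mult_right int)
    have "(LINT M|H. F (rot Y t ** M) - F M - of_real t * F1 M)
        = (LINT M|H. F (rot Y t ** M)) - (LINT M|H. F M) - of_real t * (LINT M|H. F1 M)"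
      using int by (simp add: Bochner_Integration.integral_diff)
    also have "\<dots> = - (of_real t * (LINT M|H. F1 M))"
      by (simp add: haar_left_invariant[OF F rot_unitary[OF Y]])
    finally have "of_real t * (LINT M|H. F1 M) = - (LINT M|H. F (rot Y t ** M) - F M - of_real t * F1 M)"
      by simp
    from arg_cong[OF this, of cmod]
    have "t * cmod (LINT M|H. F1 M) = cmod (LINT M|H. F (rot Y t ** M) - F M - of_real t * F1 M)"
      using t by (simp only: norm_mult norm_minus_cancel norm_of_real abs_of_pos)
    also have "\<dots> \<le> (LINT M|H. cmod (F (rot Y t ** M) - F M - of_real t * F1 M))"
      by (rule integral_norm_bound)
    also have "\<dots> \<le> (LINT M|H. C * t\<^sup>2)"
    proof (rule integral_mono)
      fix M assume "M \<in> space H"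
      then show "cmod (F (rot Y t ** M) - F M - of_real t * F1 M) \<le> C * t\<^sup>2"
        using t by (intro C(2)) (simp_all add: space_haar)
    qed (use intD in simp_all)
    also have "\<dots> = t * (C * t)" by (simp add: power2_eq_square prob_space)
    finally show ?thesis using t by simp
  qed
  note bound = this
  have "cmod (LINT M|H. F1 M) \<le> 0 + e" if e: "e > 0" for e
  proof -
    \<comment> \<open>The denominator C + 1 avoids division by 0, and the minimum keeps t in the
      range of the expansion.\<close>
    have "cmod (LINT M|H. F1 M) \<le> C * min 1 (e / (C + 1))"
      using bound[of "min 1 (e / (C + 1))"] e C(1) by simp
    also have "\<dots> \<le> C * (e / (C + 1))" using C(1) by (intro mult_left_mono) auto
    also have "\<dots> = e * (C / (C + 1))" by simp
    also have "\<dots> \<le> e * 1" using C(1) e by (intro mult_left_mono) auto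
    finally show ?thesis by simp
  qed
  then have "cmod (LINT M|H. F1 M) \<le> 0" by (rule field_le_epsilon)
  then show ?thesis by simp
qed

end

subsection \<open>Loop equations and the Weyl integration formula\<close>

lemma dpow_add: "dpow (Y + Z) a M = dpow Y a M + dpow Z a M"
  by (simp add: dpow_def matrix_add_ldistrib matrix_add_rdistrib sum.distrib)

lemma dpow_scal: "dpow (scal c Y) a M = scal c (dpow Y a M)"
  by (simp add: dpow_def scal_mult_left scal_mult_right scal_sum scal_minus)

text \<open>Since (A e_ij B)_ij = A_ii B_jj, the double sum replaces each product A Y B by tr A tr
  B: a loop splits in two.\<close>

lemma sum_dpow_munit:
  fixes M :: "complex^'n^'n"
  assumes M: "M \<in> unitary_group"
  shows "(\<Sum>i\<in>UNIV. \<Sum>j\<in>UNIV. dpow (munit i j) a M $ i $ j) = leval CARD('n) (eig M) (loop_term CARD('n) a)"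
proof -
  have 1: "(\<Sum>i\<in>UNIV. \<Sum>j\<in>UNIV. (mpow M b ** munit i j ** mpow M d) $ i $ j)
      = leval CARD('n) (eig M) (psum CARD('n) b * psum CARD('n) d)" for b d
    by (simp add: mult_munit_mult evalU_mult[OF M] trace_def sum_product flip: trace_mpow_eig[OF M])
  have 2: "(\<Sum>i\<in>UNIV. \<Sum>j\<in>UNIV. (\<Sum>c\<in>K. A c ** munit i j ** B c) $ i $ j)
      = (\<Sum>c\<in>K. \<Sum>i\<in>UNIV. \<Sum>j\<in>UNIV. (A c ** munit i j ** B c) $ i $ j)"
    for K :: "nat set" and A B :: "nat \<Rightarrow> complex^'n^'n"
    by (simp, subst (2) sum.swap, subst sum.swap) (rule refl)
  have 3: "leval n x (- f) = - leval n x f" for n x f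
    using eval_diff[of n x 0 f] by simp
  show ?thesis
    unfolding dpow_def loop_term_def
    by (cases "a \<ge> 0") (simp_all add: 2 1 3 eval_sum sum_negf del: sum_component)
qed

text \<open>The derivative of (M^a)_ij F(M) along Y integrates to 0, first for projections Y and by
  complex linearity for all matrix units. Put Y = e_ij and sum over i, j: differentiating M^a splits
  the loop, and differentiating F gives tr(M^a G), the term with \<open>Theta\<close>.\<close>

lemma haar_loop_equation:
  fixes H :: "(complex^'n^'n) measure"
  assumes haar: "normalized_haar H" and u: "u \<in> csym CARD('n)"
  shows "(LINT M|H. leval CARD('n) (eig M) (loop_term CARD('n) a * u + Theta CARD('n) a u)) = 0"
proof -
  obtain F and G :: "complex^'n^'n \<Rightarrow> complex^'n^'n" where FG: "cls u F G"
    using csym_cls[OF u] by blast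
  have F: "continuous_on UNIV F" and G: "continuous_on UNIV G"
    using cls_continuous[OF FG] by auto
  define J where "J i j Y = (LINT M|H. dpow Y a M $ i $ j * F M + mpow M a $ i $ j * trace (Y ** G M))"
    for i j Y
  have cont: "continuous_on UNIV (\<lambda>M. dpow Y a M $ i $ j * F M + mpow M a $ i $ j * trace (Y ** G M))"
    for i j Y
    by (intro continuous_intros F continuous_dpow continuous_mpow continuous_trace continuous_matrix_mult G)
  note int = haar_integrable[OF haar cont]
  have J_add: "J i j (Y + Z) = J i j Y + J i j Z" for i j Y Z
    unfolding J_def
    by (subst Bochner_Integration.integral_add[OF int int, symmetric])
      (simp add: dpow_add matrix_add_rdistrib trace_add algebra_simps)
  have J_scal: "J i j (scal c Y) = c * J i j Y" for i j c Y
    unfolding J_def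
    by (subst integral_mult_right_zero[symmetric])
      (simp add: dpow_scal scal_mult_left trace_scal algebra_simps)
  have J_proj: "J i j Y = 0" if Y: "hproj Y" for i j Y
  proof -
    have "expands unitary_group (\<lambda>t M. mpow (rot Y t ** M) a $ i $ j) (\<lambda>M. mpow M a $ i $ j)
       (\<lambda>M. scal \<i> (dpow Y a M) $ i $ j)"
      using expandsM_mpow[OF Y, of a] unfolding expandsM_def by blast
    from expands_mult[OF this cls_expands[OF Y FG]]
    have "expands unitary_group (\<lambda>t M. mpow (rot Y t ** M) a $ i $ j * F (rot Y t ** M)) (\<lambda>M. mpow M a $ i $ j * F M)
       (\<lambda>M. \<i> * (dpow Y a M $ i $ j * F M + mpow M a $ i $ j * trace (Y ** G M)))"
      by (rule expands_cong) (simp_all add: algebra_simps)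
    then have "(LINT M|H. \<i> * (dpow Y a M $ i $ j * F M + mpow M a $ i $ j * trace (Y ** G M))) = 0"
      by (rule haar_derivative[OF haar _ Y])
        (intro continuous_intros F continuous_mpow cont)+
    then show ?thesis by (simp add: J_def)
  qed
  have J_munit: "J i j (munit k l) = 0" for i j k l
  proof (cases "k = l")
    case True
    then show ?thesis by (simp add: J_proj hproj_munit)
  next
    case False
    have kk: "J i j (munit k k) = 0" "J i j (munit l l) = 0" by (simp_all add: J_proj hproj_munit)
    have *: "w * J i j (munit k l) + cnj w * J i j (munit l k) = 0" if "cmod w = 1" for w
      using J_proj[OF hproj_munit_pair[OF False that], of i j] kk by (simp add: J_add J_scal)
    \<comment> \<open>The phase 1 controls the sum of the two off-diagonal values, the phase \<i>
      their difference.\<close>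
    have "J i j (munit k l) + J i j (munit l k) = 0" using *[of 1] by simp
    moreover have "\<i> * (J i j (munit k l) - J i j (munit l k)) = 0"
      using *[of \<i>] by (simp add: algebra_simps)
    ultimately show ?thesis by (simp add: add_eq_0_iff2)
  qed
  have "(LINT M|H. leval CARD('n) (eig M) (loop_term CARD('n) a * u + Theta CARD('n) a u))
      = (LINT M|H. (\<Sum>i\<in>UNIV. \<Sum>j\<in>UNIV. dpow (munit i j) a M $ i $ j * F M
           + mpow M a $ i $ j * trace (munit i j ** G M)))"
  proof (rule Bochner_Integration.integral_cong[OF refl])
    fix M assume "M \<in> space H"
    then have M: "M \<in> unitary_group" using space_haar[OF haar] by simp
    have "(\<Sum>i\<in>UNIV. \<Sum>j\<in>UNIV. dpow (munit i j) a M $ i $ j * F M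
           + mpow M a $ i $ j * trace (munit i j ** G M))
        = (\<Sum>i\<in>UNIV. \<Sum>j\<in>UNIV. dpow (munit i j) a M $ i $ j) * F M + trace (mpow M a ** G M)"
      by (simp only: trace_munit_mult)
        (simp add: sum.distrib sum_distrib_right trace_def matrix_matrix_mult_def)
    also have "\<dots> = leval CARD('n) (eig M) (loop_term CARD('n) a * u + Theta CARD('n) a u)"
      by (simp add: sum_dpow_munit[OF M] cls_Theta[OF FG M] cls_eval[OF FG M] eval_add evalU_mult[OF M])
    finally show "leval CARD('n) (eig M) (loop_term CARD('n) a * u + Theta CARD('n) a u)
       = (\<Sum>i\<in>UNIV. \<Sum>j\<in>UNIV. dpow (munit i j) a M $ i $ j * F M
           + mpow M a $ i $ j * trace (munit i j ** G M))" ..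
  qed
  also have "\<dots> = (\<Sum>i\<in>UNIV. \<Sum>j\<in>UNIV. J i j (munit i j))"
    unfolding J_def
    by (subst Bochner_Integration.integral_sum, (intro Bochner_Integration.integrable_sum int)[1],
        rule sum.cong[OF refl], rule Bochner_Integration.integral_sum, rule int)
  also have "\<dots> = 0" by (simp add: J_munit)
  finally show ?thesis .
qed

lemma csym_integrable:
  fixes H :: "(complex^'n^'n) measure"
  assumes haar: "normalized_haar H" and f: "f \<in> csym CARD('n)"
  shows "integrable H (\<lambda>M. leval CARD('n) (eig M) f)"
proof -
  obtain F and G :: "complex^'n^'n \<Rightarrow> complex^'n^'n" where FG: "cls f F G"
    using csym_cls[OF f] by blast
  have "integrable H F" using cls_continuous[OF FG] haar_integrable[OF haar] by blast
  then show ?thesis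
    using Bochner_Integration.integrable_cong[of H H F "\<lambda>M. leval CARD('n) (eig M) f"] cls_eval[OF FG] space_haar[OF haar] by simp
qed

theorem weyl_integration:
  fixes H :: "(complex^'n^'n) measure"
  assumes haar: "normalized_haar H" and f: "f \<in> csym CARD('n)"
  shows "fact CARD('n) * (LINT M|H. leval CARD('n) (eig M) f)
    = lookup (alt CARD('n) (dlt CARD('n)) * f * alt CARD('n) (\<lambda>i. - dlt CARD('n) i)) 0"
proof (rule weyl_functional[OF _ _ _ _ f])
  interpret prob_space H using haar by (simp add: normalized_haar_def)
  fix f g c assume fg: "f \<in> csym CARD('n)"
  show "g \<in> csym CARD('n) \<Longrightarrow> (LINT M|H. leval CARD('n) (eig M) (f + g))
      = (LINT M|H. leval CARD('n) (eig M) f) + (LINT M|H. leval CARD('n) (eig M) g)"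
    by (simp add: eval_add csym_integrable[OF haar] fg)
  have "(LINT M|H. leval CARD('n) (eig M) (cst c * f)) = (LINT M|H. c * leval CARD('n) (eig M) f)"
    by (rule Bochner_Integration.integral_cong[OF refl]) (simp add: evalU_mult space_haar[OF haar])
  then show "(LINT M|H. leval CARD('n) (eig M) (cst c * f)) = c * (LINT M|H. leval CARD('n) (eig M) f)"
    by simp
next
  interpret prob_space H using haar by (simp add: normalized_haar_def)
  show "(LINT M|H. leval CARD('n) (eig M) 1) = 1" by (simp add: prob_space)
qed (rule haar_loop_equation[OF haar])

subsection \<open>Jacobi--Trudi and bialternants\<close>

definition geo_fps :: "'a::comm_ring_1 \<Rightarrow> 'a fps" where
  "geo_fps c = Abs_fps (\<lambda>k. c ^ k)"

text \<open>The generating function \<Prod> 1 / (1 - x_j z) of the complete homogeneous polynomials,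
  built from geometric series so that it makes sense over any commutative ring, in particular for
  Laurent polynomials.\<close>

definition hfps :: "nat \<Rightarrow> (nat \<Rightarrow> 'a::comm_ring_1) \<Rightarrow> 'a fps" where
  "hfps n x = (\<Prod>j<n. geo_fps (x j))"

definition hsym :: "nat \<Rightarrow> (nat \<Rightarrow> 'a::comm_ring_1) \<Rightarrow> int \<Rightarrow> 'a" where
  "hsym n x k = (if k < 0 then 0 else fps_nth (hfps n x) (nat k))"

lemma geo_fps_inverse: "geo_fps c * (1 - fps_const c * fps_X) = 1"
proof (rule fps_ext)
  fix k
  have "geo_fps c * (1 - fps_const c * fps_X) = geo_fps c - fps_const c * (fps_X * geo_fps c)"
    by (simp add: algebra_simps)
  then show "fps_nth (geo_fps c * (1 - fps_const c * fps_X)) k = fps_nth 1 k"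
    by (cases k) (simp_all add: geo_fps_def)
qed

lemma prod_linear_nth_eq_0:
  fixes c :: "nat \<Rightarrow> 'a::comm_ring_1"
  assumes "finite A" "card A < m"
  shows "fps_nth (\<Prod>i\<in>A. 1 - fps_const (c i) * fps_X) m = 0"
  using assms
proof (induction A arbitrary: m)
  case (insert a A)
  then obtain m' where m: "m = Suc m'" "card A < m'" by (cases m) auto
  have "(\<Prod>i\<in>insert a A. 1 - fps_const (c i) * fps_X)
      = (\<Prod>i\<in>A. 1 - fps_const (c i) * fps_X) - fps_const (c a) * (fps_X * (\<Prod>i\<in>A. 1 - fps_const (c i) * fps_X))"
    using insert by (simp add: algebra_simps)
  then show ?case using insert.IH[of m] insert.IH[of m'] m by simp
qed auto

text \<open>Multiplying \<Prod> 1 / (1 - x_i z) by the factors 1 - x_i z with i \<noteq> j leaves 1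
  / (1 - x_j z). The multiplier has degree at most n - 1, so its coefficients can be indexed by the
  staircase.\<close>

lemma power_eq_hsym:
  fixes x :: "nat \<Rightarrow> 'a::comm_ring_1"
  assumes j: "j < n"
  shows "x j ^ k = (\<Sum>l<n. hsym n x (int k - dlt n l) *
     fps_nth (\<Prod>i\<in>{..<n} - {j}. 1 - fps_const (x i) * fps_X) (n - 1 - l))"
proof -
  let ?e = "\<Prod>i\<in>{..<n} - {j}. 1 - fps_const (x i) * fps_X"
  have "hfps n x * ?e = geo_fps (x j) * (\<Prod>i\<in>{..<n} - {j}. geo_fps (x i) * (1 - fps_const (x i) * fps_X))"
    unfolding hfps_def prod.distrib by (subst prod.remove[of "{..<n}" j]) (use j in \<open>auto simp: mult.assoc\<close>)
  then have "hfps n x * ?e = geo_fps (x j)" by (simp add: geo_fps_inverse)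
  then have "x j ^ k = fps_nth (?e * hfps n x) k" by (simp add: geo_fps_def mult.commute)
  also have "\<dots> = (\<Sum>m=0..k. hsym n x (int k - int m) * fps_nth ?e m)"
    unfolding fps_mult_nth by (rule sum.cong) (auto simp: hsym_def nat_diff_distrib mult.commute)
  also have "\<dots> = (\<Sum>m<n. hsym n x (int k - int m) * fps_nth ?e m)"
  proof (rule sum.mono_neutral_cong)
    fix m assume "m \<in> {0..k} - {..<n}"
    then have "card ({..<n} - {j}) < m" using j by (simp, linarith)
    then show "hsym n x (int k - int m) * fps_nth ?e m = 0"
      using prod_linear_nth_eq_0[of "{..<n} - {j}" m x] by simp
  qed (auto simp: hsym_def)
  also have "\<dots> = (\<Sum>l<n. hsym n x (int k - dlt n l) * fps_nth ?e (n - 1 - l))"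
    by (rule sum.reindex_bij_witness[of _ "\<lambda>l. n - 1 - l" "\<lambda>l. n - 1 - l"])
      (auto simp: dlt_def of_nat_diff algebra_simps)
  finally show ?thesis .
qed

lemma hsym_0: "hsym n x 0 = 1"
proof -
  have "fps_nth (hfps n x) 0 = 1"
    by (induction n) (simp_all add: hfps_def geo_fps_def)
  then show ?thesis by (simp add: hsym_def)
qed

text \<open>By \<open>power_eq_hsym\<close> every matrix of powers factors as H(h) E with one and
  the same E. For the staircase H is unitriangular, which identifies det E with the denominator
  without computing it.\<close>

lemma bialternant:
  fixes x :: "nat \<Rightarrow> 'a::comm_ring_1"
  shows "Determinant.det (Matrix.mat n n (\<lambda>(i, j). x j ^ h i))
    = Determinant.det (Matrix.mat n n (\<lambda>(i, j). hsym n x (int (h i) - dlt n j)))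
      * Determinant.det (Matrix.mat n n (\<lambda>(i, j). x j ^ (n - 1 - i)))"
proof -
  let ?e = "\<lambda>j. \<Prod>i\<in>{..<n} - {j}. 1 - fps_const (x i) * fps_X"
  let ?H = "\<lambda>h. Matrix.mat n n (\<lambda>(i, l). hsym n x (int (h i) - dlt n l))"
  let ?E = "Matrix.mat n n (\<lambda>(l, j). fps_nth (?e j) (n - 1 - l))"
  have "Matrix.mat n n (\<lambda>(i, j). x j ^ h i) = ?H h * ?E" for h
    by (rule eq_matI) (auto simp: scalar_prod_def power_eq_hsym[of _ n x] atLeast0LessThan)
  then have 1: "Determinant.det (Matrix.mat n n (\<lambda>(i, j). x j ^ h i)) = Determinant.det (?H h) * Determinant.det ?E" for h
    by (simp add: Determinant.det_mult[of _ n])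
  have "Determinant.det (?H (\<lambda>i. n - 1 - i)) = prod_list (diag_mat (?H (\<lambda>i. n - 1 - i)))"
    by (rule Determinant.det_upper_triangular[of _ n])
      (auto simp: upper_triangular_def hsym_def dlt_def of_nat_diff)
  also have "diag_mat (?H (\<lambda>i. n - 1 - i)) = replicate n 1"
    by (rule nth_equalityI) (auto simp: diag_mat_def dlt_def of_nat_diff hsym_0)
  finally have "Determinant.det (?H (\<lambda>i. n - 1 - i)) = 1" by (simp add: prod_list_replicate)
  then show ?thesis using 1[of h] 1[of "\<lambda>i. n - 1 - i"] by simp
qed

subsection \<open>Newton's recursion\<close>

lemma fps_XD_prod:
  fixes f :: "nat \<Rightarrow> 'a::comm_ring_1 fps"
  assumes "\<And>j. j < n \<Longrightarrow> fps_X * fps_deriv (f j) = f j * g j"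
  shows "fps_X * fps_deriv (\<Prod>j<n. f j) = (\<Prod>j<n. f j) * (\<Sum>j<n. g j)"
  using assms
proof (induction n)
  case (Suc n)
  have "fps_X * fps_deriv (\<Prod>j<Suc n. f j)
      = (fps_X * fps_deriv (\<Prod>j<n. f j)) * f n + (\<Prod>j<n. f j) * (fps_X * fps_deriv (f n))"
    by (simp add: algebra_simps)
  then show ?case using Suc by (simp add: algebra_simps)
qed simp

definition pfps :: "(nat \<Rightarrow> 'a::comm_ring_1) \<Rightarrow> 'a fps" where
  "pfps p = Abs_fps (\<lambda>i. if i = 0 then 0 else p i)"

lemma hfps_XD:
  fixes x :: "nat \<Rightarrow> 'a::comm_ring_1"
  shows "fps_X * fps_deriv (hfps n x) = hfps n x * pfps (\<lambda>i. \<Sum>j<n. x j ^ i)"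
proof -
  have "fps_X * fps_deriv (geo_fps c) = geo_fps c * pfps (\<lambda>i. c ^ i)" for c :: 'a
  proof (rule fps_ext)
    fix k
    have "fps_nth (geo_fps c * pfps (\<lambda>i. c ^ i)) k = (\<Sum>i=0..k. c ^ i * (if k - i = 0 then 0 else c ^ (k - i)))"
      by (simp add: fps_mult_nth geo_fps_def pfps_def)
    also have "\<dots> = (\<Sum>i\<in>{0..<k}. c ^ k)"
      by (rule sum.mono_neutral_cong_right) (auto simp flip: power_add)
    also have "\<dots> = fps_nth (fps_X * fps_deriv (geo_fps c)) k"
      by (cases k) (simp_all add: geo_fps_def)
    finally show "fps_nth (fps_X * fps_deriv (geo_fps c)) k = fps_nth (geo_fps c * pfps (\<lambda>i. c ^ i)) k" ..
  qed
  then have "fps_X * fps_deriv (hfps n x) = hfps n x * (\<Sum>j<n. pfps (\<lambda>i. x j ^ i))"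
    unfolding hfps_def by (intro fps_XD_prod) auto
  also have "(\<Sum>j<n. pfps (\<lambda>i. x j ^ i)) = pfps (\<lambda>i. \<Sum>j<n. x j ^ i)"
    by (rule fps_ext) (simp add: pfps_def fps_sum_nth)
  finally show ?thesis .
qed

text \<open>For \<open>hfps\<close> these are Newton's identities k h_k = \<Sum> h_i
  p_(k-i).\<close>

lemma XD_recursion:
  assumes "fps_X * fps_deriv F = F * pfps p"
  shows "of_nat k * fps_nth F k = (\<Sum>i<k. fps_nth F i * p (k - i))"
proof -
  have "of_nat k * fps_nth F k = fps_nth (fps_X * fps_deriv F) k" by (cases k) simp_all
  also have "\<dots> = (\<Sum>i=0..k. fps_nth F i * (if k - i = 0 then 0 else p (k - i)))"
    by (simp add: assms fps_mult_nth pfps_def)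
  also have "\<dots> = (\<Sum>i<k. fps_nth F i * p (k - i))"
    by (rule sum.mono_neutral_cong_right) auto
  finally show ?thesis .
qed

lemma XD_unique:
  fixes F G :: "complex fps"
  assumes "fps_X * fps_deriv F = F * pfps p" "fps_X * fps_deriv G = G * pfps p" "fps_nth F 0 = fps_nth G 0"
  shows "F = G"
proof (rule fps_ext)
  fix k show "fps_nth F k = fps_nth G k"
  proof (induction k rule: less_induct)
    case (less k)
    show ?case
    proof (cases "k = 0")
      case False
      have "of_nat k * fps_nth F k = of_nat k * fps_nth G k"
        unfolding XD_recursion[OF assms(1)] XD_recursion[OF assms(2)]
        by (rule sum.cong) (auto simp: less)
      then show ?thesis using False by simp
    qed (simp add: assms)
  qed
qed

text \<open>The series exp(\<Sum> p_i z^i / i) and \<Prod> 1 / (1 - x_j z) have the same constant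
  term and the same logarithmic derivative. The division by 0 at i = 0 is harmless as
  \<open>elem_schur\<close> ignores that argument.\<close>

lemma elem_schur_power_sums:
  fixes x :: "nat \<Rightarrow> complex"
  shows "elem_schur (\<lambda>i. (\<Sum>j<n. x j ^ i) / of_nat i) k = hsym n x k"
proof -
  define t where "t i = (\<Sum>j<n. x j ^ i) / of_nat i" for i
  define B where "B = Abs_fps (\<lambda>i. if i = 0 then 0 else t i)"
  define F where "F = fps_compose (fps_exp 1) B"
  have B0: "fps_nth B 0 = 0" by (simp add: B_def)
  have e: "Abs_fps (\<lambda>j. of_real (1 / fact j)) = fps_exp (1::complex)"
    by (rule fps_ext) (simp add: of_real_divide)
  have "fps_deriv F = F * fps_deriv B"
    unfolding F_def using fps_compose_deriv[OF B0, of "fps_exp 1"] by (simp add: fps_exp_deriv)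
  then have "fps_X * fps_deriv F = F * (fps_X * fps_deriv B)" by (simp add: mult.left_commute)
  moreover have "fps_X * fps_deriv B = pfps (\<lambda>i. \<Sum>j<n. x j ^ i)"
  proof (rule fps_ext)
    fix k
    have "fps_nth (fps_X * fps_deriv B) k = of_nat k * fps_nth B k" by (cases k) simp_all
    then show "fps_nth (fps_X * fps_deriv B) k = fps_nth (pfps (\<lambda>i. \<Sum>j<n. x j ^ i)) k"
      by (cases "k = 0") (simp_all add: pfps_def B_def t_def)
  qed
  ultimately have F: "fps_X * fps_deriv F = F * pfps (\<lambda>i. \<Sum>j<n. x j ^ i)" by simp
  have "fps_nth F 0 = fps_nth (hfps n x) 0"
    using hsym_0[of n x] by (simp add: hsym_def F_def)
  then have "F = hfps n x" by (rule XD_unique[OF F hfps_XD])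
  then show ?thesis
    unfolding elem_schur_def hsym_def e t_def[symmetric] B_def[symmetric] F_def[symmetric] by simp
qed

text \<open>Newton's identities express k h_k by power sums and earlier h_i; k can be divided out
  over the complex numbers.\<close>

lemma csym_hsym: "hsym n (\<lambda>j. X j a) k \<in> csym n"
proof -
  have "fps_nth (hfps n (\<lambda>j. X j a)) k \<in> csym n" for k
  proof (induction k rule: less_induct)
    case (less k)
    show ?case
    proof (cases "k = 0")
      case True
      then show ?thesis using hsym_0[of n "\<lambda>j. X j a"] csym_1 by (simp add: hsym_def)
    next
      case False
      have "of_nat k * fps_nth (hfps n (\<lambda>j. X j a)) k
          = (\<Sum>i<k. fps_nth (hfps n (\<lambda>j. X j a)) i * psum n (a * int (k - i)))"
        unfolding XD_recursion[OF hfps_XD] by (simp add: X_power psum_def)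
      also have "\<dots> \<in> csym n"
        by (intro csym_sum csym_mult csym_psum less) simp
      finally have "cst (1 / of_nat k) * (of_nat k * fps_nth (hfps n (\<lambda>j. X j a)) k) \<in> csym n"
        by (rule csym_mult[OF csym_cst])
      also have "cst (1 / of_nat k) * (of_nat k * fps_nth (hfps n (\<lambda>j. X j a)) k) = fps_nth (hfps n (\<lambda>j. X j a)) k"
        using False unfolding of_nat_cst mult.assoc[symmetric] cst_mult[symmetric] by simp
      finally show ?thesis .
    qed
  qed
  then show ?thesis using csym_0 by (simp add: hsym_def)
qed

lemma eval_hsym:
  assumes "\<And>i. i < n \<Longrightarrow> x i \<noteq> 0"
  shows "leval n x (hsym n (\<lambda>j. X j a) k) = hsym n (\<lambda>j. x j powi a) k"
proof -
  have "leval n x (fps_nth (hfps m (\<lambda>j. X j a)) k) = fps_nth (hfps m (\<lambda>j. x j powi a)) k" if "m \<le> n" for m k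
    using that
  proof (induction m arbitrary: k)
    case 0
    then show ?case by (cases k) (simp_all add: hfps_def)
  next
    case (Suc m)
    have "leval n x (X m a ^ i) = (x m powi a) ^ i" for i
      using Suc.prems by (induction i) (simp_all add: eval_mult[OF assms] eval_X)
    then show ?case using Suc
      by (simp add: hfps_def fps_mult_nth eval_sum eval_mult[OF assms] geo_fps_def)
  qed
  then show ?thesis by (simp add: hsym_def)
qed

subsection \<open>Schur functions as Laurent polynomials\<close>

lemma elem_schur_0: "elem_schur t 0 = 1"
  by (simp add: elem_schur_def)

lemma elem_schur_neg: "k < 0 \<Longrightarrow> elem_schur t k = 0"
  by (simp add: elem_schur_def)

lemma down_closed_eq_lessThan:
  assumes fin: "finite S" and down: "\<And>i j :: nat. i \<in> S \<Longrightarrow> j \<le> i \<Longrightarrow> j \<in> S"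
  shows "S = {..<card S}"
proof (rule card_subset_eq)
  show "S \<subseteq> {..<card S}"
  proof
    fix i assume "i \<in> S"
    then have "{..i} \<subseteq> S" using down by auto
    then have "card {..i} \<le> card S" by (rule card_mono[OF fin])
    then show "i \<in> {..<card S}" by simp
  qed
qed simp_all

lemma partition_support:
  assumes la: "is_partition la"
  shows "la i = 0 \<longleftrightarrow> num_rows la \<le> i"
proof -
  have "{i. la i \<noteq> 0} = {..<num_rows la}"
    unfolding num_rows_def
  proof (rule down_closed_eq_lessThan)
    fix i j assume i: "i \<in> {i. la i \<noteq> 0}" and "j \<le> i"
    then have "la i \<le> la j" using la by (simp add: is_partition_def antimono_def)
    then show "j \<in> {i. la i \<noteq> 0}" using i by simp
  qed (use la in \<open>simp add: is_partition_def\<close>)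
  from arg_cong[OF this, of "\<lambda>S. i \<in> S"] show ?thesis by auto
qed

text \<open>A row beyond the last part is 0 up to the diagonal and 1 on it, so a determinant of any
  size n at least the number of rows can be used for all partitions alike.\<close>

lemma schur_larger_det:
  assumes la: "is_partition la" and n: "num_rows la \<le> n"
  shows "schur t la = Determinant.det (Matrix.mat n n (\<lambda>(i, j). elem_schur t (int (la i) - int i + int j)))"
  using n
proof (induction rule: dec_induct)
  case (step n)
  let ?A = "Matrix.mat (Suc n) (Suc n) (\<lambda>(i, j). elem_schur t (int (la i) - int i + int j))"
  have la0: "la n = 0" using partition_support[OF la] step by simp
  have "Determinant.det ?A = (\<Sum>j<Suc n. ?A $$ (n, j) * cofactor ?A n j)"
    by (rule laplace_expansion_row) auto
  also have "\<dots> = cofactor ?A n n"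
    by (simp add: la0 elem_schur_0 elem_schur_neg)
  also have "\<dots> = Determinant.det (mat_delete ?A n n)"
    by (simp add: cofactor_def flip: mult_2)
  also have "mat_delete ?A n n = Matrix.mat n n (\<lambda>(i, j). elem_schur t (int (la i) - int i + int j))"
    by (rule eq_matI) (auto simp: mat_delete_def)
  finally show ?case using step.IH by simp
qed (simp add: schur_def)

text \<open>The Schur polynomial in the variables x_j^a: a = 1 belongs to M and a = -1 to its
  complex conjugate.\<close>

definition slaur :: "nat \<Rightarrow> int \<Rightarrow> (nat \<Rightarrow> nat) \<Rightarrow> laurent" where
  "slaur n a la = Determinant.det (Matrix.mat n n (\<lambda>(i, j). hsym n (\<lambda>j. X j a) (int (la i) - int i + int j)))"

lemma slaur_leibniz: "slaur n a la = (\<Sum>p | p permutes {0..<n}. of_int (sign p) *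
    (\<Prod>i<n. hsym n (\<lambda>j. X j a) (int (la i) - int i + int (p i))))"
  unfolding slaur_def by (subst Determinant.det_def'[of _ n])
    (auto intro!: sum.cong prod.cong simp: permutes_in_image atLeast0LessThan)

lemma csym_slaur: "slaur n a la \<in> csym n"
  unfolding slaur_leibniz of_int_cst by (intro csym_sum csym_mult csym_cst csym_prod csym_hsym)

lemma eval_slaur:
  assumes x: "\<And>i. i < n \<Longrightarrow> x i \<noteq> 0" and la: "is_partition la" "num_rows la \<le> n"
  shows "leval n x (slaur n a la) = schur (\<lambda>i. (\<Sum>j<n. (x j powi a) ^ i) / of_nat i) la"
proof -
  have "leval n x (slaur n a la) = (\<Sum>p | p permutes {0..<n}. of_int (sign p) *
    (\<Prod>i<n. hsym n (\<lambda>j. x j powi a) (int (la i) - int i + int (p i))))"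
    unfolding slaur_leibniz of_int_cst
    by (simp only: eval_sum eval_mult[OF x] eval_prod[OF x] eval_hsym[OF x] eval_cst)
  also have "\<dots> = Determinant.det (Matrix.mat n n (\<lambda>(i, j). hsym n (\<lambda>j. x j powi a) (int (la i) - int i + int j)))"
    by (subst Determinant.det_def'[of _ n])
      (auto intro!: sum.cong prod.cong simp: permutes_in_image atLeast0LessThan)
  also have "\<dots> = schur (\<lambda>i. (\<Sum>j<n. (x j powi a) ^ i) / of_nat i) la"
    unfolding schur_larger_det[OF la] elem_schur_power_sums ..
  finally show ?thesis .
qed

lemma slaur_mult_alt:
  "slaur n a la * alt n (\<lambda>i. a * dlt n i) = alt n (\<lambda>i. a * (int (la i) + dlt n i))"
proof -
  have h: "int (la i + (n - 1 - i)) - dlt n j = int (la i) - int i + int j" if "i < n" "j < n" for i j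
    using that by (simp add: dlt_def of_nat_diff)
  have 1: "Matrix.mat n n (\<lambda>(i, j). hsym n (\<lambda>j. X j a) (int (la i + (n - 1 - i)) - dlt n j))
      = Matrix.mat n n (\<lambda>(i, j). hsym n (\<lambda>j. X j a) (int (la i) - int i + int j))"
    by (rule eq_matI) (simp_all only: index_mat dim_row_mat dim_col_mat split h)
  have 2: "alt n (\<lambda>i. a * int (k i)) = Determinant.det (Matrix.mat n n (\<lambda>(i, j). X j a ^ k i))" for k
    by (simp add: alt_def X_power)
  have 3: "alt n (\<lambda>i. a * dlt n i) = alt n (\<lambda>i. a * int (n - 1 - i))"
    "alt n (\<lambda>i. a * (int (la i) + dlt n i)) = alt n (\<lambda>i. a * int (la i + (n - 1 - i)))"
    by (rule alt_cong; simp add: dlt_def of_nat_diff)+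
  show ?thesis
    unfolding 3 2 bialternant[of n "\<lambda>j. X j a" "\<lambda>i. la i + (n - 1 - i)"] 1 slaur_def ..
qed

subsection \<open>Walkers and alternants\<close>

text \<open>\<open>walks\<close> with arbitrary integer endpoints: steps to the left may lead below
  0, and the recursion on the first step needs such starting points.\<close>

definition gwalks :: "nat \<Rightarrow> nat \<Rightarrow> int list \<Rightarrow> int list \<Rightarrow> int list list set" where
  "gwalks q k x y = {w. length w = q + k + 1 \<and> w ! 0 = x \<and> w ! (q + k) = y
     \<and> (\<forall>c\<in>set w. sorted_wrt (<) c)
     \<and> (\<forall>m<q. right_step (w ! m) (w ! Suc m))
     \<and> (\<forall>m\<in>{q..<q + k}. left_step (w ! m) (w ! Suc m))}"

lemma ball_Suc_interval: "(\<forall>m\<in>{Suc a..<Suc b}. P m) \<longleftrightarrow> (\<forall>m\<in>{a..<b}. P (Suc m))"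
  unfolding image_Suc_atLeastLessThan[symmetric] by blast

lemma gwalks_0: "sorted_wrt (<) x \<Longrightarrow> gwalks 0 0 x y = (if x = y then {[x]} else {})"
  by (auto simp: gwalks_def length_Suc_conv)

lemma Cons_gwalks_right: "z # w \<in> gwalks (Suc q) k x y \<longleftrightarrow>
    z = x \<and> sorted_wrt (<) x \<and> right_step x (w ! 0) \<and> w \<in> gwalks q k (w ! 0) y"
  unfolding gwalks_def by (auto simp: All_less_Suc2 ball_Suc_interval)

lemma Cons_gwalks_left: "z # w \<in> gwalks 0 (Suc k) x y \<longleftrightarrow>
    z = x \<and> sorted_wrt (<) x \<and> left_step x (w ! 0) \<and> w \<in> gwalks 0 k (w ! 0) y"
proof -
  have "(\<forall>m\<in>{0..<Suc k}. P m) \<longleftrightarrow> P 0 \<and> (\<forall>m\<in>{0..<k}. P (Suc m))" for P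
    by (auto simp: less_Suc_eq_0_disj)
  then show ?thesis unfolding gwalks_def by auto
qed

lemma gwalks_nonempty: "w \<in> gwalks q k x y \<Longrightarrow> w = x # tl w" and gwalks_sorted: "w \<in> gwalks q k x y \<Longrightarrow> sorted_wrt (<) x"
  by (cases w; force simp: gwalks_def)+

lemma gwalks_Suc_right:
  assumes "sorted_wrt (<) x"
  shows "gwalks (Suc q) k x y = (\<Union>d\<in>{d. right_step x d \<and> sorted_wrt (<) d}. (#) x ` gwalks q k d y)"
proof (rule equalityI; rule subsetI)
  fix w assume w: "w \<in> gwalks (Suc q) k x y"
  then obtain v where v: "w = x # v" using gwalks_nonempty by blast
  then have "right_step x (v ! 0)" "v \<in> gwalks q k (v ! 0) y" using w by (auto simp: Cons_gwalks_right)
  then show "w \<in> (\<Union>d\<in>{d. right_step x d \<and> sorted_wrt (<) d}. (#) x ` gwalks q k d y)"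
    using v gwalks_sorted by blast
next
  fix w assume "w \<in> (\<Union>d\<in>{d. right_step x d \<and> sorted_wrt (<) d}. (#) x ` gwalks q k d y)"
  then obtain d v where "right_step x d" "v \<in> gwalks q k d y" "w = x # v" by blast
  then show "w \<in> gwalks (Suc q) k x y"
    using assms by (auto simp: Cons_gwalks_right) (simp_all add: gwalks_def)
qed

lemma gwalks_Suc_left:
  assumes "sorted_wrt (<) x"
  shows "gwalks 0 (Suc k) x y = (\<Union>d\<in>{d. left_step x d \<and> sorted_wrt (<) d}. (#) x ` gwalks 0 k d y)"
proof (rule equalityI; rule subsetI)
  fix w assume w: "w \<in> gwalks 0 (Suc k) x y"
  then obtain v where v: "w = x # v" using gwalks_nonempty by blast
  then have "left_step x (v ! 0)" "v \<in> gwalks 0 k (v ! 0) y" using w by (auto simp: Cons_gwalks_left)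
  then show "w \<in> (\<Union>d\<in>{d. left_step x d \<and> sorted_wrt (<) d}. (#) x ` gwalks 0 k d y)"
    using v gwalks_sorted by blast
next
  fix w assume "w \<in> (\<Union>d\<in>{d. left_step x d \<and> sorted_wrt (<) d}. (#) x ` gwalks 0 k d y)"
  then obtain d v where "left_step x d" "v \<in> gwalks 0 k d y" "w = x # v" by blast
  then show "w \<in> gwalks 0 (Suc k) x y"
    using assms by (auto simp: Cons_gwalks_left) (simp_all add: gwalks_def)
qed

text \<open>The set \<open>B\<close> numbers the walkers from right to left, the order in which
  \<open>altl\<close> lists the exponents.\<close>

definition right_moves :: "int list \<Rightarrow> nat set \<Rightarrow> int list" where
  "right_moves x B = map (\<lambda>j. x ! j + of_bool (length x - 1 - j \<in> B)) [0..<length x]"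

lemma right_moves_nth:
  "i < length x \<Longrightarrow> right_moves x B ! (length x - Suc i) = x ! (length x - Suc i) + of_bool (i \<in> B)"
  by (simp add: right_moves_def)

lemma bij_betw_right_moves: "bij_betw (right_moves x) (Pow {..<length x}) {d. right_step x d}"
proof (rule bij_betw_byWitness[where f' = "\<lambda>d. {i. i < length x \<and> d ! (length x - Suc i) \<noteq> x ! (length x - Suc i)}"])
  show "\<forall>B\<in>Pow {..<length x}. {i. i < length x \<and> right_moves x B ! (length x - Suc i) \<noteq> x ! (length x - Suc i)} = B"
  proof
    fix B assume "B \<in> Pow {..<length x}"
    then have "i < length x \<and> right_moves x B ! (length x - Suc i) \<noteq> x ! (length x - Suc i) \<longleftrightarrow> i \<in> B" for i
      by (cases "i < length x") (auto simp: right_moves_nth)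
    then show "{i. i < length x \<and> right_moves x B ! (length x - Suc i) \<noteq> x ! (length x - Suc i)} = B"
      by simp
  qed
  show "\<forall>d\<in>{d. right_step x d}. right_moves x {i. i < length x \<and> d ! (length x - Suc i) \<noteq> x ! (length x - Suc i)} = d"
  proof
    fix d assume "d \<in> {d. right_step x d}"
    then have d: "length d = length x" "\<And>i. i < length x \<Longrightarrow> d ! i = x ! i \<or> d ! i = x ! i + 1"
      by (auto simp: right_step_def)
    show "right_moves x {i. i < length x \<and> d ! (length x - Suc i) \<noteq> x ! (length x - Suc i)} = d"
      by (rule nth_equalityI) (use d in \<open>force simp: right_moves_def\<close>)+
  qed
qed (auto simp: right_moves_def right_step_def)

lemma bij_betw_left_moves: "bij_betw (\<lambda>i. x[i := x ! i - 1]) {..<length x} {d. left_step x d}"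
  unfolding bij_betw_def
proof
  show "inj_on (\<lambda>i. x[i := x ! i - 1]) {..<length x}"
  proof (rule inj_onI)
    fix i j assume "i \<in> {..<length x}" "j \<in> {..<length x}" "x[i := x ! i - 1] = x[j := x ! j - 1]"
    from this(1) arg_cong[OF this(3), of "\<lambda>l. l ! i"] show "i = j" by (cases "i = j") auto
  qed
qed (auto simp: left_step_def)

text \<open>Read from right to left, an increasing configuration gives decreasing exponents, as
  orthogonality requires.\<close>

definition altl :: "int list \<Rightarrow> laurent" where
  "altl x = alt (length x) (\<lambda>i. x ! (length x - 1 - i))"

lemma altl_eq_0:
  assumes "i < j" "j < length x" "x ! i = x ! j"
  shows "altl x = 0"
  unfolding altl_def
  by (rule alt_eq_0[of "length x - 1 - i" _ "length x - 1 - j"]) (use assms in auto)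

lemma not_sorted_wrt_less:
  assumes "\<not> sorted_wrt (<) (d :: int list)"
  obtains i j where "i < j" "j < length d" "d ! j \<le> d ! i"
  using assms by (auto simp: sorted_wrt_iff_nth_less not_less)

text \<open>Walkers at distinct integer positions that move at most one unit to the right cannot
  exchange their order in one instant; if the order is lost, two of them collide and the alternant
  vanishes. The same holds when a single walker moves left.\<close>

lemma altl_right_step:
  assumes x: "sorted_wrt (<) x"
  shows "(\<Prod>i<length x. 1 + X i 1) * altl x = (\<Sum>d | right_step x d \<and> sorted_wrt (<) d. altl d)"
proof -
  have "(\<Prod>i<length x. 1 + X i 1) * altl x = (\<Sum>B\<in>Pow {..<length x}. altl (right_moves x B))"
    unfolding altl_def prod_1_add_X_mult_alt
    by (rule sum.cong) (auto simp: right_moves_def intro!: alt_cong)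
  also have "\<dots> = (\<Sum>d | right_step x d. altl d)"
    by (rule sum.reindex_bij_betw[OF bij_betw_right_moves])
  also have "\<dots> = (\<Sum>d | right_step x d \<and> sorted_wrt (<) d. altl d)"
  proof (rule sum.mono_neutral_right)
    show "finite {d. right_step x d}"
      using bij_betw_finite[OF bij_betw_right_moves[of x]] by simp
    show "\<forall>d\<in>{d. right_step x d} - {d. right_step x d \<and> sorted_wrt (<) d}. altl d = 0"
    proof
      fix d assume "d \<in> {d. right_step x d} - {d. right_step x d \<and> sorted_wrt (<) d}"
      then have d: "right_step x d" "\<not> sorted_wrt (<) d" by auto
      obtain i j where ij: "i < j" "j < length d" "d ! j \<le> d ! i" using d(2) by (rule not_sorted_wrt_less)
      have len: "length d = length x" using d(1) by (simp add: right_step_def)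
      have "x ! i < x ! j" using x ij len by (simp add: sorted_wrt_iff_nth_less)
      moreover have "d ! i \<le> x ! i + 1" "x ! j \<le> d ! j"
      proof -
        have "d ! l = x ! l \<or> d ! l = x ! l + 1" if "l < length x" for l
          using d(1) that by (simp add: right_step_def)
        from this[of i] this[of j] show "d ! i \<le> x ! i + 1" "x ! j \<le> d ! j" using ij len by auto
      qed
      ultimately have "d ! i = d ! j" using ij by linarith
      then show "altl d = 0" by (rule altl_eq_0[OF ij(1,2)])
    qed
  qed auto
  finally show ?thesis .
qed

lemma altl_left_step:
  assumes x: "sorted_wrt (<) x"
  shows "psum (length x) (- 1) * altl x = (\<Sum>d | left_step x d \<and> sorted_wrt (<) d. altl d)"
proof -
  let ?n = "length x"
  have "psum ?n (- 1) * altl x = (\<Sum>i<?n. alt ?n ((\<lambda>i. x ! (?n - 1 - i))(i := x ! (?n - 1 - i) - 1)))"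
    unfolding altl_def psum_mult_alt by simp
  also have "\<dots> = (\<Sum>i<?n. altl (x[?n - 1 - i := x ! (?n - 1 - i) - 1]))"
    unfolding altl_def by (rule sum.cong) (auto simp: nth_list_update intro!: alt_cong)
  also have "\<dots> = (\<Sum>i<?n. altl (x[i := x ! i - 1]))"
    by (rule sum.reindex_bij_witness[of _ "\<lambda>i. ?n - 1 - i" "\<lambda>i. ?n - 1 - i"]) auto
  also have "\<dots> = (\<Sum>d | left_step x d. altl d)"
    by (rule sum.reindex_bij_betw[OF bij_betw_left_moves])
  also have "\<dots> = (\<Sum>d | left_step x d \<and> sorted_wrt (<) d. altl d)"
  proof (rule sum.mono_neutral_right)
    show "finite {d. left_step x d}"
      using bij_betw_finite[OF bij_betw_left_moves[of x]] by simp
    show "\<forall>d\<in>{d. left_step x d} - {d. left_step x d \<and> sorted_wrt (<) d}. altl d = 0"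
    proof
      fix d assume "d \<in> {d. left_step x d} - {d. left_step x d \<and> sorted_wrt (<) d}"
      then obtain l where d: "d = x[l := x ! l - 1]" "l < ?n" "\<not> sorted_wrt (<) d" by (auto simp: left_step_def)
      obtain i j where ij: "i < j" "j < length d" "d ! j \<le> d ! i" using d(3) by (rule not_sorted_wrt_less)
      have "x ! i < x ! j" using x ij d by (simp add: sorted_wrt_iff_nth_less)
      then have "d ! i = d ! j" using ij d(1,2) by (auto simp: nth_list_update split: if_splits)
      then show "altl d = 0" by (rule altl_eq_0[OF ij(1,2)])
    qed
  qed auto
  finally show ?thesis .
qed

lemma card_gwalks_step:
  assumes "finite D" "\<And>d. d \<in> D \<Longrightarrow> finite (gwalks q k d y)"
  shows "finite (\<Union>d\<in>D. (#) x ` gwalks q k d y) \<and> card (\<Union>d\<in>D. (#) x ` gwalks q k d y) = (\<Sum>d\<in>D. card (gwalks q k d y))"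
proof
  have "card (\<Union>d\<in>D. (#) x ` gwalks q k d y) = (\<Sum>d\<in>D. card ((#) x ` gwalks q k d y))"
    by (rule card_UN_disjoint) (use assms in \<open>auto simp: gwalks_def\<close>)
  also have "\<dots> = (\<Sum>d\<in>D. card (gwalks q k d y))"
    by (rule sum.cong) (auto intro!: card_image)
  finally show "card (\<Union>d\<in>D. (#) x ` gwalks q k d y) = (\<Sum>d\<in>D. card (gwalks q k d y))" .
qed (use assms in auto)

lemma sorted_altl_constant_term:
  assumes x: "sorted_wrt (<) x" "length x = n" and y: "sorted_wrt (<) y" "length y = n"
  shows "lookup (altl x * alt n (\<lambda>i. - (y ! (n - 1 - i)))) 0 = (if x = y then fact n else 0)"
proof -
  have "(\<forall>i<n. x ! (n - 1 - i) = y ! (n - 1 - i)) \<longleftrightarrow> x = y"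
  proof
    assume *: "\<forall>i<n. x ! (n - 1 - i) = y ! (n - 1 - i)"
    show "x = y"
    proof (rule nth_equalityI)
      fix i assume "i < length x"
      then show "x ! i = y ! i" using *[rule_format, of "n - 1 - i"] x(2) by simp
    qed (use x y in simp)
  qed simp
  moreover have dec: "z ! (n - 1 - i) > z ! (n - 1 - j)"
    if "sorted_wrt (<) z" "length z = n" "i < j" "j < n" for z :: "int list" and i j
    by (rule sorted_wrt_nth_less[OF that(1)]) (use that in auto)
  ultimately show ?thesis
    unfolding altl_def x(2)
    using lookup_0_alt_mult_alt[of n "\<lambda>i. x ! (n - 1 - i)" "\<lambda>i. y ! (n - 1 - i)", OF dec[OF x] dec[OF y]]
    by simp
qed

lemma lookup_sum_mult: "lookup ((\<Sum>d\<in>D. f d) * G) m = (\<Sum>d\<in>D. lookup (f d * G) m)"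
  by (simp add: sum_distrib_right lookup_sum)

text \<open>Each factor, absorbed into the alternant of the current configuration, spreads it over
  the possible next ones, and orthogonality tests the end point. The walk begins with its right
  steps, so the induction on q ends in a walk with left steps only.\<close>

theorem constant_term_walks:
  assumes y: "sorted_wrt (<) y" "length y = n"
  shows "sorted_wrt (<) x \<Longrightarrow> length x = n \<Longrightarrow> finite (gwalks q k x y) \<and>
    lookup (altl x * ((\<Prod>i<n. 1 + X i 1) ^ q * psum n (- 1) ^ k * alt n (\<lambda>i. - (y ! (n - 1 - i))))) 0
      = fact n * of_nat (card (gwalks q k x y))"
proof (induction q arbitrary: x)
  case 0
  then show ?case
  proof (induction k arbitrary: x)
    case 0
    then show ?case using sorted_altl_constant_term[OF 0 y] by (simp add: gwalks_0)
  next
    case (Suc k)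
    let ?D = "{d. left_step x d \<and> sorted_wrt (<) d}"
    let ?G = "psum n (- 1) ^ k * alt n (\<lambda>i. - (y ! (n - 1 - i)))"
    have fin: "finite ?D" using bij_betw_finite[OF bij_betw_left_moves[of x]] by simp
    have IH: "finite (gwalks 0 k d y) \<and> lookup (altl d * ?G) 0 = fact n * of_nat (card (gwalks 0 k d y))" if "d \<in> ?D" for d
      using Suc.IH[of d] that Suc.prems by (auto simp: left_step_def)
    have "altl x * (psum n (- 1) ^ Suc k * alt n (\<lambda>i. - (y ! (n - 1 - i)))) = (psum n (- 1) * altl x) * ?G"
      by (simp add: mult_ac)
    also have "\<dots> = (\<Sum>d\<in>?D. altl d) * ?G"
      using altl_left_step[OF Suc.prems(1)] Suc.prems(2) by simp
    finally have "lookup (altl x * (psum n (- 1) ^ Suc k * alt n (\<lambda>i. - (y ! (n - 1 - i))))) 0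
       = (\<Sum>d\<in>?D. lookup (altl d * ?G) 0)" by (simp only: lookup_sum_mult)
    also have "\<dots> = (\<Sum>d\<in>?D. fact n * of_nat (card (gwalks 0 k d y)))"
      by (rule sum.cong[OF refl]) (rule conjunct2[OF IH])
    finally show ?case
      unfolding gwalks_Suc_left[OF Suc.prems(1)]
      using card_gwalks_step[OF fin conjunct1[OF IH], of x] by (simp add: sum_distrib_left)
  qed
next
  case (Suc q)
  let ?D = "{d. right_step x d \<and> sorted_wrt (<) d}"
  let ?G = "(\<Prod>i<n. 1 + X i 1) ^ q * psum n (- 1) ^ k * alt n (\<lambda>i. - (y ! (n - 1 - i)))"
  have fin: "finite ?D" using bij_betw_finite[OF bij_betw_right_moves[of x]] by simp
  have IH: "finite (gwalks q k d y) \<and> lookup (altl d * ?G) 0 = fact n * of_nat (card (gwalks q k d y))" if "d \<in> ?D" for d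
    using Suc.IH[of d] that Suc.prems by (auto simp: right_step_def)
  have "altl x * ((\<Prod>i<n. 1 + X i 1) ^ Suc q * psum n (- 1) ^ k * alt n (\<lambda>i. - (y ! (n - 1 - i))))
      = ((\<Prod>i<n. 1 + X i 1) * altl x) * ?G"
    by (simp add: mult_ac)
  also have "\<dots> = (\<Sum>d\<in>?D. altl d) * ?G"
    using altl_right_step[OF Suc.prems(1)] Suc.prems(2) by simp
  finally have "lookup (altl x * ((\<Prod>i<n. 1 + X i 1) ^ Suc q * psum n (- 1) ^ k * alt n (\<lambda>i. - (y ! (n - 1 - i))))) 0
     = (\<Sum>d\<in>?D. lookup (altl d * ?G) 0)" by (simp only: lookup_sum_mult)
  also have "\<dots> = (\<Sum>d\<in>?D. fact n * of_nat (card (gwalks q k d y)))"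
    by (rule sum.cong[OF refl]) (rule conjunct2[OF IH])
  finally show ?case
    unfolding gwalks_Suc_right[OF Suc.prems(1)]
    using card_gwalks_step[OF fin conjunct1[OF IH], of x] by (simp add: sum_distrib_left)
qed

subsection \<open>Counting moves\<close>

text \<open>In a right step the number of moves equals the total displacement; in a left step one
  move goes with the displacement -1, a discrepancy of 2. The displacements telescope.\<close>

lemma effective_moves_eq:
  assumes w: "w \<in> gwalks q k x y"
  shows "int (effective_moves w) = 2 * int k + (\<Sum>i<length x. y ! i - x ! i)"
proof -
  let ?n = "length x"
  define c where "c m = card {i. i < ?n \<and> w ! Suc m ! i \<noteq> w ! m ! i}" for m
  define D where "D m = (\<Sum>i<?n. w ! Suc m ! i - w ! m ! i)" for m
  have lw: "length w = Suc (q + k)" and w0: "w ! 0 = x" and wy: "w ! (q + k) = y"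
    and R: "\<And>m. m < q \<Longrightarrow> right_step (w ! m) (w ! Suc m)"
    and L: "\<And>m. q \<le> m \<Longrightarrow> m < q + k \<Longrightarrow> left_step (w ! m) (w ! Suc m)"
    using w by (auto simp: gwalks_def)
  have len: "length (w ! m) = ?n" if "m \<le> q + k" for m
    using that
  proof (induction m)
    case (Suc m)
    have "right_step (w ! m) (w ! Suc m) \<or> left_step (w ! m) (w ! Suc m)"
      using R[of m] L[of m] Suc.prems by (cases "m < q") auto
    then show ?case using Suc by (auto simp: right_step_def left_step_def)
  qed (simp add: w0)
  have right: "int (c m) = D m" if "m < q" for m
  proof -
    have st: "w ! Suc m ! i = w ! m ! i \<or> w ! Suc m ! i = w ! m ! i + 1" if "i < ?n" for i
      using R[OF \<open>m < q\<close>] \<open>m < q\<close> that len[of m] by (simp add: right_step_def)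
    have "D m = (\<Sum>i<?n. if w ! Suc m ! i \<noteq> w ! m ! i then 1 else 0)"
      unfolding D_def
    proof (rule sum.cong[OF refl])
      fix i assume "i \<in> {..<?n}"
      then show "w ! Suc m ! i - w ! m ! i = (if w ! Suc m ! i \<noteq> w ! m ! i then 1 else 0)"
        using st[of i] by auto
    qed
    also have "\<dots> = (\<Sum>i\<in>{i. i < ?n \<and> w ! Suc m ! i \<noteq> w ! m ! i}. 1)"
      by (rule sum.mono_neutral_cong_right) auto
    finally show ?thesis by (simp add: c_def)
  qed
  have left: "int (c m) = 2 + D m" if m: "q \<le> m" "m < q + k" for m
  proof -
    have "left_step (w ! m) (w ! Suc m)" using m by (rule L)
    then obtain l where l: "l < ?n" "w ! Suc m = (w ! m)[l := w ! m ! l - 1]"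
      using len[of m] m by (auto simp: left_step_def)
    have "{i. i < ?n \<and> w ! Suc m ! i \<noteq> w ! m ! i} = {l}"
      using l len[of m] m by (auto simp: nth_list_update)
    moreover have "D m = (\<Sum>i<?n. if i = l then - 1 else 0)"
      unfolding D_def by (rule sum.cong) (use l len[of m] m in \<open>auto simp: nth_list_update\<close>)
    ultimately show ?thesis using l(1) by (simp add: c_def sum.delta)
  qed
  have "{(m, i). Suc m < length w \<and> i < length (w ! m) \<and> w ! Suc m ! i \<noteq> w ! m ! i}
      = (SIGMA m:{..<q + k}. {i. i < ?n \<and> w ! Suc m ! i \<noteq> w ! m ! i})"
    using len by (auto simp: lw)
  then have "effective_moves w = (\<Sum>m<q + k. c m)"
    by (simp add: effective_moves_def c_def)
  then have "int (effective_moves w) = (\<Sum>m<q + k. int (c m))"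
    by (simp only: of_nat_sum)
  also have "\<dots> = (\<Sum>m<q + k. (if m < q then 0 else 2) + D m)"
  proof (rule sum.cong[OF refl])
    fix m assume "m \<in> {..<q + k}"
    then show "int (c m) = (if m < q then 0 else 2) + D m"
      using right[of m] left[of m] by (cases "m < q") simp_all
  qed
  also have "\<dots> = (\<Sum>m<q + k. if m < q then 0 else 2) + (\<Sum>m<q + k. D m)"
    by (rule sum.distrib)
  also have "(\<Sum>m<q + k. if m < q then 0 else 2 :: int) = (\<Sum>m\<in>{q..<q + k}. 2)"
    by (rule sum.mono_neutral_cong_right) auto
  also have "(\<Sum>m<q + k. D m) = (\<Sum>i<?n. \<Sum>m<q + k. w ! Suc m ! i - w ! m ! i)"
    unfolding D_def by (rule sum.swap)
  also have "\<dots> = (\<Sum>i<?n. y ! i - x ! i)"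
  proof (rule sum.cong[OF refl])
    fix i show "(\<Sum>m<q + k. w ! Suc m ! i - w ! m ! i) = y ! i - x ! i"
      using sum_lessThan_telescope[of "\<lambda>m. w ! m ! i" "q + k"] by (simp add: w0 wy)
  qed
  finally show ?thesis by simp
qed

subsection \<open>Linear forms and their exponentials\<close>

text \<open>The linear form \<Sum> c_v v, possibly with infinitely many terms. The sum over the keys
  of \<open>m\<close> only finds the variable to which the monomial is equal, if there is
  one.\<close>

definition mlin :: "('v \<Rightarrow> complex) \<Rightarrow> 'v mfps" where
  "mlin c = Abs_mfps (\<lambda>m. \<Sum>v\<in>keys m. if m = single v 1 then c v else 0)"

lemma mcoeff_mlin_single: "mcoeff (mlin c) (single v (Suc 0)) = c v"
  by (simp add: mlin_def)

lemma mcoeff_mlin_eq_0: "(\<And>v. m \<noteq> single v 1) \<Longrightarrow> mcoeff (mlin c) m = 0"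
  by (simp add: mlin_def)

lemma mlin_add: "mlin c + mlin d = mlin (\<lambda>v. c v + d v)"
proof (rule mfps_eqI)
  fix m
  show "mcoeff (mlin c + mlin d) m = mcoeff (mlin (\<lambda>v. c v + d v)) m"
    unfolding mcoeff_add mlin_def mcoeff_Abs sum.distrib[symmetric] by (rule sum.cong) simp_all
qed

lemma single_plus_diff:
  assumes "v \<in> keys m"
  shows "single v 1 + (m - single v 1) = (m :: 'v \<Rightarrow>\<^sub>0 nat)"
  using assms by (intro poly_mapping_eqI) (auto simp: lookup_add lookup_minus lookup_single when_def in_keys_iff)

lemma single_1_eq_iff [simp]: "single u (Suc 0) = single v (Suc 0) \<longleftrightarrow> u = v"
proof
  assume "single u (Suc 0) = single v (Suc 0)"
  then have "lookup (single u (Suc 0)) u = lookup (single v (Suc 0)) u" by (rule arg_cong)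
  then show "u = v" by (simp add: lookup_single when_def split: if_splits)
qed simp

lemma mcoeff_mlin_mult:
  "mcoeff (mlin c * G) m = (\<Sum>v\<in>keys m. c v * mcoeff G (m - single v 1))"
proof -
  let ?h = "\<lambda>v. (single v (1::nat), m - single v 1)"
  have inj: "inj_on ?h (keys m)"
    by (rule inj_onI) simp
  have "mcoeff (mlin c * G) m = (\<Sum>(a, b)\<in>?h ` keys m. mcoeff (mlin c) a * mcoeff G b)"
    unfolding mcoeff_mult
  proof (rule sum.mono_neutral_right)
    show "?h ` keys m \<subseteq> splits m" using single_plus_diff by (auto simp: splits_def)
    show "\<forall>i\<in>splits m - ?h ` keys m. (case i of (a, b) \<Rightarrow> mcoeff (mlin c) a * mcoeff G b) = 0"
    proof
      fix i assume i: "i \<in> splits m - ?h ` keys m"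
      obtain a b where ab: "i = (a, b)" by (cases i)
      have sum: "a + b = m" using i ab by (simp add: splits_def)
      have "a \<noteq> single v 1" for v
      proof
        assume a: "a = single v 1"
        then have "v \<in> keys m" using sum by (auto simp: in_keys_iff lookup_add)
        moreover have "b = m - single v 1" using a sum by auto
        ultimately have "i \<in> ?h ` keys m" unfolding ab a by (intro image_eqI[of _ _ v]) simp_all
        then show False using i by blast
      qed
      then show "(case i of (a, b) \<Rightarrow> mcoeff (mlin c) a * mcoeff G b) = 0"
        by (simp add: ab mcoeff_mlin_eq_0)
    qed
  qed simp
  also have "\<dots> = (\<Sum>v\<in>keys m. c v * mcoeff G (m - single v 1))"
    unfolding sum.reindex[OF inj] o_def case_prod_conv by (simp add: mcoeff_mlin_single)
  finally show ?thesis .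
qed

text \<open>The coefficient of \<open>m\<close> in the exponential of the linear form \<Sum> c_v
  v.\<close>

definition ecoef :: "('v \<Rightarrow> complex) \<Rightarrow> ('v \<Rightarrow>\<^sub>0 nat) \<Rightarrow> complex" where
  "ecoef c m = (\<Prod>v\<in>keys m. c v ^ lookup m v / fact (lookup m v))"

definition wt :: "('v \<Rightarrow> nat) \<Rightarrow> ('v \<Rightarrow>\<^sub>0 nat) \<Rightarrow> nat" where
  "wt w m = (\<Sum>v\<in>keys m. lookup m v * w v)"

lemma ecoef_superset: "finite K \<Longrightarrow> keys m \<subseteq> K \<Longrightarrow> ecoef c m = (\<Prod>v\<in>K. c v ^ lookup m v / fact (lookup m v))"
  unfolding ecoef_def by (rule prod.mono_neutral_left) (auto simp: in_keys_iff)

lemma wt_superset: "finite K \<Longrightarrow> keys m \<subseteq> K \<Longrightarrow> wt w m = (\<Sum>v\<in>K. lookup m v * w v)"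
  unfolding wt_def by (rule sum.mono_neutral_left) (auto simp: in_keys_iff)

lemma wt_add: "wt w (a + b) = wt w a + wt w b"
proof -
  let ?K = "keys a \<union> keys b"
  have "wt w (a + b) = (\<Sum>v\<in>?K. lookup (a + b) v * w v)"
    by (rule wt_superset) (auto simp: in_keys_iff lookup_add)
  also have "\<dots> = (\<Sum>v\<in>?K. lookup a v * w v) + (\<Sum>v\<in>?K. lookup b v * w v)"
    by (simp add: lookup_add distrib_right sum.distrib)
  also have "\<dots> = wt w a + wt w b"
    by (simp add: wt_superset[of ?K])
  finally show ?thesis .
qed

lemma wt_single: "wt w (single v k) = k * w v"
  by (simp add: wt_superset[of "{v}"])

lemma mdegree_single: "mdegree (single v k) = k"
  by (simp add: mdegree_superset[of "{v}"])

lemma ecoef_diff_single: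
  assumes v: "v \<in> keys m"
  shows "c v * ecoef c (m - single v 1) = of_nat (lookup m v) * ecoef c m"
proof -
  obtain k where k: "lookup m v = Suc k" using v by (cases "lookup m v") (auto simp: in_keys_iff)
  have sub: "keys (m - single v 1) \<subseteq> keys m"
    by (auto simp: in_keys_iff lookup_minus)
  have "ecoef c (m - single v 1)
      = c v ^ k / fact k * (\<Prod>u\<in>keys m - {v}. c u ^ lookup (m - single v 1) u / fact (lookup (m - single v 1) u))"
    unfolding ecoef_superset[OF finite_keys sub] by (subst prod.remove[OF finite_keys v]) (simp add: lookup_minus k)
  also have "(\<Prod>u\<in>keys m - {v}. c u ^ lookup (m - single v 1) u / fact (lookup (m - single v 1) u))
      = (\<Prod>u\<in>keys m - {v}. c u ^ lookup m u / fact (lookup m u))"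
    by (rule prod.cong) (auto simp: lookup_minus lookup_single when_def)
  finally have 1: "ecoef c (m - single v 1) = c v ^ k / fact k * (\<Prod>u\<in>keys m - {v}. c u ^ lookup m u / fact (lookup m u))" .
  have "ecoef c m = c v ^ Suc k / fact (Suc k) * (\<Prod>u\<in>keys m - {v}. c u ^ lookup m u / fact (lookup m u))"
    unfolding ecoef_def by (subst prod.remove[OF finite_keys v]) (simp add: k)
  then show ?thesis unfolding 1 k by (simp add: field_simps del: of_nat_Suc)
qed

lemma mcoeff_sum: "mcoeff (\<Sum>i\<in>A. f i) m = (\<Sum>i\<in>A. mcoeff (f i) m)"
  by (induction A rule: infinite_finite_induct) auto

text \<open>
  The coefficients of the powers of \<open>\<Sum> c\<^sub>v v z\<^sup>w\<^sup>(\<^sup>v\<^sup>)\<close>; the weight \<open>w = 0\<close> gives powers of a single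
  linear form, the weight of the power sums gives the elementary Schur polynomials.
\<close>
lemma mcoeff_power_graded:
  fixes c :: "'v \<Rightarrow> complex" and w :: "'v \<Rightarrow> nat"
  defines "b \<equiv> Abs_fps (\<lambda>i. mlin (\<lambda>v. if w v = i then c v else 0))"
  shows "mcoeff (fps_nth (b ^ j) k) m = (if mdegree m = j \<and> wt w m = k then fact j * ecoef c m else 0)"
proof (induction j arbitrary: k m)
  case 0
  show ?case using mdegree_eq_0[of m]
    by (auto simp: mcoeff_1 mdegree_def wt_def ecoef_def)
next
  case (Suc j)
  have "mcoeff (fps_nth (b ^ Suc j) k) m
      = (\<Sum>i=0..k. \<Sum>v\<in>keys m. (if w v = i then c v else 0) * mcoeff (fps_nth (b ^ j) (k - i)) (m - single v 1))"
    by (simp add: fps_mult_nth mcoeff_sum b_def mcoeff_mlin_mult)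
  also have "\<dots> = (\<Sum>v\<in>keys m. \<Sum>i=0..k. (if w v = i then c v else 0) * mcoeff (fps_nth (b ^ j) (k - i)) (m - single v 1))"
    by (rule sum.swap)
  also have "\<dots> = (\<Sum>v\<in>keys m. if mdegree m = Suc j \<and> wt w m = k then of_nat (lookup m v) * (fact j * ecoef c m) else 0)"
  proof (rule sum.cong[OF refl])
    fix v assume v: "v \<in> keys m"
    have m: "single v 1 + (m - single v 1) = m" by (rule single_plus_diff[OF v])
    have d: "mdegree m = Suc (mdegree (m - single v 1))"
      using mdegree_add[of "single v 1" "m - single v 1"] by (simp only: m mdegree_single)
    have wm: "wt w m = w v + wt w (m - single v 1)"
      using wt_add[of w "single v 1" "m - single v 1"] by (simp only: m wt_single mult_1)
    have "(\<Sum>i=0..k. (if w v = i then c v else 0) * mcoeff (fps_nth (b ^ j) (k - i)) (m - single v 1))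
        = (\<Sum>i=0..k. if w v = i then c v * mcoeff (fps_nth (b ^ j) (k - i)) (m - single v 1) else 0)"
      by (rule sum.cong) auto
    also have "\<dots> = (if w v \<le> k then c v * mcoeff (fps_nth (b ^ j) (k - w v)) (m - single v 1) else 0)"
      by (simp add: sum.delta)
    also have "\<dots> = (if mdegree m = Suc j \<and> wt w m = k then of_nat (lookup m v) * (fact j * ecoef c m) else 0)"
      unfolding Suc.IH d wm using ecoef_diff_single[OF v, of c] by (auto simp: mult.left_commute)
    finally show "(\<Sum>i=0..k. (if w v = i then c v else 0) * mcoeff (fps_nth (b ^ j) (k - i)) (m - single v 1))
       = (if mdegree m = Suc j \<and> wt w m = k then of_nat (lookup m v) * (fact j * ecoef c m) else 0)" .
  qed
  also have "\<dots> = (if mdegree m = Suc j \<and> wt w m = k then of_nat (mdegree m) * (fact j * ecoef c m) else 0)"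
  proof -
    have e: "of_nat (mdegree m) = (\<Sum>v\<in>keys m. of_nat (lookup m v) :: complex)"
      by (simp add: mdegree_def)
    have "(\<Sum>v\<in>keys m. if P then of_nat (lookup m v) * K else 0) = (if P then of_nat (mdegree m) * K else 0)"
      for P and K :: complex
      unfolding e by (cases P) (simp_all add: sum_distrib_right)
    then show ?thesis .
  qed
  also have "\<dots> = (if mdegree m = Suc j \<and> wt w m = k then fact (Suc j) * ecoef c m else 0)"
    by (auto simp: mult.assoc)
  finally show ?case .
qed

lemma mcoeff_mlin_power: "mcoeff (mlin c ^ j) m = (if mdegree m = j then fact j * ecoef c m else 0)"
proof -
  have "Abs_fps (\<lambda>i. mlin (\<lambda>v. if (0::nat) = i then c v else 0)) = fps_const (mlin c)"
  proof (rule fps_ext)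
    fix i
    have "mlin (\<lambda>v. 0) = (0 :: 'a mfps)" by (rule mfps_eqI) (simp add: mlin_def)
    then show "fps_nth (Abs_fps (\<lambda>i. mlin (\<lambda>v. if 0 = i then c v else 0))) i = fps_nth (fps_const (mlin c)) i"
      by (cases "i = 0") auto
  qed
  then show ?thesis
    using mcoeff_power_graded[of "\<lambda>_. 0" c j 0 m] by (simp add: fps_const_power wt_def)
qed

lemma mcoeff_exp_mlin: "mcoeff (mfps_exp (mlin c)) m = ecoef c m"
proof -
  have *: "mcoeff ((1 / fact j) *\<^sub>R mlin c ^ j) m = (if j = mdegree m then ecoef c m else 0)" for j
    by (auto simp: mcoeff_mlin_power scaleR_conv_of_real[where 'a = complex])
  have "mcoeff (mfps_exp (mlin c)) m = (\<Sum>j | (if j = mdegree m then ecoef c m else 0) \<noteq> 0. if j = mdegree m then ecoef c m else 0)"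
    unfolding mfps_exp_def mfps_infsum_def by (simp only: mcoeff_Abs * UNIV_I simp_thms)
  also have "\<dots> = (\<Sum>j\<in>{mdegree m}. if j = mdegree m then ecoef c m else 0)"
    by (rule sum.mono_neutral_left) auto
  finally show ?thesis by simp
qed

text \<open>The law exp(f + g) = exp f exp g for linear forms, one monomial at a time: only the
  power whose exponent is the degree of \<open>m\<close> contributes, and there it is the binomial
  theorem.\<close>

lemma ecoef_add: "ecoef (\<lambda>v. c v + d v) m = (\<Sum>(a, b)\<in>splits m. ecoef c a * ecoef d b)"
proof -
  let ?j = "mdegree m"
  have "fact ?j * ecoef (\<lambda>v. c v + d v) m = mcoeff ((mlin c + mlin d) ^ ?j) m"
    by (simp add: mlin_add mcoeff_mlin_power)
  also have "\<dots> = (\<Sum>i\<le>?j. \<Sum>(a, b)\<in>splits m. of_nat (?j choose i) * mcoeff (mlin c ^ i) a * mcoeff (mlin d ^ (?j - i)) b)"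
  proof -
    have "mcoeff (of_nat u * f) m = of_nat u * mcoeff f m" for u :: nat and f :: "'a mfps"
      by (induction u) (simp_all add: distrib_right)
    then show ?thesis
      unfolding binomial_ring mcoeff_sum mult.assoc
      by (intro sum.cong refl) (simp only:, simp add: mcoeff_mult sum_distrib_left case_prod_unfold)
  qed
  also have "\<dots> = (\<Sum>(a, b)\<in>splits m. \<Sum>i\<le>?j. of_nat (?j choose i) * mcoeff (mlin c ^ i) a * mcoeff (mlin d ^ (?j - i)) b)"
    unfolding case_prod_unfold by (rule sum.swap)
  also have "\<dots> = (\<Sum>(a, b)\<in>splits m. fact ?j * (ecoef c a * ecoef d b))"
  proof (rule sum.cong[OF refl], clarify)
    fix a b assume "(a, b) \<in> splits m"
    then have j: "?j = mdegree a + mdegree b" by (auto simp: splits_def mdegree_add)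
    have "(\<Sum>i\<le>?j. of_nat (?j choose i) * mcoeff (mlin c ^ i) a * mcoeff (mlin d ^ (?j - i)) b)
        = (\<Sum>i\<in>{mdegree a}. of_nat (?j choose i) * mcoeff (mlin c ^ i) a * mcoeff (mlin d ^ (?j - i)) b)"
      by (rule sum.mono_neutral_right) (auto simp: mcoeff_mlin_power j)
    also have "\<dots> = fact ?j * (ecoef c a * ecoef d b)"
      using binomial_fact_lemma[of "mdegree a" ?j]
      by (simp add: mcoeff_mlin_power j mult_ac) (metis (no_types, lifting) mult.commute mult.left_commute of_nat_fact of_nat_mult)
    finally show "(\<Sum>i\<le>?j. of_nat (?j choose i) * mcoeff (mlin c ^ i) a * mcoeff (mlin d ^ (?j - i)) b)
        = fact ?j * (ecoef c a * ecoef d b)" .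
  qed
  also have "\<dots> = fact ?j * (\<Sum>(a, b)\<in>splits m. ecoef c a * ecoef d b)"
    by (simp add: sum_distrib_left case_prod_unfold)
  finally show ?thesis by simp
qed

lemma exp_mlin_add: "mfps_exp (mlin (\<lambda>v. c v + d v)) = mfps_exp (mlin c) * mfps_exp (mlin d)"
  by (rule mfps_eqI) (simp add: mcoeff_exp_mlin mcoeff_mult ecoef_add)

lemma exp_mlin_sum:
  fixes n :: nat
  shows "mfps_exp (mlin (\<lambda>v. \<Sum>j<n. c j v)) = (\<Prod>j<n. mfps_exp (mlin (c j)))"
proof (induction n)
  case 0
  show ?case
  proof (rule mfps_eqI)
    fix m :: "'a \<Rightarrow>\<^sub>0 nat"
    show "mcoeff (mfps_exp (mlin (\<lambda>v. \<Sum>j<0. c j v))) m = mcoeff (\<Prod>j<0. mfps_exp (mlin (c j))) m"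
    proof (cases "m = 0")
      case False
      then obtain v where "v \<in> keys m" using keys_eq_empty[of m] by blast
      then have "ecoef (\<lambda>v. 0) m = 0"
        unfolding ecoef_def by (intro prod_zero) (auto simp: in_keys_iff intro!: bexI[of _ v])
      then show ?thesis using False by (simp add: mcoeff_exp_mlin mcoeff_1)
    qed (simp add: mcoeff_exp_mlin mcoeff_1 ecoef_def)
  qed
qed (simp add: exp_mlin_add)

text \<open>The k-th elementary Schur polynomial is the part of weight k of exp(\<Sum> t_i), where
  the variable v belongs to t_i for i = w v.\<close>

lemma mcoeff_elem_schur:
  fixes c :: "'v \<Rightarrow> complex" and w :: "'v \<Rightarrow> nat"
  assumes t: "\<And>i. i > 0 \<Longrightarrow> t i = mlin (\<lambda>v. if w v = i then c v else 0)"
    and c: "\<And>v. w v = 0 \<Longrightarrow> c v = 0"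
  shows "mcoeff (elem_schur t k) m = (if int (wt w m) = k then ecoef c m else 0)"
proof (cases "k < 0")
  case False
  define b where "b = Abs_fps (\<lambda>i. mlin (\<lambda>v. if w v = i then c v else 0))"
  have z: "mlin (\<lambda>v. if w v = 0 then c v else 0) = 0"
    by (rule mfps_eqI) (auto simp: mlin_def c intro!: sum.neutral)
  have b: "Abs_fps (\<lambda>i. if i = 0 then 0 else t i) = b"
    by (rule fps_ext) (simp add: b_def t z)
  \<comment> \<open>The variables that occur have weight at least 1, so the powers beyond the k-th,
    which a composition of series omits at index k, would contribute nothing.\<close>
  have deg: "mdegree m \<le> wt w m" if "ecoef c m \<noteq> 0"
  proof -
    have "lookup m v \<le> lookup m v * w v" if "v \<in> keys m" for v
    proof -
      have "c v \<noteq> 0"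
        using \<open>ecoef c m \<noteq> 0\<close> that by (auto simp: ecoef_def in_keys_iff)
      then show ?thesis using c[of v] by (cases "w v") auto
    qed
    then show ?thesis unfolding mdegree_def wt_def by (rule sum_mono)
  qed
  have "mcoeff (elem_schur t k) m = (\<Sum>j=0..nat k. mcoeff (of_real (1 / fact j) * fps_nth (b ^ j) (nat k)) m)"
    using False by (simp add: elem_schur_def b fps_compose_nth mcoeff_sum)
  also have "\<dots> = (\<Sum>j=0..nat k. if j = mdegree m \<and> wt w m = nat k then ecoef c m else 0)"
  proof (rule sum.cong[OF refl])
    fix j
    have "mcoeff (of_real (1 / fact j) * fps_nth (b ^ j) (nat k)) m = (1 / fact j) *\<^sub>R mcoeff (fps_nth (b ^ j) (nat k)) m"
      by (simp flip: scaleR_conv_of_real)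
    then show "mcoeff (of_real (1 / fact j) * fps_nth (b ^ j) (nat k)) m
        = (if j = mdegree m \<and> wt w m = nat k then ecoef c m else 0)"
      unfolding b_def mcoeff_power_graded by (auto simp: scaleR_conv_of_real[where 'a = complex])
  qed
  also have "\<dots> = (if int (wt w m) = k then ecoef c m else 0)"
  proof (cases "wt w m = nat k \<and> ecoef c m \<noteq> 0")
    case True
    then have "mdegree m \<in> {0..nat k}" using deg by simp
    moreover have "int (wt w m) = k" using True False by simp
    ultimately show ?thesis using True by (simp add: sum.delta)
  next
    case no: False
    then show ?thesis using False by (auto intro!: sum.neutral)
  qed
  finally show ?thesis .
qed (simp add: elem_schur_def)

subsection \<open>Strictly decreasing rearrangements\<close>

definition shifted :: "nat \<Rightarrow> (nat \<Rightarrow> nat) \<Rightarrow> nat \<Rightarrow> nat" where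
  "shifted n la i = la i + (n - 1 - i)"

definition bounded_partitions :: "nat \<Rightarrow> nat \<Rightarrow> (nat \<Rightarrow> nat) set" where
  "bounded_partitions n N = {la \<in> partitions_rows_le n. la 0 \<le> N}"

lemma partitions_rows_le_eq_0:
  assumes "la \<in> partitions_rows_le n" "n \<le> i"
  shows "la i = 0"
  using assms partition_support[of la i] by (simp add: partitions_rows_le_def)

lemma partitions_rows_le_antimono: "la \<in> partitions_rows_le n \<Longrightarrow> i \<le> j \<Longrightarrow> la j \<le> la i"
  by (simp add: partitions_rows_le_def is_partition_def antimono_def)

lemma finite_bounded_partitions: "finite (bounded_partitions n N)"
proof -
  let ?r = "\<lambda>la :: nat \<Rightarrow> nat. restrict la {..<n}"
  have "?r ` bounded_partitions n N \<subseteq> {..<n} \<rightarrow>\<^sub>E {..N}"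
  proof (rule image_subsetI)
    fix la assume "la \<in> bounded_partitions n N"
    then have "la i \<le> N" for i
      using partitions_rows_le_antimono[of la n 0 i] by (simp add: bounded_partitions_def)
    then show "?r la \<in> {..<n} \<rightarrow>\<^sub>E {..N}" unfolding restrict_PiE_iff by simp
  qed
  then have "finite (?r ` bounded_partitions n N)"
    by (rule finite_subset) (auto intro: finite_PiE)
  moreover have "inj_on ?r (bounded_partitions n N)"
  proof (rule inj_onI)
    fix a b assume ab: "a \<in> bounded_partitions n N" "b \<in> bounded_partitions n N" "?r a = ?r b"
    show "a = b"
    proof
      fix i show "a i = b i"
        using fun_cong[OF ab(3), of i] ab(1,2) partitions_rows_le_eq_0[of a n i] partitions_rows_le_eq_0[of b n i]
        by (cases "i < n") (auto simp: bounded_partitions_def)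
    qed
  qed
  ultimately show ?thesis by (rule finite_imageD)
qed

lemma shifted_strict: "la \<in> partitions_rows_le n \<Longrightarrow> i < j \<Longrightarrow> j < n \<Longrightarrow> shifted n la j < shifted n la i"
  using partitions_rows_le_antimono[of la n i j] by (simp add: shifted_def)

lemma partition_of_decreasing:
  fixes g :: "nat \<Rightarrow> nat"
  assumes dec: "\<And>i j. i < j \<Longrightarrow> j < n \<Longrightarrow> g j < g i"
  shows "\<exists>la\<in>partitions_rows_le n. \<forall>i<n. shifted n la i = g i"
proof -
  define la where "la i = (if i < n then g i - (n - 1 - i) else 0)" for i
  \<comment> \<open>This makes the truncated subtraction in \<open>la\<close> exact.\<close>
  have ge: "n - 1 - i \<le> g i" if "i < n" for i
    using that
  proof (induction "n - 1 - i" arbitrary: i)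
    case (Suc d)
    then have "n - 1 - Suc i \<le> g (Suc i)" by (intro Suc.hyps(1)) auto
    moreover have "g (Suc i) < g i" using Suc by (intro dec) auto
    ultimately show ?case by linarith
  qed simp
  have "la (Suc i) \<le> la i" for i
    using dec[of i "Suc i"] by (cases "Suc i < n") (auto simp: la_def)
  then have "antimono la" by (rule decseq_SucI)
  moreover have sub: "{i. la i \<noteq> 0} \<subseteq> {..<n}" by (auto simp: la_def)
  ultimately have "la \<in> partitions_rows_le n"
    using finite_subset[OF sub] card_mono[OF _ sub]
    by (simp add: partitions_rows_le_def is_partition_def num_rows_def)
  moreover have "\<forall>i<n. shifted n la i = g i"
  proof (intro allI impI)
    fix i assume i: "i < n"
    show "shifted n la i = g i"
      unfolding shifted_def la_def if_P[OF i] using ge[OF i] by (rule le_add_diff_inverse2)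
  qed
  ultimately show ?thesis by blast
qed

lemma decreasing_rearrangement:
  fixes f :: "nat \<Rightarrow> nat"
  assumes inj: "inj_on f {..<n}"
  shows "\<exists>p g. p permutes {..<n} \<and> (\<forall>i<n. f i = g (p i)) \<and> (\<forall>i j. i < j \<longrightarrow> j < n \<longrightarrow> g j < g i)"
proof -
  define xs where "xs = rev (sorted_list_of_set (f ` {..<n}))"
  have len: "length xs = n" and set: "set xs = f ` {..<n}" and dist: "distinct xs"
    using card_image[OF inj] by (simp_all add: xs_def)
  have dec: "xs ! j < xs ! i" if "i < j" "j < n" for i j
  proof -
    have "sorted_wrt (>) xs"
      unfolding xs_def sorted_wrt_rev by simp
    then show ?thesis using that len by (intro sorted_wrt_nth_less) auto
  qed
  define p where "p i = (if i < n then THE k. k < n \<and> xs ! k = f i else i)" for i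
  have p: "p i < n \<and> xs ! p i = f i" if "i < n" for i
  proof -
    have "f i \<in> set xs" using that set by auto
    then obtain k where k: "k < n" "xs ! k = f i" using len by (auto simp: in_set_conv_nth)
    have "\<exists>!k. k < n \<and> xs ! k = f i"
    proof (rule ex1I[of _ k])
      fix l assume "l < n \<and> xs ! l = f i"
      then show "l = k" using k len nth_eq_iff_index_eq[OF dist, of l k] by simp
    qed (simp add: k)
    from theI'[OF this] show ?thesis using that by (simp add: p_def)
  qed
  have "p permutes {..<n}"
  proof (rule bij_imp_permutes)
    have "inj_on p {..<n}"
      by (rule inj_onI) (metis inj inj_onD lessThan_iff p)
    moreover have "p ` {..<n} \<subseteq> {..<n}" using p by auto
    ultimately show "bij_betw p {..<n} {..<n}" by (simp add: bij_betw_def endo_inj_surj)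
  qed (simp add: p_def)
  then show ?thesis using p dec by (intro exI[of _ p] exI[of _ "(!) xs"]) auto
qed

text \<open>An injective sequence is in exactly one way a decreasing sequence composed with a
  permutation, and decreasing sequences are partitions plus the staircase. The largest entry is la 0
  + n - 1, so the bound N + n corresponds to la 0 \<le> N.\<close>

lemma bij_betw_shifted:
  assumes n: "n > 0"
  shows "bij_betw (\<lambda>(la, p). restrict (\<lambda>i. shifted n la (p i)) {..<n})
    (bounded_partitions n N \<times> {p. p permutes {..<n}})
    {f \<in> {..<n} \<rightarrow>\<^sub>E {..<N + n}. inj_on f {..<n}}"
  unfolding bij_betw_def
proof
  let ?F = "\<lambda>(la, p). restrict (\<lambda>i. shifted n la (p i)) {..<n}"
  show "inj_on ?F (bounded_partitions n N \<times> {p. p permutes {..<n}})"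
  proof (rule inj_onI, clarify)
    fix a p b r
    assume ab: "a \<in> bounded_partitions n N" "b \<in> bounded_partitions n N"
      and pr: "p permutes {..<n}" "r permutes {..<n}"
      and eq: "restrict (\<lambda>i. shifted n a (p i)) {..<n} = restrict (\<lambda>i. shifted n b (r i)) {..<n}"
    have A: "a \<in> partitions_rows_le n" "b \<in> partitions_rows_le n" using ab by (auto simp: bounded_partitions_def)
    define s where "s = r \<circ> inv_into UNIV p"
    have s: "s permutes {..<n}" unfolding s_def by (intro permutes_compose permutes_inv pr)
    have sp: "s (p i) = r i" for i unfolding s_def using permutes_inverses(2)[OF pr(1)] by simp
    have as: "shifted n a j = shifted n b (s j)" if j: "j < n" for j
    proof -
      define i where "i = inv_into UNIV p j"
      have i: "p i = j" unfolding i_def by (rule permutes_inverses(1)[OF pr(1)])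
      then have "i < n" using permutes_in_image[OF pr(1), of i] j by simp
      then show ?thesis using fun_cong[OF eq, of i] sp[of i] i by simp
    qed
    have "s = id"
    proof (rule strict_mono_permutation_id[OF s])
      fix i j assume ij: "i < j" "j < n"
      have lt: "s i < n" "s j < n" using permutes_in_image[OF s] ij by auto
      have "shifted n b (s j) < shifted n b (s i)" using shifted_strict[OF A(1) ij] as ij by simp
      then show "s i < s j"
        using shifted_strict[OF A(2), of "s j" "s i"] lt by (cases "s i" "s j" rule: linorder_cases) auto
    qed
    moreover have "a = b"
    proof
      fix i show "a i = b i"
        using as[of i] \<open>s = id\<close> partitions_rows_le_eq_0[OF A(1), of i] partitions_rows_le_eq_0[OF A(2), of i]
        by (cases "i < n") (auto simp: shifted_def)
    qed
    ultimately show "a = b \<and> p = r" using sp by (auto simp: fun_eq_iff)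
  qed
  show "?F ` (bounded_partitions n N \<times> {p. p permutes {..<n}}) = {f \<in> {..<n} \<rightarrow>\<^sub>E {..<N + n}. inj_on f {..<n}}"
  proof (rule equalityI; rule subsetI)
    fix f assume "f \<in> ?F ` (bounded_partitions n N \<times> {p. p permutes {..<n}})"
    then obtain la p where la: "la \<in> bounded_partitions n N" and p: "p permutes {..<n}"
      and f: "f = restrict (\<lambda>i. shifted n la (p i)) {..<n}" by auto
    have A: "la \<in> partitions_rows_le n" "la 0 \<le> N" using la by (auto simp: bounded_partitions_def)
    have "shifted n la j < N + n" if "j < n" for j
      using partitions_rows_le_antimono[OF A(1), of 0 j] A(2) that by (simp add: shifted_def)
    then have "f \<in> {..<n} \<rightarrow>\<^sub>E {..<N + n}" using permutes_in_image[OF p] by (auto simp: f)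
    moreover have "inj_on f {..<n}"
    proof (rule inj_onI)
      fix i j assume ij: "i \<in> {..<n}" "j \<in> {..<n}" "f i = f j"
      have lt: "p i < n" "p j < n" using permutes_in_image[OF p] ij by auto
      have "shifted n la (p i) = shifted n la (p j)" using ij by (simp add: f)
      then have "p i = p j"
        using shifted_strict[OF A(1), of "p i" "p j"] shifted_strict[OF A(1), of "p j" "p i"] lt
        by (cases "p i" "p j" rule: linorder_cases) auto
      then show "i = j" using permutes_inj[OF p] by (simp add: inj_eq)
    qed
    ultimately show "f \<in> {f \<in> {..<n} \<rightarrow>\<^sub>E {..<N + n}. inj_on f {..<n}}" by simp
  next
    fix f assume f: "f \<in> {f \<in> {..<n} \<rightarrow>\<^sub>E {..<N + n}. inj_on f {..<n}}"
    obtain p g where p: "p permutes {..<n}" and fg: "\<forall>i<n. f i = g (p i)"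
      and dec: "\<And>i j. i < j \<Longrightarrow> j < n \<Longrightarrow> g j < g i"
      using decreasing_rearrangement[of f n] f by blast
    obtain la where la: "la \<in> partitions_rows_le n" "\<forall>i<n. shifted n la i = g i"
      using partition_of_decreasing[of n g] dec by blast
    have "la 0 \<le> N"
    proof -
      obtain i where i: "p i = 0" "i < n"
        using permutes_inverses(1)[OF p, of 0] permutes_in_image[OF p, of "inv_into UNIV p 0"] n by auto
      have "shifted n la 0 = f i" using la(2) fg i n by simp
      also have "f i < N + n" using f i by (auto simp: PiE_iff)
      finally show ?thesis using n by (simp add: shifted_def)
    qed
    then have "la \<in> bounded_partitions n N" using la by (simp add: bounded_partitions_def)
    moreover have "f = restrict (\<lambda>i. shifted n la (p i)) {..<n}"
    proof
      fix i show "f i = restrict (\<lambda>i. shifted n la (p i)) {..<n} i"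
      proof (cases "i < n")
        case True
        then have "p i < n" using permutes_in_image[OF p, of i] by simp
        then show ?thesis using True fg la(2) by simp
      next
        case False
        then show ?thesis using f by (auto simp: PiE_def extensional_def)
      qed
    qed
    ultimately show "f \<in> ?F ` (bounded_partitions n N \<times> {p. p permutes {..<n}})"
      using p by (intro image_eqI[of _ _ "(la, p)"]) auto
  qed
qed

subsection \<open>The Cauchy identity\<close>

lemma mcoeff_const_mult [simp]:
  fixes m :: "'v \<Rightarrow>\<^sub>0 nat"
  shows "mcoeff (mfps_const a * f) m = a * mcoeff f m"
proof -
  have "mcoeff (mfps_const a * f) m = (\<Sum>(u, v)\<in>{(0 :: 'v \<Rightarrow>\<^sub>0 nat, m)}. mcoeff (mfps_const a) u * mcoeff f v)"
    unfolding mcoeff_mult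
    by (rule sum.mono_neutral_right[OF finite_splits]) (auto simp: splits_def mfps_const_def split: if_splits)
  then show ?thesis by (simp add: mfps_const_def)
qed

lemma mfps_const_mult: "mfps_const (a * b) = mfps_const a * mfps_const b"
  by (rule mfps_eqI) (simp, simp add: mfps_const_def)

lemma mfps_const_1: "mfps_const 1 = 1"
  by (rule mfps_eqI) (simp add: mfps_const_def mcoeff_1)

lemma mfps_const_add: "mfps_const (a + b) = mfps_const a + mfps_const b"
  by (rule mfps_eqI) (simp add: mfps_const_def)

lemma mfps_const_0: "mfps_const 0 = 0"
  by (rule mfps_eqI) (simp add: mfps_const_def)

lemma mfps_const_sum: "mfps_const (\<Sum>i\<in>A. f i) = (\<Sum>i\<in>A. mfps_const (f i))"
  by (induction A rule: infinite_finite_induct) (auto simp: mfps_const_0 mfps_const_add)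

lemma mfps_const_prod: "mfps_const (\<Prod>i\<in>A. f i) = (\<Prod>i\<in>A. mfps_const (f i))"
  by (induction A rule: infinite_finite_induct) (auto simp: mfps_const_1 mfps_const_mult)

lemma mfps_const_of_int: "mfps_const (of_int k) = of_int k"
proof -
  have nat: "mfps_const (of_nat m) = of_nat m" for m
    by (induction m) (simp_all add: mfps_const_0 mfps_const_add mfps_const_1)
  have neg: "mfps_const (- a) = - mfps_const a" for a
    by (rule mfps_eqI) (simp add: mfps_const_def)
  show ?thesis by (cases k rule: int_cases2) (simp_all add: nat neg)
qed

text \<open>Equality modulo terms of weight above N. Weights add under multiplication, so the
  relation respects products and allows infinite series to be truncated inside a
  determinant.\<close>

definition agree :: "('v \<Rightarrow> nat) \<Rightarrow> nat \<Rightarrow> 'v mfps \<Rightarrow> 'v mfps \<Rightarrow> bool" where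
  "agree w N f g \<longleftrightarrow> (\<forall>m. wt w m \<le> N \<longrightarrow> mcoeff f m = mcoeff g m)"

lemma agree_mult:
  assumes "agree w N f f'" "agree w N g g'"
  shows "agree w N (f * g) (f' * g')"
  unfolding agree_def
proof (intro allI impI)
  fix m assume m: "wt w m \<le> N"
  show "mcoeff (f * g) m = mcoeff (f' * g') m"
    unfolding mcoeff_mult
  proof (rule sum.cong[OF refl], clarify)
    fix a b assume "(a, b) \<in> splits m"
    then have "wt w a + wt w b = wt w m" by (auto simp: splits_def wt_add)
    then show "mcoeff f a * mcoeff g b = mcoeff f' a * mcoeff g' b"
      using assms m by (simp add: agree_def)
  qed
qed

lemma agree_refl: "agree w N f f"
  by (simp add: agree_def)

lemma agree_prod: "(\<And>i. i \<in> A \<Longrightarrow> agree w N (f i) (g i)) \<Longrightarrow> agree w N (\<Prod>i\<in>A. f i) (\<Prod>i\<in>A. g i)"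
  by (induction A rule: infinite_finite_induct) (auto intro: agree_mult agree_refl)

lemma agree_sum: "(\<And>i. i \<in> A \<Longrightarrow> agree w N (f i) (g i)) \<Longrightarrow> agree w N (\<Sum>i\<in>A. f i) (\<Sum>i\<in>A. g i)"
  by (auto simp: agree_def mcoeff_sum)

definition homog :: "('v \<Rightarrow> nat) \<Rightarrow> int \<Rightarrow> 'v mfps \<Rightarrow> bool" where
  "homog w d f \<longleftrightarrow> (\<forall>m. mcoeff f m \<noteq> 0 \<longrightarrow> int (wt w m) = d)"

lemma homog_mult:
  assumes "homog w d f" "homog w e g"
  shows "homog w (d + e) (f * g)"
  unfolding homog_def
proof (intro allI impI)
  fix m assume "mcoeff (f * g) m \<noteq> 0"
  then obtain a b where ab: "(a, b) \<in> splits m" "mcoeff f a * mcoeff g b \<noteq> 0"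
    unfolding mcoeff_mult by (auto elim!: sum.not_neutral_contains_not_neutral)
  then have "wt w m = wt w a + wt w b" by (auto simp: splits_def wt_add)
  then show "int (wt w m) = d + e" using ab(2) assms by (auto simp: homog_def)
qed

lemma homog_1: "homog w 0 1"
  by (auto simp: homog_def mcoeff_1 wt_def split: if_splits)

lemma homog_prod: "(\<And>i. i < n \<Longrightarrow> homog w (d i) (f i)) \<Longrightarrow> homog w (\<Sum>i<n. d i) (\<Prod>i<n::nat. f i)"
  by (induction n) (auto intro: homog_mult homog_1)

lemma homog_sum: "(\<And>i. i \<in> A \<Longrightarrow> homog w d (f i)) \<Longrightarrow> homog w d (\<Sum>i\<in>A. f i)"
  unfolding homog_def mcoeff_sum by (metis sum.neutral)

lemma homog_of_int_mult: "homog w d f \<Longrightarrow> homog w d (of_int k * f)"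
  unfolding mfps_const_of_int[symmetric] homog_def by simp

lemma partitions_rows_leD: "la \<in> partitions_rows_le n \<Longrightarrow> is_partition la" "la \<in> partitions_rows_le n \<Longrightarrow> num_rows la \<le> n"
  by (auto simp: partitions_rows_le_def)

lemma schur_leibniz:
  assumes "la \<in> partitions_rows_le n"
  shows "schur t la = (\<Sum>p | p permutes {..<n}. of_int (sign p) *
    (\<Prod>i<n. elem_schur t (int (la (p i)) - int (p i) + int i)))"
  unfolding schur_larger_det[OF partitions_rows_leD[OF assms]]
  by (subst Determinant.det_col[of _ n])
    (auto intro!: sum.cong prod.cong simp: permutes_in_image atLeast0LessThan)

context
  fixes c :: "'v \<Rightarrow> complex" and w :: "'v \<Rightarrow> nat" and t :: "nat \<Rightarrow> 'v mfps"
  assumes t: "\<And>i. i > 0 \<Longrightarrow> t i = mlin (\<lambda>v. if w v = i then c v else 0)"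
    and c: "\<And>v. w v = 0 \<Longrightarrow> c v = 0"
begin

lemma mcoeff_elem_schur': "mcoeff (elem_schur t k) m = (if int (wt w m) = k then ecoef c m else 0)"
  by (rule mcoeff_elem_schur[OF t c])

lemma homog_schur:
  assumes la: "la \<in> partitions_rows_le n"
  shows "homog w (\<Sum>i<n. int (la i)) (schur t la)"
  unfolding schur_leibniz[OF la]
proof (intro homog_sum homog_of_int_mult)
  fix p assume "p \<in> {p. p permutes {..<n}}"
  then have p: "p permutes {..<n}" by simp
  have "homog w (\<Sum>i<n. int (la (p i)) - int (p i) + int i)
      (\<Prod>i<n. elem_schur t (int (la (p i)) - int (p i) + int i))"
    by (rule homog_prod) (simp add: homog_def mcoeff_elem_schur')
  also have "(\<Sum>i<n. int (la (p i)) - int (p i) + int i) = (\<Sum>i<n. int (la i))"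
    using sum.permute[OF p, of "\<lambda>i. int (la i) - int i"] by (simp add: o_def sum.distrib sum_subtractf)
  finally show "homog w (\<Sum>i<n. int (la i)) (\<Prod>i<n. elem_schur t (int (la (p i)) - int (p i) + int i))" .
qed

text \<open>A Schur function is homogeneous of weight \<Sum> la i, which bounds the first part.
  Hence only finitely many partitions meet a given monomial.\<close>

lemma mcoeff_schur_bounded:
  assumes la: "la \<in> partitions_rows_le n" and m: "mcoeff (schur t la) m \<noteq> 0" "wt w m \<le> N"
  shows "la \<in> bounded_partitions n N"
proof -
  have "int (wt w m) = (\<Sum>i<n. int (la i))" using homog_schur[OF la] m(1) by (simp add: homog_def)
  then have "(\<Sum>i<n. la i) \<le> N" using m(2) by (simp flip: of_nat_sum)
  moreover have "la 0 \<le> (\<Sum>i<n. la i)"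
    using partitions_rows_le_eq_0[OF la, of 0] by (cases "n = 0") (auto intro!: member_le_sum)
  ultimately show ?thesis using la by (simp add: bounded_partitions_def)
qed

definition vdet :: "nat \<Rightarrow> (nat \<Rightarrow> complex) \<Rightarrow> (nat \<Rightarrow> nat) \<Rightarrow> complex" where
  "vdet n y f = Determinant.det (Matrix.mat n n (\<lambda>(i, j). y j ^ f i))"

lemma vdet_leibniz: "vdet n y f = (\<Sum>p | p permutes {..<n}. of_int (sign p) * (\<Prod>i<n. y (p i) ^ f i))"
  unfolding vdet_def by (subst Determinant.det_def'[of _ n])
    (auto intro!: sum.cong prod.cong simp: permutes_in_image atLeast0LessThan)

lemma vdet_cong: "(\<And>i. i < n \<Longrightarrow> f i = g i) \<Longrightarrow> vdet n y f = vdet n y g"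
  unfolding vdet_leibniz by (intro sum.cong arg_cong2[of _ _ _ _ "(*)"] prod.cong) auto

lemma vdet_permute:
  assumes p: "p permutes {..<n}"
  shows "vdet n y (\<lambda>i. f (p i)) = of_int (sign p) * vdet n y f"
proof -
  let ?A = "Matrix.mat n n (\<lambda>(i, j). y j ^ f i)"
  have "Matrix.mat n n (\<lambda>(i, j). y j ^ f (p i)) = Matrix.mat n n (\<lambda>(i, j). ?A $$ (p i, j))"
    using permutes_in_image[OF p] by (intro eq_matI) auto
  then show ?thesis
    using Determinant.det_permute_rows[of ?A n p] p by (simp add: vdet_def atLeast0LessThan)
qed

lemma vdet_eq_0: "\<not> inj_on f {..<n} \<Longrightarrow> vdet n y f = 0"
  unfolding inj_on_def vdet_def
  by (auto intro!: Determinant.det_identical_rows[of _ n] simp: Matrix.row_def)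

lemma vdet_shifted:
  assumes la: "la \<in> partitions_rows_le n"
  shows "vdet n y (shifted n la) = schur (\<lambda>i. (\<Sum>j<n. y j ^ i) / of_nat i) la * vdet n y (\<lambda>i. n - 1 - i)"
proof -
  have "Matrix.mat n n (\<lambda>(i, j). hsym n y (int (shifted n la i) - dlt n j))
      = Matrix.mat n n (\<lambda>(i, j). hsym n y (int (la i) - int i + int j))"
    by (rule eq_matI) (auto simp: shifted_def dlt_def of_nat_diff intro!: arg_cong[of _ _ "hsym n y"])
  then show ?thesis
    unfolding vdet_def bialternant[of n y "shifted n la"]
    by (simp add: schur_larger_det[OF partitions_rows_leD[OF la]] elem_schur_power_sums)
qed

text \<open>A Cauchy-Binet expansion. The exponential factors into series phi_j = \<Sum> y_j^k
  s_k(t), so the left side is the determinant of the product of the matrices (y_j^l) and (s_(l - dlt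
  n i)(t)) with l as summation index. Sorting the chosen indices l gives a partition and a
  permutation; the permutations assemble the determinant of s_la(t).\<close>

lemma cauchy_vdet:
  assumes n: "n > 0" and m: "wt w m \<le> N"
  shows "vdet n y (\<lambda>i. n - 1 - i) * mcoeff (mfps_exp (mlin (\<lambda>v. c v * (\<Sum>j<n. y j ^ w v)))) m
    = (\<Sum>la\<in>bounded_partitions n N. vdet n y (shifted n la) * mcoeff (schur t la) m)"
proof -
  let ?P = "{p. p permutes {..<n}}" and ?A = "{..<N + n}"
  define phi where "phi j = mfps_exp (mlin (\<lambda>v. c v * y j ^ w v))" for j
  define S where "S i l = elem_schur t (int l - dlt n i)" for i l
  have phi: "mcoeff (phi j) m = y j ^ wt w m * ecoef c m" for j m
  proof -
    have "(c v * y j ^ w v) ^ k / fact k = y j ^ (k * w v) * (c v ^ k / fact k)" for v k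
      by (simp add: power_mult_distrib power_mult[symmetric] mult.commute)
    then show ?thesis
      by (simp only: phi_def mcoeff_exp_mlin ecoef_def prod.distrib wt_def power_sum)
  qed
  have exp: "mfps_exp (mlin (\<lambda>v. c v * (\<Sum>j<n. y j ^ w v))) = (\<Prod>j<n. phi j)"
    unfolding phi_def sum_distrib_left by (rule exp_mlin_sum)
  \<comment> \<open>A term of weight at most N in row i carries the power l = weight + n - 1 - i,
    which is less than N + n.\<close>
  have row: "agree w N (mfps_const (y j ^ (n - 1 - i)) * phi j) (\<Sum>l\<in>?A. mfps_const (y j ^ l) * S i l)"
    if i: "i < n" for i j
    unfolding agree_def
  proof (intro allI impI)
    fix m assume m: "wt w m \<le> N"
    have "mcoeff (\<Sum>l\<in>?A. mfps_const (y j ^ l) * S i l) m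
        = (\<Sum>l\<in>?A. if l = wt w m + (n - 1 - i) then y j ^ l * ecoef c m else 0)"
      unfolding mcoeff_sum
      by (rule sum.cong) (use i in \<open>auto simp: S_def mcoeff_elem_schur' dlt_def\<close>)
    also have "\<dots> = y j ^ (wt w m + (n - 1 - i)) * ecoef c m"
      using m i by (simp add: sum.delta)
    finally show "mcoeff (mfps_const (y j ^ (n - 1 - i)) * phi j) m = mcoeff (\<Sum>l\<in>?A. mfps_const (y j ^ l) * S i l) m"
      by (simp add: phi power_add)
  qed
  have "mfps_const (vdet n y (\<lambda>i. n - 1 - i)) * (\<Prod>j<n. phi j)
      = (\<Sum>p\<in>?P. of_int (sign p) * (\<Prod>i<n. mfps_const (y (p i) ^ (n - 1 - i)) * phi (p i)))"
    unfolding vdet_leibniz mfps_const_sum sum_distrib_right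
  proof (rule sum.cong[OF refl])
    fix p assume "p \<in> ?P"
    then have p: "p permutes {..<n}" by simp
    have "(\<Prod>j<n. phi j) = (\<Prod>i<n. phi (p i))" using prod.permute[OF p, of phi] by (simp add: o_def)
    then show "mfps_const (of_int (sign p) * (\<Prod>i<n. y (p i) ^ (n - 1 - i))) * (\<Prod>j<n. phi j)
        = of_int (sign p) * (\<Prod>i<n. mfps_const (y (p i) ^ (n - 1 - i)) * phi (p i))"
      by (simp only: mfps_const_mult mfps_const_prod mfps_const_of_int prod.distrib mult.assoc)
  qed
  moreover have "agree w N (\<Sum>p\<in>?P. of_int (sign p) * (\<Prod>i<n. mfps_const (y (p i) ^ (n - 1 - i)) * phi (p i)))
      (\<Sum>p\<in>?P. of_int (sign p) * (\<Prod>i<n. \<Sum>l\<in>?A. mfps_const (y (p i) ^ l) * S i l))"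
    by (intro agree_sum agree_mult agree_prod row) (auto simp: agree_def)
  ultimately have 1: "mcoeff (mfps_const (vdet n y (\<lambda>i. n - 1 - i)) * (\<Prod>j<n. phi j)) m
      = mcoeff (\<Sum>p\<in>?P. of_int (sign p) * (\<Prod>i<n. \<Sum>l\<in>?A. mfps_const (y (p i) ^ l) * S i l)) m"
    using m by (simp add: agree_def)
  have "(\<Sum>p\<in>?P. of_int (sign p) * (\<Prod>i<n. \<Sum>l\<in>?A. mfps_const (y (p i) ^ l) * S i l))
      = (\<Sum>p\<in>?P. \<Sum>f\<in>{..<n} \<rightarrow>\<^sub>E ?A. of_int (sign p) * (\<Prod>i<n. mfps_const (y (p i) ^ f i) * S i (f i)))"
    by (simp add: prod_sum_PiE sum_distrib_left)
  also have "\<dots> = (\<Sum>f\<in>{..<n} \<rightarrow>\<^sub>E ?A. \<Sum>p\<in>?P. of_int (sign p) * (\<Prod>i<n. mfps_const (y (p i) ^ f i) * S i (f i)))"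
    by (rule sum.swap)
  also have "\<dots> = (\<Sum>f\<in>{..<n} \<rightarrow>\<^sub>E ?A. mfps_const (vdet n y f) * (\<Prod>i<n. S i (f i)))"
    by (simp only: vdet_leibniz mfps_const_sum sum_distrib_right mfps_const_mult mfps_const_prod mfps_const_of_int
        prod.distrib mult.assoc)
  also have "\<dots> = (\<Sum>f\<in>{f \<in> {..<n} \<rightarrow>\<^sub>E ?A. inj_on f {..<n}}. mfps_const (vdet n y f) * (\<Prod>i<n. S i (f i)))"
    by (rule sum.mono_neutral_right) (auto simp: vdet_eq_0 mfps_const_0 intro: finite_PiE)
  also have "\<dots> = (\<Sum>(la, p)\<in>bounded_partitions n N \<times> ?P.
      mfps_const (vdet n y (restrict (\<lambda>i. shifted n la (p i)) {..<n})) * (\<Prod>i<n. S i (restrict (\<lambda>i. shifted n la (p i)) {..<n} i)))"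
    unfolding case_prod_unfold
    by (rule sum.reindex_bij_betw[OF bij_betw_shifted[OF n, of N], unfolded case_prod_unfold, symmetric])
  also have "\<dots> = (\<Sum>la\<in>bounded_partitions n N. \<Sum>p\<in>?P.
      mfps_const (vdet n y (restrict (\<lambda>i. shifted n la (p i)) {..<n})) * (\<Prod>i<n. S i (restrict (\<lambda>i. shifted n la (p i)) {..<n} i)))"
    by (rule sum.cartesian_product[symmetric])
  also have "\<dots> = (\<Sum>la\<in>bounded_partitions n N. mfps_const (vdet n y (shifted n la)) * schur t la)"
  proof (rule sum.cong[OF refl])
    fix la assume "la \<in> bounded_partitions n N"
    then have la: "la \<in> partitions_rows_le n" by (simp add: bounded_partitions_def)
    show "(\<Sum>p\<in>?P. mfps_const (vdet n y (restrict (\<lambda>i. shifted n la (p i)) {..<n}))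
          * (\<Prod>i<n. S i (restrict (\<lambda>i. shifted n la (p i)) {..<n} i)))
        = mfps_const (vdet n y (shifted n la)) * schur t la"
      unfolding schur_leibniz[OF la] sum_distrib_left
    proof (rule sum.cong[OF refl])
      fix p assume "p \<in> ?P"
      then have p: "p permutes {..<n}" by simp
      have "vdet n y (restrict (\<lambda>i. shifted n la (p i)) {..<n}) = vdet n y (\<lambda>i. shifted n la (p i))"
        by (rule vdet_cong) simp
      also have "\<dots> = of_int (sign p) * vdet n y (shifted n la)" by (rule vdet_permute[OF p])
      finally have v: "mfps_const (vdet n y (restrict (\<lambda>i. shifted n la (p i)) {..<n}))
          = of_int (sign p) * mfps_const (vdet n y (shifted n la))"
        by (simp only: mfps_const_mult mfps_const_of_int)
      have "(\<Prod>i<n. S i (restrict (\<lambda>i. shifted n la (p i)) {..<n} i))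
          = (\<Prod>i<n. elem_schur t (int (la (p i)) - int (p i) + int i))"
      proof (rule prod.cong[OF refl])
        fix i assume i: "i \<in> {..<n}"
        then have "p i < n" using permutes_in_image[OF p] by blast
        then have "int (shifted n la (p i)) - dlt n i = int (la (p i)) - int (p i) + int i"
          using i by (simp add: shifted_def dlt_def of_nat_diff)
        then show "S i (restrict (\<lambda>i. shifted n la (p i)) {..<n} i) = elem_schur t (int (la (p i)) - int (p i) + int i)"
          using i by (simp add: S_def)
      qed
      then show "mfps_const (vdet n y (restrict (\<lambda>i. shifted n la (p i)) {..<n}))
          * (\<Prod>i<n. S i (restrict (\<lambda>i. shifted n la (p i)) {..<n} i))
        = mfps_const (vdet n y (shifted n la)) * (of_int (sign p) *
            (\<Prod>i<n. elem_schur t (int (la (p i)) - int (p i) + int i)))"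
        unfolding v by (simp only: mult_ac)
    qed
  qed
  finally show ?thesis using 1 by (simp add: exp mcoeff_sum)
qed

lemma continuous_schur_power_sums:
  assumes la: "la \<in> partitions_rows_le n" and y: "\<And>j. j < n \<Longrightarrow> continuous_on UNIV (\<lambda>e :: real. y e j)"
  shows "continuous_on UNIV (\<lambda>e :: real. schur (\<lambda>i. (\<Sum>j<n. y e j ^ i) / of_nat i) la :: complex)"
proof -
  have "continuous_on UNIV (\<lambda>e. fps_nth (hfps r (y e)) k)" if "r \<le> n" for r k
    using that
  proof (induction r arbitrary: k)
    case 0
    show ?case by (simp add: hfps_def)
  next
    case (Suc r)
    then show ?case
      by (auto simp: hfps_def fps_mult_nth geo_fps_def intro!: continuous_intros y)
  qed
  then have "continuous_on UNIV (\<lambda>e. hsym n (y e) k)" for k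
    by (cases "k < 0") (simp_all add: hsym_def)
  then show ?thesis
    unfolding schur_leibniz[OF la] elem_schur_power_sums by (intro continuous_intros)
qed

lemma vdet_nonzero:
  assumes "inj_on y {..<n}"
  shows "vdet n y (\<lambda>i. n - 1 - i) \<noteq> 0"
proof -
  define p where "p i = (if i < n then n - 1 - i else i)" for i
  have "bij_betw p {..<n} {..<n}"
    by (rule bij_betw_byWitness[of _ p]) (auto simp: p_def)
  then have p: "p permutes {..<n}"
    by (rule bij_imp_permutes) (auto simp: p_def)
  have "vdet n y (\<lambda>i. n - 1 - i) = vdet n y (\<lambda>i. id (p i))"
    by (rule vdet_cong) (simp add: p_def)
  also have "\<dots> = of_int (sign p) * (\<Prod>j<n. \<Prod>r<j. y j - y r)"
    unfolding vdet_permute[OF p] by (simp add: vdet_def det_vandermonde)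
  finally have *: "vdet n y (\<lambda>i. n - 1 - i) = of_int (sign p) * (\<Prod>j<n. \<Prod>r<j. y j - y r)" .
  have "y j - y r \<noteq> 0" if "j < n" "r < j" for j r
    using inj_onD[OF assms, of j r] that by auto
  then have "of_int (sign p) * (\<Prod>j<n. \<Prod>r<j. y j - y r) \<noteq> 0"
    by (auto simp: sign_def)
  then show ?thesis unfolding * .
qed

text \<open>For distinct y_j the Vandermonde determinant can be cancelled in
  \<open>cauchy_vdet\<close>. In general y_j is replaced by y_j + e j, which has distinct entries
  for all but finitely many real e; both sides are continuous in e, so e may tend to 0.\<close>

theorem cauchy_identity:
  assumes n: "n > 0" and m: "wt w m \<le> N"
  shows "mcoeff (mfps_exp (mlin (\<lambda>v. c v * (\<Sum>j<n. y j ^ w v)))) m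
    = (\<Sum>la\<in>bounded_partitions n N. schur (\<lambda>i. (\<Sum>j<n. y j ^ i) / of_nat i) la * mcoeff (schur t la) m)"
proof -
  define z where "z e j = y j + of_real (e * real j)" for e :: real and j
  define f where "f e = mcoeff (mfps_exp (mlin (\<lambda>v. c v * (\<Sum>j<n. z e j ^ w v)))) m" for e
  define g where "g e = (\<Sum>la\<in>bounded_partitions n N. schur (\<lambda>i. (\<Sum>j<n. z e j ^ i) / of_nat i) la * mcoeff (schur t la) m)" for e
  have z: "continuous_on UNIV (\<lambda>e. z e j)" for j
    unfolding z_def by (intro continuous_intros)
  have f: "continuous_on UNIV f"
    unfolding f_def mcoeff_exp_mlin ecoef_def by (intro continuous_intros z) auto
  have g: "continuous_on UNIV g"
    unfolding g_def
    by (intro continuous_intros continuous_schur_power_sums[of _ n] z) (auto simp: bounded_partitions_def)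
  have eq: "f e = g e" if "inj_on (z e) {..<n}" for e
  proof -
    have "vdet n (z e) (\<lambda>i. n - 1 - i) * f e = vdet n (z e) (\<lambda>i. n - 1 - i) * g e"
      unfolding f_def g_def cauchy_vdet[OF n m]
      unfolding sum_distrib_left
    proof (rule sum.cong[OF refl])
      fix la assume "la \<in> bounded_partitions n N"
      then have la: "la \<in> partitions_rows_le n" by (simp add: bounded_partitions_def)
      show "vdet n (z e) (shifted n la) * mcoeff (schur t la) m = vdet n (z e) (\<lambda>i. n - 1 - i) *
          (schur (\<lambda>i. (\<Sum>j<n. z e j ^ i) / of_nat i) la * mcoeff (schur t la) m)"
        unfolding vdet_shifted[OF la] by (simp only: mult_ac)
    qed
    then show ?thesis using vdet_nonzero[OF that] by simp
  qed
  have fin: "finite {e. \<not> inj_on (z e) {..<n}}"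
  proof -
    have "{e. \<not> inj_on (z e) {..<n}} \<subseteq> (\<Union>i<n. \<Union>j<n. {Re ((y i - y j) / of_real (real j - real i))})"
    proof
      fix e assume "e \<in> {e. \<not> inj_on (z e) {..<n}}"
      then obtain i j where ij: "i < n" "j < n" "i \<noteq> j" "z e i = z e j" by (auto simp: inj_on_def)
      then have "y i - y j = of_real e * of_real (real j - real i)"
        by (simp add: z_def algebra_simps)
      then have "e = Re ((y i - y j) / of_real (real j - real i))" using ij(3) by simp
      then show "e \<in> (\<Union>i<n. \<Union>j<n. {Re ((y i - y j) / of_real (real j - real i))})" using ij by blast
    qed
    then show ?thesis by (rule finite_subset) auto
  qed
  \<comment> \<open>The value 0 may itself be a collision; without it the finite set
    \<open>D\<close> has a complement that is a neighbourhood of 0.\<close>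
  define D where "D = {e. \<not> inj_on (z e) {..<n}} - {0}"
  have "open (- D)" unfolding D_def using fin by (intro open_Compl finite_imp_closed) simp
  then have "\<forall>\<^sub>F e in at 0. e \<noteq> 0 \<and> e \<in> - D"
    unfolding eventually_at_topological by (intro exI[of _ "- D"]) (auto simp: D_def)
  then have "\<forall>\<^sub>F e in at 0. f e = g e"
    by (rule eventually_mono) (auto simp: D_def eq)
  moreover have "(f \<longlongrightarrow> f 0) (at 0)" "(g \<longlongrightarrow> g 0) (at 0)"
    using f g by (auto simp: continuous_on_eq_continuous_at isCont_def)
  ultimately have "f 0 = g 0"
    by (metis tendsto_cong tendsto_unique trivial_limit_at)
  then show ?thesis by (simp add: f_def g_def z_def)
qed

end

subsection \<open>Class functions as evaluations\<close>

lemma csym_hdet: "Determinant.det (Matrix.mat n n (\<lambda>(i, j). hsym n (\<lambda>j. X j a) (k i j))) \<in> csym n"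
proof -
  have "Determinant.det (Matrix.mat n n (\<lambda>(i, j). hsym n (\<lambda>j. X j a) (k i j)))
      = (\<Sum>p | p permutes {0..<n}. of_int (sign p) * (\<Prod>i<n. hsym n (\<lambda>j. X j a) (k i (p i))))"
    by (subst Determinant.det_def'[of _ n])
      (auto intro!: sum.cong prod.cong simp: permutes_in_image atLeast0LessThan)
  also have "\<dots> \<in> csym n"
    unfolding of_int_cst by (intro csym_sum csym_mult csym_cst csym_prod csym_hsym)
  finally show ?thesis .
qed

text \<open>Multiplied by the staircase alternant, the product becomes a sum of alternants, each of
  which is a determinant of complete homogeneous polynomials times the same staircase alternant.
  That factor can be cancelled.\<close>

lemma csym_prod_1_add_X: "(\<Prod>i<n. 1 + X i 1) \<in> csym n"
proof -
  let ?h = "\<lambda>B i. n - 1 - i + of_bool (i \<in> B)"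
  let ?G = "\<lambda>B. Determinant.det (Matrix.mat n n (\<lambda>(i, j). hsym n (\<lambda>j. X j 1) (int (?h B i) - dlt n j)))"
  have alt: "alt n (\<lambda>i. int (k i)) = Determinant.det (Matrix.mat n n (\<lambda>(i, j). X j 1 ^ k i))" for k
    by (simp add: alt_def X_power)
  have dlt: "alt n (dlt n) = alt n (\<lambda>i. int (n - 1 - i))"
    by (rule alt_cong) (simp add: dlt_def of_nat_diff)
  have "(\<Prod>i<n. 1 + X i 1) * alt n (dlt n) = (\<Sum>B\<in>Pow {..<n}. alt n (\<lambda>i. int (?h B i)))"
    unfolding prod_1_add_X_mult_alt by (rule sum.cong[OF refl], rule alt_cong) (simp add: dlt_def of_nat_diff)
  also have "\<dots> = (\<Sum>B\<in>Pow {..<n}. ?G B) * alt n (dlt n)"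
    unfolding sum_distrib_right dlt alt by (rule sum.cong[OF refl], rule bialternant)
  finally have "(\<Prod>i<n. 1 + X i 1) = (\<Sum>B\<in>Pow {..<n}. ?G B)"
    using alt_dlt_nonzero[of n] by simp
  then show ?thesis by (simp add: csym_sum csym_hdet)
qed

lemma mat_pow_mat_cnj: "mat_pow (mat_cnj M) k = mat_cnj (mat_pow M k)"
proof (induction k)
  case 0
  show ?case by (auto simp: mat_pow_0 vec_eq_iff mat_cnj_nth mat_def)
next
  case (Suc k)
  show ?case by (simp add: mat_pow_Suc Suc vec_eq_iff mat_cnj_nth matrix_matrix_mult_def)
qed

lemma trace_mat_cnj: "trace (mat_cnj M) = cnj (trace M)"
  by (simp add: trace_def mat_cnj_nth)

lemma trace_mat_pow_mat_cnj:
  fixes M :: "complex^'n^'n"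
  assumes M: "M \<in> unitary_group"
  shows "trace (mat_pow (mat_cnj M) k) = (\<Sum>i<CARD('n). cnj (eig M i) ^ k)"
  unfolding mat_pow_mat_cnj trace_mat_cnj trace_mat_pow_eig[OF M] by simp

lemma schur_mat_eq_eval:
  fixes M :: "complex^'n^'n"
  assumes M: "M \<in> unitary_group" and la: "la \<in> partitions_rows_le CARD('n)"
  shows "schur_mat la M = leval CARD('n) (eig M) (slaur CARD('n) 1 la)"
    and "schur_mat la (mat_cnj M) = leval CARD('n) (eig M) (slaur CARD('n) (- 1) la)"
proof -
  note ev = eval_slaur[OF eig_nonzero[OF M] partitions_rows_leD[OF la]]
  show "schur_mat la M = leval CARD('n) (eig M) (slaur CARD('n) 1 la)"
    by (simp add: ev schur_mat_def trace_mat_pow_eig[OF M])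
  have "(\<Sum>i<CARD('n). cnj (eig M i) ^ k) = (\<Sum>i<CARD('n). (eig M i powi - 1) ^ k)" for k
    by (rule sum.cong) (simp_all add: cnj_eig[OF M] power_int_minus)
  then show "schur_mat la (mat_cnj M) = leval CARD('n) (eig M) (slaur CARD('n) (- 1) la)"
    by (simp only: ev schur_mat_def trace_mat_pow_mat_cnj[OF M])
qed

lemma evalU_power:
  fixes M :: "complex^'n^'n"
  assumes M: "M \<in> unitary_group"
  shows "leval CARD('n) (eig M) (f ^ k) = leval CARD('n) (eig M) f ^ k"
  by (induction k) (simp_all add: evalU_mult[OF M])

lemma det_eq_eval:
  fixes M :: "complex^'n^'n"
  assumes M: "M \<in> unitary_group"
  shows "Determinants.det (idm + M) = leval CARD('n) (eig M) (\<Prod>i<CARD('n). 1 + X i 1)"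
  by (simp add: det_eig[OF M] eval_prod[OF eig_nonzero[OF M]] eval_add eval_X)

lemma trace_cnj_eq_eval:
  fixes M :: "complex^'n^'n"
  assumes M: "M \<in> unitary_group"
  shows "trace (mat_cnj M) = leval CARD('n) (eig M) (psum CARD('n) (- 1))"
  using cnj_eig[OF M] by (simp add: trace_mat_cnj trace_mat_pow_eig[OF M, of 1, unfolded mat_pow_def, simplified]
      eval_psum power_int_minus)

text \<open>Only the polynomial part of the integrand; the exponential of z Tr(conj M) enters
  through powers of p_(-1).\<close>

definition integrand :: "nat \<Rightarrow> nat \<Rightarrow> (nat \<Rightarrow> nat) \<Rightarrow> (nat \<Rightarrow> nat) \<Rightarrow> laurent" where
  "integrand n q la mu = slaur n 1 la * slaur n (- 1) mu * (\<Prod>i<n. 1 + X i 1) ^ q"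

lemma csym_integrand: "integrand n q la mu \<in> csym n"
  unfolding integrand_def by (intro csym_mult csym_slaur csym_power csym_prod_1_add_X)

lemma integrand_eq_eval:
  fixes M :: "complex^'n^'n"
  assumes M: "M \<in> unitary_group" and la: "la \<in> partitions_rows_le CARD('n)" "mu \<in> partitions_rows_le CARD('n)"
  shows "schur_mat la M * schur_mat mu (mat_cnj M) * Determinants.det (idm + M) ^ q
    = leval CARD('n) (eig M) (integrand CARD('n) q la mu)"
  by (simp add: integrand_def evalU_mult[OF M] evalU_power[OF M] schur_mat_eq_eval[OF M] la det_eq_eval[OF M])

subsection \<open>The walk expansion\<close>

lemma walks_eq_gwalks: "walks q k x y = gwalks q k (map int x) (map int y)"
  by (simp add: walks_def gwalks_def)

text \<open>Parts are stored from index 0 and walkers from left to right, so part i belongs to the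
  walker with index n - 1 - i.\<close>

lemma altl_map_int:
  assumes x: "length x = n"
    and la: "\<forall>j\<in>{1..n}. int (la (n - j)) = int (x ! (j - 1)) - int j + 1" and i: "i < n"
  shows "int (la i) + dlt n i = map int x ! (n - 1 - i)"
  using la[rule_format, of "n - i"] i x by (simp add: dlt_def of_nat_diff)

text \<open>The two Vandermonde factors of Weyl's formula are the denominators of the two Schur
  functions, the one for conj M in the inverse variables. Only the alternants of the two end
  configurations remain.\<close>

lemma walk_integral:
  fixes H :: "(complex^'n^'n) measure"
  assumes haar: "normalized_haar H"
    and x: "length x = CARD('n)" "sorted_wrt (<) x"
    and y: "length y = CARD('n)" "sorted_wrt (<) y"
    and la: "\<forall>j\<in>{1..CARD('n)}. int (la (CARD('n) - j)) = int (x ! (j - 1)) - int j + 1"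
    and mu: "\<forall>j\<in>{1..CARD('n)}. int (mu (CARD('n) - j)) = int (y ! (j - 1)) - int j + 1"
  shows "(LINT M|H. leval CARD('n) (eig M) (integrand CARD('n) q la mu * psum CARD('n) (- 1) ^ k))
    = of_nat (num_walks q k x y)"
proof -
  let ?n = "CARD('n)"
  let ?E = "\<Prod>i<?n. 1 + X i 1" and ?p = "psum ?n (- 1)"
  have sx: "sorted_wrt (<) (map int x)" "sorted_wrt (<) (map int y)"
    using x(2) y(2) by (simp_all add: sorted_wrt_map)
  have A: "slaur ?n 1 la * alt ?n (dlt ?n) = altl (map int x)"
    using slaur_mult_alt[of ?n 1 la] altl_map_int[OF x(1) la]
    by (simp add: altl_def x(1)) (rule alt_cong, simp)
  have B: "slaur ?n (- 1) mu * alt ?n (\<lambda>i. - dlt ?n i) = alt ?n (\<lambda>i. - (map int y ! (?n - 1 - i)))"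
  proof -
    have "alt ?n (\<lambda>i. - 1 * (int (mu i) + dlt ?n i)) = alt ?n (\<lambda>i. - (map int y ! (?n - 1 - i)))"
      by (rule alt_cong) (simp only: altl_map_int[OF y(1) mu] mult_minus1)
    then show ?thesis using slaur_mult_alt[of ?n "- 1" mu] by (simp only: mult_minus1)
  qed
  have "alt ?n (dlt ?n) * (integrand ?n q la mu * ?p ^ k) * alt ?n (\<lambda>i. - dlt ?n i)
      = (slaur ?n 1 la * alt ?n (dlt ?n)) * (?E ^ q * ?p ^ k * (slaur ?n (- 1) mu * alt ?n (\<lambda>i. - dlt ?n i)))"
    by (simp only: integrand_def mult_ac)
  then have "fact ?n * (LINT M|H. leval ?n (eig M) (integrand ?n q la mu * ?p ^ k))
      = lookup (altl (map int x) * (?E ^ q * ?p ^ k * alt ?n (\<lambda>i. - (map int y ! (?n - 1 - i))))) 0"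
    unfolding A B using weyl_integration[OF haar, of "integrand ?n q la mu * ?p ^ k"]
    by (simp only: csym_mult csym_integrand csym_power csym_psum)
  also have "\<dots> = fact ?n * of_nat (card (gwalks q k (map int x) (map int y)))"
    using constant_term_walks[OF sx(2) _ sx(1), of ?n q k] x(1) y(1) by simp
  finally show ?thesis by (simp add: num_walks_def walks_eq_gwalks)
qed

lemma csym_bounded:
  fixes f :: laurent
  assumes "f \<in> csym CARD('n::finite)"
  shows "\<exists>B\<ge>0. \<forall>M\<in>(unitary_group :: (complex^'n^'n) set). cmod (leval CARD('n) (eig M) f) \<le> B"
proof -
  obtain F and G :: "complex^'n^'n \<Rightarrow> complex^'n^'n" where FG: "cls f F G"
    using csym_cls[OF assms] by blast
  have "continuous_on unitary_group F"
    using cls_continuous[OF FG] continuous_on_subset by blast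
  then have "bounded (F ` unitary_group)"
    by (intro compact_imp_bounded compact_continuous_image compact_unitary_group)
  then obtain B where B: "B > 0" "\<forall>z\<in>F ` unitary_group. cmod z \<le> B"
    unfolding bounded_pos by blast
  then show ?thesis using cls_eval[OF FG] by (intro exI[of _ B]) auto
qed

text \<open>Rewrites the integrand in the chosen eigenvalues, the form in which Weyl's formula
  applies.\<close>

lemma a_coeff_eq:
  fixes H :: "(complex^'n^'n) measure"
  assumes haar: "normalized_haar H"
    and la: "la \<in> partitions_rows_le CARD('n)" "mu \<in> partitions_rows_le CARD('n)"
  shows "a_coeff H q la mu z = (LINT M|H. leval CARD('n) (eig M) (integrand CARD('n) q la mu)
      * exp (z * leval CARD('n) (eig M) (psum CARD('n) (- 1))))"
  unfolding a_coeff_def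
  by (rule Bochner_Integration.integral_cong[OF refl])
    (simp add: space_haar[OF haar] integrand_eq_eval la trace_cnj_eq_eval)

text \<open>The exponential is expanded under the integral. The traces are bounded on the compact
  group, so B (|z| C)^k / k! dominates the terms and the sum may be exchanged with the
  integral.\<close>

lemma a_coeff_sums:
  fixes H :: "(complex^'n^'n) measure"
  assumes haar: "normalized_haar H"
    and x: "length x = CARD('n)" "sorted_wrt (<) x"
    and y: "length y = CARD('n)" "sorted_wrt (<) y"
    and la: "la \<in> partitions_rows_le CARD('n)" "\<forall>j\<in>{1..CARD('n)}. int (la (CARD('n) - j)) = int (x ! (j - 1)) - int j + 1"
    and mu: "mu \<in> partitions_rows_le CARD('n)" "\<forall>j\<in>{1..CARD('n)}. int (mu (CARD('n) - j)) = int (y ! (j - 1)) - int j + 1"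
  shows "(\<lambda>k. z ^ k / fact k * of_nat (num_walks q k x y)) sums a_coeff H q la mu z"
proof -
  let ?n = "CARD('n)"
  interpret prob_space H using haar by (simp add: normalized_haar_def)
  define F where "F M = leval ?n (eig M) (integrand ?n q la mu)" for M :: "complex^'n^'n"
  define T where "T M = leval ?n (eig M) (psum ?n (- 1))" for M :: "complex^'n^'n"
  obtain B where B: "B \<ge> 0" "\<And>M. M \<in> unitary_group \<Longrightarrow> cmod (F M) \<le> B"
    using csym_bounded[OF csym_integrand[of ?n q la mu]] unfolding F_def by blast
  obtain C where C: "C \<ge> 0" "\<And>M. M \<in> unitary_group \<Longrightarrow> cmod (T M) \<le> C"
    using csym_bounded[OF csym_psum[of ?n "- 1"]] unfolding T_def by blast
  define f where "f k M = z ^ k / fact k * (F M * T M ^ k)" for k M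
  have FT: "F M * T M ^ k = leval ?n (eig M) (integrand ?n q la mu * psum ?n (- 1) ^ k)" if "M \<in> space H" for M k
    using that by (simp add: F_def T_def space_haar[OF haar] evalU_mult evalU_power)
  have intFT: "integrable H (\<lambda>M. F M * T M ^ k)" for k
    using csym_integrable[OF haar csym_mult[OF csym_integrand csym_power[OF csym_psum]], of q la mu "- 1" k]
    by (subst Bochner_Integration.integrable_cong[OF refl FT])
  have int: "integrable H (f k)" for k
    unfolding f_def by (intro integrable_mult_right intFT)
  have bound: "cmod (f k M) \<le> B * ((cmod z * C) ^ k / fact k)" if "M \<in> unitary_group" for k M
  proof -
    have "cmod (f k M) = cmod z ^ k / fact k * (cmod (F M) * cmod (T M) ^ k)"
      by (simp add: f_def norm_mult norm_divide norm_power)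
    also have "\<dots> \<le> cmod z ^ k / fact k * (B * C ^ k)"
      by (intro mult_left_mono mult_mono power_mono B C that) (use B C in auto)
    finally show ?thesis by (simp add: power_mult_distrib mult_ac)
  qed
  have summ: "summable (\<lambda>k. B * ((cmod z * C) ^ k / fact k))"
    using summable_exp_generic[of "cmod z * C"] by (intro summable_mult) (simp add: scaleR_conv_of_real divide_inverse mult.commute)
  have "(\<lambda>k. LINT M|H. f k M) sums (LINT M|H. (suminf (\<lambda>k. f k M)))"
  proof (rule sums_integral[OF int])
    show "AE M in H. summable (\<lambda>k. norm (f k M))"
    proof (rule AE_I2)
      fix M assume "M \<in> space H"
      then have "M \<in> unitary_group" by (simp add: space_haar[OF haar])
      then have "norm (norm (f k M)) \<le> B * ((cmod z * C) ^ k / fact k)" for k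
        using bound[of M k] by simp
      then show "summable (\<lambda>k. norm (f k M))"
        by (rule summable_comparison_test'[OF summ])
    qed
    show "summable (\<lambda>k. LINT M|H. norm (f k M))"
    proof (rule summable_comparison_test'[OF summ])
      fix k
      have "(LINT M|H. norm (f k M)) \<le> (LINT M|H. B * ((cmod z * C) ^ k / fact k))"
      proof (rule integral_mono)
        show "norm (f k M) \<le> B * ((cmod z * C) ^ k / fact k)" if "M \<in> space H" for M
          using that by (intro bound) (simp add: space_haar[OF haar])
      qed (use int in simp_all)
      then show "norm (LINT M|H. norm (f k M)) \<le> B * ((cmod z * C) ^ k / fact k)"
        by (simp add: prob_space)
    qed
  qed
  moreover have "(LINT M|H. f k M) = z ^ k / fact k * of_nat (num_walks q k x y)" for k
  proof -
    have "(LINT M|H. f k M) = z ^ k / fact k * (LINT M|H. F M * T M ^ k)"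
      unfolding f_def by simp
    also have "(LINT M|H. F M * T M ^ k) = (LINT M|H. leval ?n (eig M) (integrand ?n q la mu * psum ?n (- 1) ^ k))"
      by (rule Bochner_Integration.integral_cong[OF refl FT])
    finally show ?thesis unfolding walk_integral[OF haar x y la(2) mu(2)] .
  qed
  moreover have "(LINT M|H. (suminf (\<lambda>k. f k M))) = a_coeff H q la mu z"
    unfolding a_coeff_eq[OF haar la(1) mu(1)]
  proof (rule Bochner_Integration.integral_cong[OF refl])
    fix M
    have "(\<lambda>k. F M * ((z * T M) ^ k /\<^sub>R fact k)) sums (F M * exp (z * T M))"
      by (intro sums_mult exp_converges)
    moreover have "F M * ((z * T M) ^ k /\<^sub>R fact k) = f k M" for k
      by (simp add: f_def scaleR_conv_of_real power_mult_distrib field_simps)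
    ultimately have "(\<lambda>k. f k M) sums (F M * exp (z * T M))" by simp
    from sums_unique[OF this, symmetric]
    show "suminf (\<lambda>k. f k M) = leval ?n (eig M) (integrand ?n q la mu) * exp (z * leval ?n (eig M) (psum ?n (- 1)))"
      unfolding F_def T_def .
  qed
  ultimately show ?thesis by simp
qed

subsection \<open>The generating function\<close>

definition t_weight :: "nat + nat \<Rightarrow> nat" where
  "t_weight v = (case v of Inl i \<Rightarrow> i | Inr _ \<Rightarrow> 0)"

definition s_weight :: "nat + nat \<Rightarrow> nat" where
  "s_weight v = (case v of Inl _ \<Rightarrow> 0 | Inr i \<Rightarrow> i)"

text \<open>Variables of the other family and those with index 0 have weight 0 and get the
  coefficient 0, as \<open>cauchy_identity\<close> demands. The coefficient -1 in
  \<open>s_coeff\<close> belongs to the argument -s.\<close>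

definition t_coeff :: "nat + nat \<Rightarrow> complex" where
  "t_coeff v = (if t_weight v = 0 then 0 else 1)"

definition s_coeff :: "nat + nat \<Rightarrow> complex" where
  "s_coeff v = (if s_weight v = 0 then 0 else - 1)"

lemma mlin_eqI:
  assumes "\<And>v. mcoeff f (single v (Suc 0)) = c v" "\<And>m. (\<And>v. m \<noteq> single v (Suc 0)) \<Longrightarrow> mcoeff f m = 0"
  shows "f = mlin c"
proof (rule mfps_eqI)
  fix m show "mcoeff f m = mcoeff (mlin c) m"
    using assms mcoeff_mlin_single[of c] mcoeff_mlin_eq_0[of m c]
    by (cases "\<exists>v. m = single v (Suc 0)") auto
qed

lemma t_var_mlin: "i > 0 \<Longrightarrow> t_var i = mlin (\<lambda>v. if t_weight v = i then t_coeff v else 0)"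
  by (rule mlin_eqI) (auto simp: t_var_def mfps_var_def t_weight_def t_coeff_def split: sum.splits)

lemma s_var_mlin: "i > 0 \<Longrightarrow> - s_var i = mlin (\<lambda>v. if s_weight v = i then s_coeff v else 0)"
  by (rule mlin_eqI) (auto simp: s_var_def mfps_var_def s_weight_def s_coeff_def split: sum.splits)

lemma power_trace_form_mlin:
  fixes M :: "complex^'n^'n"
  assumes M: "M \<in> unitary_group"
  shows "power_trace_form M = mlin (\<lambda>v. t_coeff v * (\<Sum>j<CARD('n). eig M j ^ t_weight v)
     + s_coeff v * (\<Sum>j<CARD('n). cnj (eig M j) ^ s_weight v))"
proof (rule mlin_eqI)
  define g :: "nat \<Rightarrow> (nat + nat) mfps" where "g i = mfps_const (trace (mat_pow M i)) * t_var i
        - mfps_const (trace (mat_pow (mat_cnj M) i)) * s_var i" for i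
  have g: "mcoeff (g i) m = (if m = single (Inl i) (Suc 0) then \<Sum>j<CARD('n). eig M j ^ i else 0)
      - (if m = single (Inr i) (Suc 0) then \<Sum>j<CARD('n). cnj (eig M j) ^ i else 0)" for i m
    by (simp add: g_def t_var_def s_var_def mfps_var_def trace_mat_pow_eig[OF M] trace_mat_pow_mat_cnj[OF M])
  have ptf: "mcoeff (power_trace_form M) m = (\<Sum>i | i \<in> {1..} \<and> mcoeff (g i) m \<noteq> 0. mcoeff (g i) m)" for m
    by (simp add: power_trace_form_def mfps_infsum_def g_def)
  show "mcoeff (power_trace_form M) (single v (Suc 0)) = t_coeff v * (\<Sum>j<CARD('n). eig M j ^ t_weight v)
     + s_coeff v * (\<Sum>j<CARD('n). cnj (eig M j) ^ s_weight v)" for v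
  proof -
    define i where "i = (case v of Inl i \<Rightarrow> i | Inr i \<Rightarrow> i)"
    have "mcoeff (power_trace_form M) (single v (Suc 0)) = (\<Sum>l\<in>{1..} \<inter> {i}. mcoeff (g l) (single v (Suc 0)))"
      unfolding ptf
      by (rule sum.mono_neutral_left) (auto simp: g i_def split: if_splits sum.splits)
    then show ?thesis
      by (cases v; cases "i = 0") (auto simp: i_def g t_coeff_def s_coeff_def t_weight_def s_weight_def)
  qed
  show "mcoeff (power_trace_form M) m = 0" if "\<And>v. m \<noteq> single v (Suc 0)" for m
    unfolding ptf by (rule sum.neutral) (simp add: g that)
qed

text \<open>The linear form is the sum of a part in t and a part in s, so its exponential is a
  product, and the Cauchy identity applies to each factor, once with the eigenvalues and once with
  their conjugates.\<close>

lemma mcoeff_exp_power_trace_form: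
  fixes M :: "complex^'n^'n"
  assumes M: "M \<in> unitary_group" and N1: "wt t_weight m \<le> N" and N2: "wt s_weight m \<le> N"
  shows "mcoeff (mfps_exp (power_trace_form M)) m
    = (\<Sum>(\<alpha>, \<beta>)\<in>bounded_partitions CARD('n) N \<times> bounded_partitions CARD('n) N.
        schur_mat \<alpha> M * schur_mat \<beta> (mat_cnj M) * mcoeff (schur t_var \<alpha> * schur (\<lambda>i. - s_var i) \<beta>) m)"
proof -
  let ?P = "bounded_partitions CARD('n) N"
  have n: "CARD('n) > 0" by simp
  have tc: "\<And>v. t_weight v = 0 \<Longrightarrow> t_coeff v = 0" and sc: "\<And>v. s_weight v = 0 \<Longrightarrow> s_coeff v = 0"
    by (simp_all add: t_coeff_def s_coeff_def)
  have T: "mcoeff (mfps_exp (mlin (\<lambda>v. t_coeff v * (\<Sum>j<CARD('n). eig M j ^ t_weight v)))) a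
      = (\<Sum>\<alpha>\<in>?P. schur_mat \<alpha> M * mcoeff (schur t_var \<alpha>) a)" if "wt t_weight a \<le> N" for a
    using cauchy_identity[OF t_var_mlin tc n that, of "eig M"]
    by (simp only: schur_mat_def trace_mat_pow_eig[OF M])
  have S: "mcoeff (mfps_exp (mlin (\<lambda>v. s_coeff v * (\<Sum>j<CARD('n). cnj (eig M j) ^ s_weight v)))) a
      = (\<Sum>\<beta>\<in>?P. schur_mat \<beta> (mat_cnj M) * mcoeff (schur (\<lambda>i. - s_var i) \<beta>) a)" if "wt s_weight a \<le> N" for a
    using cauchy_identity[OF s_var_mlin sc n that, of "\<lambda>j. cnj (eig M j)"]
    by (simp only: schur_mat_def trace_mat_pow_mat_cnj[OF M])
  have "mcoeff (mfps_exp (power_trace_form M)) m = (\<Sum>(a, b)\<in>splits m.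
      (\<Sum>\<alpha>\<in>?P. schur_mat \<alpha> M * mcoeff (schur t_var \<alpha>) a) *
      (\<Sum>\<beta>\<in>?P. schur_mat \<beta> (mat_cnj M) * mcoeff (schur (\<lambda>i. - s_var i) \<beta>) b))"
    unfolding power_trace_form_mlin[OF M] exp_mlin_add mcoeff_mult
  proof (rule sum.cong[OF refl], clarify)
    fix a b assume "(a, b) \<in> splits m"
    then have "wt t_weight a \<le> N" "wt s_weight b \<le> N"
      using N1 N2 by (auto simp: splits_def wt_add)
    then show "mcoeff (mfps_exp (mlin (\<lambda>v. t_coeff v * (\<Sum>j<CARD('n). eig M j ^ t_weight v)))) a *
        mcoeff (mfps_exp (mlin (\<lambda>v. s_coeff v * (\<Sum>j<CARD('n). cnj (eig M j) ^ s_weight v)))) b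
      = (\<Sum>\<alpha>\<in>?P. schur_mat \<alpha> M * mcoeff (schur t_var \<alpha>) a) *
        (\<Sum>\<beta>\<in>?P. schur_mat \<beta> (mat_cnj M) * mcoeff (schur (\<lambda>i. - s_var i) \<beta>) b)"
      by (simp only: T S)
  qed
  also have "\<dots> = (\<Sum>x\<in>splits m. \<Sum>y\<in>?P \<times> ?P. schur_mat (fst y) M * schur_mat (snd y) (mat_cnj M) *
      (mcoeff (schur t_var (fst y)) (fst x) * mcoeff (schur (\<lambda>i. - s_var i) (snd y)) (snd x)))"
    by (simp add: sum_product sum.cartesian_product case_prod_unfold mult_ac)
  also have "\<dots> = (\<Sum>y\<in>?P \<times> ?P. \<Sum>x\<in>splits m. schur_mat (fst y) M * schur_mat (snd y) (mat_cnj M) *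
      (mcoeff (schur t_var (fst y)) (fst x) * mcoeff (schur (\<lambda>i. - s_var i) (snd y)) (snd x)))"
    by (rule sum.swap)
  finally show ?thesis by (simp add: mcoeff_mult sum_distrib_left case_prod_unfold)
qed

lemma mcoeff_schur_mult_bounded:
  assumes ab: "\<alpha> \<in> partitions_rows_le n" "\<beta> \<in> partitions_rows_le n"
    and N: "wt t_weight m \<le> N" "wt s_weight m \<le> N"
    and nz: "mcoeff (schur t_var \<alpha> * schur (\<lambda>i. - s_var i) \<beta>) m \<noteq> 0"
  shows "\<alpha> \<in> bounded_partitions n N" "\<beta> \<in> bounded_partitions n N"
proof -
  have tc: "\<And>v. t_weight v = 0 \<Longrightarrow> t_coeff v = 0" and sc: "\<And>v. s_weight v = 0 \<Longrightarrow> s_coeff v = 0"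
    by (simp_all add: t_coeff_def s_coeff_def)
  obtain a b where "(a, b) \<in> splits m" "mcoeff (schur t_var \<alpha>) a * mcoeff (schur (\<lambda>i. - s_var i) \<beta>) b \<noteq> 0"
    using nz unfolding mcoeff_mult by (auto elim!: sum.not_neutral_contains_not_neutral)
  then have nz: "mcoeff (schur t_var \<alpha>) a \<noteq> 0" "mcoeff (schur (\<lambda>i. - s_var i) \<beta>) b \<noteq> 0"
    and "wt t_weight a \<le> N" "wt s_weight b \<le> N"
    using N by (auto simp: splits_def wt_add)
  then show "\<alpha> \<in> bounded_partitions n N" "\<beta> \<in> bounded_partitions n N"
    using mcoeff_schur_bounded[OF t_var_mlin tc ab(1) nz(1)] mcoeff_schur_bounded[OF s_var_mlin sc ab(2) nz(2)] by auto
qed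

text \<open>The bound \<open>N\<close> depends on the monomial but not on M, so the Cauchy expansion
  under the integral runs over one fixed finite set of pairs of partitions, and the integral can be
  taken term by term.\<close>

lemma generating_function:
  fixes H :: "(complex^'n^'n) measure"
  assumes haar: "normalized_haar H"
  shows "mfps_has_sum
        (\<lambda>(\<alpha>, \<beta>). mfps_const (a_coeff H q \<alpha> \<beta> z) * schur t_var \<alpha> * schur (\<lambda>i. - s_var i) \<beta>)
        (partitions_rows_le CARD('n) \<times> partitions_rows_le CARD('n))
        (mfps_integral H (\<lambda>M.
          mfps_const (Determinants.det (idm + M) ^ q
            * exp (z * trace (mat_cnj M)))
          * mfps_exp (power_trace_form M)))"
  unfolding mfps_has_sum_def
proof (intro allI)
  fix m :: "(nat + nat) \<Rightarrow>\<^sub>0 nat"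
  let ?n = "CARD('n)"
  let ?R = "partitions_rows_le ?n \<times> partitions_rows_le ?n"
  define N where "N = max (wt t_weight m) (wt s_weight m)"
  let ?P = "bounded_partitions ?n N \<times> bounded_partitions ?n N"
  define G where "G = (\<lambda>(\<alpha>, \<beta>). mfps_const (a_coeff H q \<alpha> \<beta> z) * schur t_var \<alpha> * schur (\<lambda>i. - s_var i) \<beta>)"
  define K where "K \<alpha> \<beta> = mcoeff (schur t_var \<alpha> * schur (\<lambda>i. - s_var i) \<beta>) m" for \<alpha> \<beta>
  define D where "D M = Determinants.det (idm + M) ^ q * exp (z * trace (mat_cnj M))"
    for M :: "complex^'n^'n"
  have N: "wt t_weight m \<le> N" "wt s_weight m \<le> N" by (simp_all add: N_def)
  have G: "mcoeff (G (\<alpha>, \<beta>)) m = a_coeff H q \<alpha> \<beta> z * K \<alpha> \<beta>" for \<alpha> \<beta>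
    by (simp add: G_def K_def mult.assoc)
  have PR: "?P \<subseteq> ?R" by (auto simp: bounded_partitions_def)
  have sub: "{i \<in> ?R. mcoeff (G i) m \<noteq> 0} \<subseteq> ?P"
    using mcoeff_schur_mult_bounded[OF _ _ N] by (auto simp: G K_def)
  have finP: "finite ?P" by (simp add: finite_bounded_partitions)
  have int: "integrable H (\<lambda>M. schur_mat \<alpha> M * schur_mat \<beta> (mat_cnj M) * D M)"
    if ab: "\<alpha> \<in> partitions_rows_le ?n" "\<beta> \<in> partitions_rows_le ?n" for \<alpha> \<beta>
  proof -
    obtain F and F' :: "complex^'n^'n \<Rightarrow> complex^'n^'n" where F: "cls (integrand ?n q \<alpha> \<beta>) F F'"
      using csym_cls[OF csym_integrand] by blast
    have "continuous_on UNIV F" using cls_continuous[OF F] by blast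
    moreover have "continuous_on UNIV (\<lambda>M :: complex^'n^'n. exp (z * cnj (trace M)))"
      by (intro continuous_intros continuous_trace)
    ultimately have "integrable H (\<lambda>M. F M * exp (z * cnj (trace M)))"
      by (intro haar_integrable[OF haar] continuous_on_mult)
    moreover have "F M * exp (z * cnj (trace M)) = schur_mat \<alpha> M * schur_mat \<beta> (mat_cnj M) * D M"
      if "M \<in> space H" for M
      using that integrand_eq_eval[OF _ ab, of M q] cls_eval[OF F, of M]
      by (simp add: D_def space_haar[OF haar] trace_mat_cnj mult.assoc)
    ultimately show ?thesis
      using Bochner_Integration.integrable_cong[of H H "\<lambda>M. F M * exp (z * cnj (trace M))"
          "\<lambda>M. schur_mat \<alpha> M * schur_mat \<beta> (mat_cnj M) * D M"] by simp
  qed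
  have "mcoeff (mfps_integral H (\<lambda>M. mfps_const (D M) * mfps_exp (power_trace_form M))) m
      = (LINT M|H. D M * mcoeff (mfps_exp (power_trace_form M)) m)"
    by (simp add: mfps_integral_def)
  also have "\<dots> = (LINT M|H. (\<Sum>y\<in>?P. (schur_mat (fst y) M * schur_mat (snd y) (mat_cnj M) * D M) * K (fst y) (snd y)))"
    by (rule Bochner_Integration.integral_cong[OF refl])
      (simp add: space_haar[OF haar] mcoeff_exp_power_trace_form[OF _ N] sum_distrib_left K_def case_prod_unfold mult_ac)
  also have "\<dots> = (\<Sum>y\<in>?P. LINT M|H. (schur_mat (fst y) M * schur_mat (snd y) (mat_cnj M) * D M) * K (fst y) (snd y))"
    by (rule Bochner_Integration.integral_sum) (use PR in \<open>auto intro!: integrable_mult_left int\<close>)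
  also have "\<dots> = (\<Sum>y\<in>?P. mcoeff (G y) m)"
  proof (rule sum.cong[OF refl])
    fix y
    have "a_coeff H q (fst y) (snd y) z = (LINT M|H. schur_mat (fst y) M * schur_mat (snd y) (mat_cnj M) * D M)"
      by (simp add: a_coeff_def D_def mult.assoc)
    then show "(LINT M|H. (schur_mat (fst y) M * schur_mat (snd y) (mat_cnj M) * D M) * K (fst y) (snd y))
        = mcoeff (G y) m"
      using G[of "fst y" "snd y"] by simp
  qed
  also have "\<dots> = (\<Sum>y | y \<in> ?R \<and> mcoeff (G y) m \<noteq> 0. mcoeff (G y) m)"
    by (rule sum.mono_neutral_right[OF finP]) (use sub PR in auto)
  finally show "finite {i \<in> ?R. mcoeff (case i of (\<alpha>, \<beta>) \<Rightarrow> mfps_const (a_coeff H q \<alpha> \<beta> z) * schur t_var \<alpha> * schur (\<lambda>i. - s_var i) \<beta>) m \<noteq> 0} \<and>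
      mcoeff (mfps_integral H (\<lambda>M.
          mfps_const (Determinants.det (idm + M) ^ q
            * exp (z * trace (mat_cnj M)))
          * mfps_exp (power_trace_form M))) m
      = (\<Sum>i | i \<in> ?R \<and> mcoeff (case i of (\<alpha>, \<beta>) \<Rightarrow> mfps_const (a_coeff H q \<alpha> \<beta> z) * schur t_var \<alpha> * schur (\<lambda>i. - s_var i) \<beta>) m \<noteq> 0.
          mcoeff (case i of (\<alpha>, \<beta>) \<Rightarrow> mfps_const (a_coeff H q \<alpha> \<beta> z) * schur t_var \<alpha> * schur (\<lambda>i. - s_var i) \<beta>) m)"
    using finite_subset[OF sub finP] unfolding G_def D_def by simp
qed

theorem mainTheorem5:
  fixes H :: "(complex^'n^'n) measure"
    and q :: nat and z :: complex
    and x y :: "nat list" and la mu :: "nat \<Rightarrow> nat"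
  assumes haar: "normalized_haar H"
    and x: "length x = CARD('n)" "sorted_wrt (<) x"
    and y: "length y = CARD('n)" "sorted_wrt (<) y"
    and la: "is_partition la" "num_rows la \<le> CARD('n)"
      "\<forall>j\<in>{1..CARD('n)}. int (la (CARD('n) - j)) = int (x ! (j - 1)) - int j + 1"
    and mu: "is_partition mu" "num_rows mu \<le> CARD('n)"
      "\<forall>j\<in>{1..CARD('n)}. int (mu (CARD('n) - j)) = int (y ! (j - 1)) - int j + 1"
  shows "(\<forall>k. \<forall>w\<in>walks q k x y. int (effective_moves w)
            = 2 * int k + (\<Sum>i<CARD('n). int (y ! i) - int (x ! i)))
    \<and> (\<lambda>k. z ^ k / fact k * of_nat (num_walks q k x y)) sums a_coeff H q la mu z
    \<and> mfps_has_sum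
        (\<lambda>(\<alpha>, \<beta>). mfps_const (a_coeff H q \<alpha> \<beta> z) * schur t_var \<alpha> * schur (\<lambda>i. - s_var i) \<beta>)
        (partitions_rows_le CARD('n) \<times> partitions_rows_le CARD('n))
        (mfps_integral H (\<lambda>M.
          mfps_const (Determinants.det (Finite_Cartesian_Product.mat 1 + M) ^ q
            * exp (z * Determinants.trace (mat_cnj M)))
          * mfps_exp (power_trace_form M)))"
proof (intro conjI allI ballI)
  fix k w assume "w \<in> walks q k x y"
  then have "int (effective_moves w) = 2 * int k + (\<Sum>i<length (map int x). map int y ! i - map int x ! i)"
    unfolding walks_eq_gwalks by (rule effective_moves_eq)
  also have "(\<Sum>i<length (map int x). map int y ! i - map int x ! i) = (\<Sum>i<CARD('n). int (y ! i) - int (x ! i))"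
    by (rule sum.cong) (simp_all add: x y)
  finally show "int (effective_moves w) = 2 * int k + (\<Sum>i<CARD('n). int (y ! i) - int (x ! i))" .
next
  have "la \<in> partitions_rows_le CARD('n)" "mu \<in> partitions_rows_le CARD('n)"
    using la mu by (simp_all add: partitions_rows_le_def)
  then show "(\<lambda>k. z ^ k / fact k * of_nat (num_walks q k x y)) sums a_coeff H q la mu z"
    using la mu by (intro a_coeff_sums haar x y) simp_all
qed (rule generating_function[OF haar])

end
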